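(* Let $d\ge1$ and let $V:\mathbb{H}^d\to\mathbb{C}$ be a measurable function for which there exists $a<1$ such that $$\int_{\mathbb{H}^d}|V||\psi|^2\le a\int_{\mathbb{H}^d}|\nabla_{\mathbb{H}}\psi|^2\qquad\text{for all }\psi\in H^1(\mathbb{H}^d).$$ Assume that $$\int_{\mathbb{H}^d}\frac{|(z,t)|_{\mathbb{H}}^4}{|z|^2}|V|^2|\psi|^2\le b^2\int_{\mathbb{H}^d}|\nabla_{\mathbb{H}}\psi|^2\qquad\text{for all }\psi\in H^1(\mathbb{H}^d),$$ for some constant $b>0$ satisfying $$b<\frac{1}{d\,\kappa_d}.$$ Then $\mathcal{L}+V$ has no radial eigenfunctions; that is, if $u\in H^1(\mathbb{H}^d)$ is a radial weak solution of $(\mathcal{L}+V)u=\lambda u$ for some $\lambda\in\mathbb{C}$, then $u\equiv0$.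
   Context: $\mathbb{H}^d=\mathbb{C}^d\times\mathbb{R}$ is the Heisenberg group, with points $(z,t)$, $z=x+iy$ identified with $(x,y)\in\mathbb{R}^{2d}$, equipped with Lebesgue measure $dz\,dt$. The Koranyi norm is $|(z,t)|_{\mathbb{H}}=(|z|^4+t^2)^{1/4}$. The left-invariant vector fields are $X_j=\partial_{x_j}+2y_j\partial_t$, $Y_j=\partial_{y_j}-2x_j\partial_t$ ($j=1,\dots,d$); the horizontal gradient is $\nabla_{\mathbb{H}}=(X_1,\dots,X_d,Y_1,\dots,Y_d)$ and the sublaplacian is $\mathcal{L}=-\sum_{j=1}^d(X_j^2+Y_j^2)$. $\|\cdot\|$ is the norm of $L^2(\mathbb{H}^d)$, and $H^1(\mathbb{H}^d)$ is the space of $u:\mathbb{H}^d\to\mathbb{C}$ with $(\|u\|^2+\|\nabla_{\mathbb{H}}u\|^2)^{1/2}<\infty$ (derivatives in the weak sense). $\mathcal{L}+V$ is the $m$-sectorial operator on $L^2(\mathbb{H}^d)$ associated with the closed quadratic form $\psi\mapsto\int|\nabla_{\mathbb{H}}\psi|^2+\int V|\psi|^2$ with domain $H^1(\mathbb{H}^d)$. A weak solution of $(\mathcal{L}+V)u=\lambda u$ is $u\in H^1(\mathbb{H}^d)$ with $\langle\nabla_{\mathbb{H}}v,\nabla_{\mathbb{H}}u\rangle+\langle v,Vu\rangle=\lambda\langle v,u\rangle$ for all $v\in H^1(\mathbb{H}^d)$, where $\langle v,u\rangle=\int\overline{v}\,u\,dz\,dt$ and $\langle v,Vu\rangle=\int\overline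 vVu\,dz\,dt$. A function $g:\mathbb{H}^d\to\mathbb{C}$ is radial if there is $g_0:[0,+\infty)\to\mathbb{C}$ with $g(z,t)=g_0(|(z,t)|_{\mathbb{H}})$. The constant $\kappa_d$ is $$\kappa_d:=\min_{\delta>0}\max\left\{\frac{1+1/\delta}{d^2},\ \frac{K_d(\delta)}{d}\right\},\qquad K_d(\delta):=\min_{\gamma>0}\left(\frac{8d+2+\gamma\sqrt\delta}{4d}+\sqrt{\frac{(8d+2+\gamma\sqrt\delta)^2}{16d^2}+\frac{\sqrt\delta}{2\gamma}}\right);$$ equivalently, $\kappa_d$ is the unique positive solution of $\dfrac{\kappa_d^{-2}}{\sqrt{d^2-\kappa_d^{-1}}}+(4d+1)\kappa_d^{-1}=d^2$. *)

theory Defs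
  imports "HOL-Analysis.Analysis"
begin

text \<open>
  The Heisenberg group is \<open>\<complex>\<^sup>d \<times> \<real>\<close> with \<open>d = CARD('d)\<close>, carrying the Lebesgue measure of the
  underlying Euclidean space. The group law enters only through the left-invariant vector fields.
\<close>

type_synonym 'd heis = "(complex ^ 'd) \<times> real"

definition koranyi_norm :: "'d::finite heis \<Rightarrow> real" where
  "koranyi_norm p = root 4 (norm (fst p) ^ 4 + (snd p)\<^sup>2)"

definition radial :: "('d::finite heis \<Rightarrow> complex) \<Rightarrow> bool" where
  "radial g \<longleftrightarrow> (\<exists>g0 :: real \<Rightarrow> complex. \<forall>p. g p = g0 (koranyi_norm p))"

text \<open>
  The horizontal frame is indexed by \<open>'d + 'd\<close>: \<open>Inl j\<close> stands for
  \<open>X\<^sub>j = \<partial>\<^bsub>x\<^sub>j\<^esub> + 2 y\<^sub>j \<partial>\<^sub>t\<close> and \<open>Inr j\<close> for \<open>Y\<^sub>j = \<partial>\<^bsub>y\<^sub>j\<^esub> - 2 x\<^sub>j \<partial>\<^sub>t\<close>, where \<open>z\<^sub>j = x\<^sub>j + \<i> y\<^sub>j\<close>.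
\<close>

definition horizontal_field :: "'d + 'd \<Rightarrow> 'd::finite heis \<Rightarrow> 'd heis" where
  "horizontal_field k p =
     (case k of
        Inl j \<Rightarrow> (axis j 1, 2 * Im (fst p $ j))
      | Inr j \<Rightarrow> (axis j \<i>, - 2 * Re (fst p $ j)))"

definition field_deriv ::
    "'d + 'd \<Rightarrow> ('d::finite heis \<Rightarrow> complex) \<Rightarrow> 'd heis \<Rightarrow> complex" where
  "field_deriv k \<phi> p = frechet_derivative \<phi> (at p) (horizontal_field k p)"

text \<open>
  In finite dimension a function is \<open>C\<^bsup>n+1\<^esup>\<close> iff it is differentiable and all its directional
  derivatives are \<open>C\<^sup>n\<close>.
\<close>

primrec Ck :: "nat \<Rightarrow> ('a::euclidean_space \<Rightarrow> 'b::real_normed_vector) \<Rightarrow> bool" where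
  "Ck 0 f \<longleftrightarrow> continuous_on UNIV f"
| "Ck (Suc n) f \<longleftrightarrow>
     (\<forall>x. f differentiable (at x)) \<and> (\<forall>v. Ck n (\<lambda>x. frechet_derivative f (at x) v))"

definition test_function :: "('d::finite heis \<Rightarrow> complex) \<Rightarrow> bool" where
  "test_function \<phi> \<longleftrightarrow> (\<forall>n. Ck n \<phi>) \<and> compact (closure {p. \<phi> p \<noteq> 0})"

definition L2 :: "('d::finite heis \<Rightarrow> complex) set" where
  "L2 = {f \<in> borel_measurable lebesgue. integrable lebesgue (\<lambda>p. (norm (f p))\<^sup>2)}"

definition L2_inner :: "('d::finite heis \<Rightarrow> complex) \<Rightarrow> ('d heis \<Rightarrow> complex) \<Rightarrow> complex" where
  "L2_inner v u = (LINT p|lebesgue. cnj (v p) * u p)"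

text \<open>
  The fields \<open>X\<^sub>j\<close>, \<open>Y\<^sub>j\<close> are divergence free, so their formal adjoints are \<open>- X\<^sub>j\<close>, \<open>- Y\<^sub>j\<close>.
\<close>

definition has_weak_deriv ::
    "'d + 'd \<Rightarrow> ('d::finite heis \<Rightarrow> complex) \<Rightarrow> ('d heis \<Rightarrow> complex) \<Rightarrow> bool" where
  "has_weak_deriv k u w \<longleftrightarrow>
     (\<forall>\<phi>. test_function \<phi> \<longrightarrow>
        (LINT p|lebesgue. u p * field_deriv k \<phi> p) = - (LINT p|lebesgue. w p * \<phi> p))"

definition H1 :: "('d::finite heis \<Rightarrow> complex) set" where
  "H1 = {u \<in> L2. \<forall>k. \<exists>w\<in>L2. has_weak_deriv k u w}"

text \<open>
  A weak derivative in \<open>L\<^sup>2\<close> is unique up to null sets, hence integrals of \<open>hgrad u\<close> do not depend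
  on the representative selected here.
\<close>

definition weak_deriv :: "'d + 'd \<Rightarrow> ('d::finite heis \<Rightarrow> complex) \<Rightarrow> 'd heis \<Rightarrow> complex" where
  "weak_deriv k u = (SOME w. w \<in> L2 \<and> has_weak_deriv k u w)"

definition hgrad :: "('d::finite heis \<Rightarrow> complex) \<Rightarrow> 'd heis \<Rightarrow> complex ^ ('d + 'd)" where
  "hgrad u p = (\<chi> k. weak_deriv k u p)"

definition hgrad_inner :: "('d::finite heis \<Rightarrow> complex) \<Rightarrow> ('d heis \<Rightarrow> complex) \<Rightarrow> complex" where
  "hgrad_inner v u = (LINT p|lebesgue. (\<Sum>k\<in>UNIV. cnj (hgrad v p $ k) * hgrad u p $ k))"

definition dirichlet_energy :: "('d::finite heis \<Rightarrow> complex) \<Rightarrow> real" where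
  "dirichlet_energy \<psi> = (LINT p|lebesgue. (norm (hgrad \<psi> p))\<^sup>2)"

text \<open>
  The inequality \<open>\<integral> W |\<psi>|\<^sup>2 \<le> c \<integral> |\<nabla>\<psi>|\<^sup>2\<close> on the whole form domain; for a nonnegative weight,
  integrability says that the left-hand side is finite.
\<close>

definition form_bounded :: "('d::finite heis \<Rightarrow> real) \<Rightarrow> real \<Rightarrow> bool" where
  "form_bounded W c \<longleftrightarrow>
     (\<forall>\<psi>\<in>H1. integrable lebesgue (\<lambda>p. W p * (norm (\<psi> p))\<^sup>2) \<and>
              (LINT p|lebesgue. W p * (norm (\<psi> p))\<^sup>2) \<le> c * dirichlet_energy \<psi>)"

definition weak_solution ::
    "('d::finite heis \<Rightarrow> complex) \<Rightarrow> complex \<Rightarrow> ('d heis \<Rightarrow> complex) \<Rightarrow> bool" where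
  "weak_solution V ev u \<longleftrightarrow>
     u \<in> H1 \<and>
     (\<forall>v\<in>H1. hgrad_inner v u + L2_inner v (\<lambda>p. V p * u p) = ev * L2_inner v u)"

text \<open>
  Both minima below are attained: the functions are continuous and tend to infinity as the
  parameter tends to 0 or to infinity. Hence each minimum is the infimum.
\<close>

definition K_const :: "nat \<Rightarrow> real \<Rightarrow> real" where
  "K_const d \<delta> =
     (INF \<gamma>\<in>{0<..}.
        (8 * real d + 2 + \<gamma> * sqrt \<delta>) / (4 * real d) +
        sqrt ((8 * real d + 2 + \<gamma> * sqrt \<delta>)\<^sup>2 / (16 * (real d)\<^sup>2) + sqrt \<delta> / (2 * \<gamma>)))"

definition kappa :: "nat \<Rightarrow> real" where
  "kappa d = (INF \<delta>\<in>{0<..}. max ((1 + 1 / \<delta>) / (real d)\<^sup>2) (K_const d \<delta> / real d))"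

end

theory Submission
  imports Defs
begin

text \<open>
  Write \<open>R = |z|\<^sup>2\<close>, \<open>N = |(z,t)|\<^sup>4 = R\<^sup>2 + t\<^sup>2\<close> and \<open>u = f(N)\<close>, and let \<open>E\<close> be the energy
  \<open>\<integral> |\<nabla>u|\<^sup>2\<close> of a radial solution. The proof tests the equation against \<open>v = q u\<close> with the single
  multiplier \<open>q = R\<^sup>2/N - d/(d+1)\<close>, which has three properties.

  \<^item> It is homogeneous of degree zero and \<open>\<nabla>q \<sqdot> \<nabla>N = 0\<close>, because \<open>|\<nabla>N|\<^sup>2 = 16 N R\<close> and
    \<open>\<nabla>R \<sqdot> \<nabla>N = 8 R\<^sup>2\<close> (\<open>gradient_products\<close>). Hence \<open>\<nabla>v \<sqdot> \<nabla>u = q |\<nabla>u|\<^sup>2 = 16 q N R |f'(N)|\<^sup>2\<close>.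

  \<^item> Its mean over Koranyi spheres is zero, so \<open>\<langle>v, u\<rangle> = \<integral> q |u|\<^sup>2 = 0\<close>: the eigenvalue drops out of
    the tested equation, whatever complex number it is.

  \<^item> Its mean weighted by \<open>R\<close> is \<open>c\<^sub>1 = 1/((d+1)(d+2)) > 0\<close>, so \<open>\<langle>\<nabla>v, \<nabla>u\<rangle> = c\<^sub>1 E\<close>.

  All such means follow from \<open>moment_identity_C1\<close> and \<open>moment_identity\<close>: over a Koranyi sphere,
  the weight \<open>R\<^sup>m\<close> gives \<open>R\<^sup>2/N\<close> the mean \<open>(d+m)/(d+m+1)\<close>. This comes from the divergence theorem
  for the horizontal fields \<open>\<phi>(N) R\<^sup>m \<nabla>R\<close> and \<open>\<phi>(N) R\<^sup>m \<nabla>N\<close>.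

  What remains of the tested equation is \<open>c\<^sub>1 E = - \<integral> q V |u|\<^sup>2\<close>. Splitting the right-hand side as
  \<open>((N/R)\<^bsup>1/2\<^esup> |V| |u|) ((R/N)\<^bsup>1/2\<^esup> |q| |u|)\<close>, the weighted bound on \<open>V\<close> controls the first factor
  by \<open>b\<^sup>2 E\<close>. For the second one, \<open>\<integral> q\<^sup>2 (R/N) |u|\<^sup>2 = c\<^sub>2 \<integral> (R/N) |u|\<^sup>2\<close> with \<open>c\<^sub>2 =
  (2d\<^sup>2+2d+3)/((d+4)(d+2)(d+1)\<^sup>2)\<close> (\<open>multiplier_square_integral\<close>), and the Hardy inequality \<open>\<integral>
  (R/N) |u|\<^sup>2 \<le> E/d\<^sup>2\<close> (\<open>hardy_inequality_radial\<close>) applies. Together, \<open>c\<^sub>1 E \<le> b \<surd>c\<^sub>2 E / d\<close>. The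
  hypothesis on \<open>b\<close> gives \<open>b < 1/4\<close>, since \<open>\<kappa>\<^sub>d \<ge> 4/d\<close> (\<open>kappa_lower_bound\<close>); then \<open>b \<surd>c\<^sub>2 / d <
  c\<^sub>1\<close> for every \<open>d\<close> (\<open>contraction_constant\<close>). So \<open>E = 0\<close>, and by Hardy \<open>u = 0\<close>.

  The test function has to be cut off near the origin and near infinity, and this needs \<open>f\<close> to be
  continuously differentiable on \<open>(0, \<infinity>)\<close>. A priori \<open>u\<close> is only almost everywhere equal to a
  radial function. Testing against smooth radial functions shows that the flux of \<open>\<nabla>u\<close> through the
  Koranyi spheres has a continuous density (\<open>radial_flux\<close>); this density determines a \<open>C\<^sup>1\<close>
  profile up to a constant, and \<open>u\<close> agrees with it (\<open>radial_solution_profile\<close>). Polar coordinates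
  enter only through \<open>polar_formula\<close>, which is obtained from the divergence theorem as well.
\<close>

section \<open>Functions of class \<open>C\<^sup>n\<close>\<close>

lemma Ck_Suc_imp_Ck: "Ck (Suc n) f \<Longrightarrow> Ck n f"
proof (induction n arbitrary: f)
  case 0
  then show ?case
    by (auto intro!: continuous_at_imp_continuous_on differentiable_imp_continuous_within)
next
  case (Suc n)
  then show ?case by (metis Ck.simps(2))
qed

lemma Ck_le: "Ck n f \<Longrightarrow> m \<le> n \<Longrightarrow> Ck m f"
  by (induction n) (auto simp: le_Suc_eq dest: Ck_Suc_imp_Ck simp del: Ck.simps)

lemma Ck_imp_continuous: "Ck n f \<Longrightarrow> continuous_on S f"
  using Ck_le[of n f 0] continuous_on_subset by fastforce

text \<open>
  Exhibiting a derivative and its regularity suffices; the closure properties of \<open>C\<^sup>n\<close> below rest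
  on this rule.
\<close>

lemma Ck_SucI:
  assumes "\<And>x. (f has_derivative f' x) (at x)" "\<And>v. Ck n (\<lambda>x. f' x v)"
  shows "Ck (Suc n) f"
proof -
  have "frechet_derivative f (at x) = f' x" for x
    using frechet_derivative_at[OF assms(1)] by simp
  then show ?thesis using assms by (auto simp: differentiable_def)
qed

lemma Ck_Suc_has_derivative:
  "Ck (Suc n) f \<Longrightarrow> (f has_derivative frechet_derivative f (at x)) (at x)"
  by (simp add: frechet_derivative_works[symmetric])

lemma Ck_const: "Ck n (\<lambda>x. c)"
proof (induction n arbitrary: c)
  case (Suc n)
  then show ?case by (intro Ck_SucI[where f' = "\<lambda>_ _. 0"]) auto
qed simp

lemma Ck_bounded_linear: "bounded_linear f \<Longrightarrow> Ck n f"
proof (cases n)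
  case (Suc m)
  assume "bounded_linear f"
  then show ?thesis unfolding Suc
    by (intro Ck_SucI[where f' = "\<lambda>_. f"] Ck_const bounded_linear_imp_has_derivative)
qed (simp add: linear_continuous_on)

lemma Ck_add:
  assumes "Ck n f" "Ck n g" shows "Ck n (\<lambda>x. f x + g x)"
  using assms
proof (induction n arbitrary: f g)
  case (Suc n)
  then show ?case
    by (intro Ck_SucI[where f' = "\<lambda>x v. frechet_derivative f (at x) v + frechet_derivative g (at x) v"])
       (auto intro!: has_derivative_add simp: frechet_derivative_works[symmetric])
qed (auto intro!: continuous_intros)

lemma Ck_bilinear:
  assumes "bounded_bilinear pr" "Ck n f" "Ck n g" shows "Ck n (\<lambda>x. pr (f x) (g x))"
  using assms(2,3)
proof (induction n arbitrary: f g)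
  case 0
  then show ?case using bounded_bilinear.continuous_on[OF assms(1)] by simp
next
  case (Suc n)
  have "Ck n f" "Ck n g" using Suc.prems by (auto intro: Ck_Suc_imp_Ck simp del: Ck.simps)
  then show ?case using Suc
    by (intro Ck_SucI[where f' = "\<lambda>x v. pr (f x) (frechet_derivative g (at x) v) + pr (frechet_derivative f (at x) v) (g x)"]
         Ck_add)
       (auto intro!: bounded_bilinear.FDERIV[OF assms(1)] simp: frechet_derivative_works[symmetric])
qed

lemmas Ck_scaleR = Ck_bilinear[OF bounded_bilinear_scaleR]
lemmas Ck_mult = Ck_bilinear[OF bounded_bilinear_mult]

lemma Ck_linear_comp:
  assumes "bounded_linear L" "Ck n f" shows "Ck n (\<lambda>x. L (f x))"
  using assms(2)
proof (induction n arbitrary: f)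
  case 0
  then show ?case using bounded_linear.continuous_on[OF assms(1)] by simp
next
  case (Suc n)
  then show ?case
    by (intro Ck_SucI[where f' = "\<lambda>x v. L (frechet_derivative f (at x) v)"])
       (auto intro!: bounded_linear.has_derivative[OF assms(1)] simp: frechet_derivative_works[symmetric])
qed

lemma Ck_diff: "Ck n f \<Longrightarrow> Ck n g \<Longrightarrow> Ck n (\<lambda>x. f x - g x)"
  using Ck_add[of n f "\<lambda>x. - g x"] Ck_linear_comp[OF bounded_linear_minus[OF bounded_linear_ident], of n g]
  by simp

lemma Ck_power: "Ck n f \<Longrightarrow> Ck n (\<lambda>x. f x ^ m :: 'a :: real_normed_algebra_1)"
  by (induction m) (auto intro!: Ck_const Ck_mult)

lemma Ck_prod:
  fixes f :: "'i \<Rightarrow> 'a::euclidean_space \<Rightarrow> 'b::{real_normed_algebra,comm_ring_1}"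
  assumes "\<And>i. i \<in> I \<Longrightarrow> Ck n (f i)" shows "Ck n (\<lambda>x. \<Prod>i\<in>I. f i x)"
  using assms by (induction I rule: infinite_finite_induct) (auto intro!: Ck_const Ck_mult)

lemma Ck_has_vector_derivative:
  fixes \<phi> :: "real \<Rightarrow> 'b::real_normed_vector"
  shows "Ck (Suc n) \<phi> \<Longrightarrow> (\<phi> has_vector_derivative vector_derivative \<phi> (at y)) (at y)"
  by (simp add: vector_derivative_works[symmetric])

lemma Ck_vector_derivative:
  fixes \<phi> :: "real \<Rightarrow> 'b::real_normed_vector"
  assumes "Ck (Suc n) \<phi>" shows "Ck n (\<lambda>y. vector_derivative \<phi> (at y))"
proof -
  have "vector_derivative \<phi> (at y) = frechet_derivative \<phi> (at y) 1" for y
    using frechet_derivative_at[OF Ck_has_vector_derivative[OF assms, unfolded has_vector_derivative_def], of y]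
    by (metis scaleR_one)
  then show ?thesis using assms by simp
qed

lemma Ck_SucI_vector:
  fixes \<phi> :: "real \<Rightarrow> 'b::real_normed_vector"
  assumes "\<And>y. (\<phi> has_vector_derivative \<phi>' y) (at y)" "Ck n \<phi>'"
  shows "Ck (Suc n) \<phi>"
  using assms
  by (intro Ck_SucI[where f' = "\<lambda>y v. v *\<^sub>R \<phi>' y"] Ck_scaleR Ck_const) (auto simp: has_vector_derivative_def)

lemma Ck_comp_real:
  fixes \<phi> :: "real \<Rightarrow> 'b::real_normed_vector" and g :: "'a::euclidean_space \<Rightarrow> real"
  assumes "Ck n \<phi>" "Ck n g" shows "Ck n (\<lambda>x. \<phi> (g x))"
  using assms
proof (induction n arbitrary: \<phi>)
  case 0
  then show ?case using continuous_on_compose2[of UNIV \<phi> UNIV g] by auto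
next
  case (Suc n)
  have "((\<lambda>x. \<phi> (g x)) has_derivative
      (\<lambda>v. frechet_derivative g (at x) v *\<^sub>R vector_derivative \<phi> (at (g x)))) (at x)" for x
    using has_derivative_compose[OF Ck_Suc_has_derivative[OF Suc.prems(2)]
        Ck_has_vector_derivative[OF Suc.prems(1), unfolded has_vector_derivative_def]] .
  moreover have "Ck n g" "Ck n \<phi>" using Suc.prems by (auto intro: Ck_Suc_imp_Ck simp del: Ck.simps)
  ultimately show ?case using Suc
    by (intro Ck_SucI) (auto intro!: Ck_scaleR Suc.IH Ck_vector_derivative simp del: Ck.simps(2) simp: Ck.simps(2)[of n g])
qed

section \<open>Smooth bumps\<close>

text \<open>
  The functions \<open>q(1/x) e\<^bsup>-1/x\<^esup>\<close>, extended by zero, form a family closed under differentiation, so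
  one induction shows that all of them are smooth, including at the origin.
\<close>

definition flat :: "real poly \<Rightarrow> real \<Rightarrow> real" where
  "flat q x = (if x > 0 then poly q (1 / x) * exp (- (1 / x)) else 0)"

lemma poly_exp_tendsto_0: "((\<lambda>y::real. poly q y * exp (- y)) \<longlongrightarrow> 0) at_top"
proof (induction q)
  case (pCons a q)
  have *: "((\<lambda>y::real. y ^ n * exp (- y)) \<longlongrightarrow> 0) at_top" for n
    using tendsto_power_div_exp_0[of n] by (simp add: exp_minus divide_inverse)
  have "((\<lambda>y::real. poly q y * y * exp (- y)) \<longlongrightarrow> 0) at_top"
  proof -
    have "((\<lambda>y::real. (\<Sum>i\<le>degree q. coeff q i * (y ^ (i + 1) * exp (- y)))) \<longlongrightarrow> (\<Sum>i\<le>degree q. coeff q i * 0)) at_top"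
      by (intro tendsto_sum tendsto_mult * tendsto_const)
    also have "(\<lambda>y::real. (\<Sum>i\<le>degree q. coeff q i * (y ^ (i + 1) * exp (- y)))) = (\<lambda>y. poly q y * y * exp (- y))"
      by (auto simp: poly_altdef sum_distrib_right sum_distrib_left intro!: ext sum.cong)
    finally show ?thesis by simp
  qed
  from tendsto_add[OF tendsto_mult[OF tendsto_const[of a] *[of 0]] this]
  show ?case by (simp add: algebra_simps)
qed simp

lemma flat_tendsto_0: "(flat q \<longlongrightarrow> 0) (at 0)"
proof -
  have "(flat q \<longlongrightarrow> 0) (at_right 0)"
  proof (rule Lim_transform_eventually)
    show "((\<lambda>x::real. poly q (inverse x) * exp (- inverse x)) \<longlongrightarrow> 0) (at_right 0)"
      by (rule filterlim_compose[OF poly_exp_tendsto_0 filterlim_inverse_at_top_right])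
    show "\<forall>\<^sub>F x in at_right 0. poly q (inverse x) * exp (- inverse x) = flat q x"
      by (auto simp: flat_def eventually_at_right_less divide_inverse intro!: eventually_at_rightI[of 0 1])
  qed
  moreover have "(flat q \<longlongrightarrow> 0) (at_left 0)"
    by (rule Lim_transform_eventually[OF tendsto_const])
       (auto simp: flat_def intro!: eventually_at_leftI[of "-1"])
  ultimately show ?thesis by (simp add: filterlim_split_at)
qed

text \<open>
  The derivative of \<open>q(1/x) e\<^bsup>-1/x\<^esup>\<close> is \<open>x\<^bsup>-2\<^esup> (q - q')(1/x) e\<^bsup>-1/x\<^esup>\<close>.
\<close>

lemma flat_has_derivative:
  "(flat q has_real_derivative flat ([:0, 0, 1:] * (q - pderiv q)) x) (at x)"
proof -
  consider "x > 0" | "x = 0" | "x < 0" by linarith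
  then show ?thesis
  proof cases
    case 1
    have "((\<lambda>x. poly q (1 / x) * exp (- (1 / x))) has_real_derivative
        flat ([:0, 0, 1:] * (q - pderiv q)) x) (at x)"
      using 1 by (auto intro!: derivative_eq_intros simp: flat_def field_simps power2_eq_square)
    then show ?thesis
      by (rule has_field_derivative_transform_within_open[of _ _ _ "{0<..}"])
         (use 1 in \<open>auto simp: flat_def\<close>)
  next
    case 2
    \<comment> \<open>The difference quotient at the origin belongs to the family again, so it tends to zero.\<close>
    have "(\<lambda>h. (flat q (0 + h) - flat q 0) / h) = flat (pCons 0 q)"
      by (auto simp: flat_def)
    then have "((\<lambda>h. (flat q (0 + h) - flat q 0) / h) \<longlongrightarrow> 0) (at 0)"
      using flat_tendsto_0 by simp
    with 2 show ?thesis by (simp add: DERIV_def) (simp add: flat_def)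
  next
    case 3
    have "((\<lambda>x. 0) has_real_derivative 0) (at x)" by simp
    then have "(flat q has_real_derivative 0) (at x)"
      by (rule has_field_derivative_transform_within_open[of _ _ _ "{..<0}"])
         (use 3 in \<open>auto simp: flat_def\<close>)
    then show ?thesis using 3 by (simp add: flat_def)
  qed
qed

lemma Ck_flat: "Ck n (flat q)"
proof (induction n arbitrary: q)
  case 0
  then show ?case
    by (auto intro!: DERIV_isCont continuous_at_imp_continuous_on flat_has_derivative)
next
  case (Suc n)
  then show ?case
    by (intro Ck_SucI_vector)
       (rule flat_has_derivative[unfolded has_real_derivative_iff_has_vector_derivative], rule Suc.IH)
qed

text \<open>
  The dilation by \<open>n + 1\<close> makes the bumps increase to the indicator of the open box.
\<close>

definition box_bump :: "'b::euclidean_space \<Rightarrow> 'b \<Rightarrow> nat \<Rightarrow> 'b \<Rightarrow> real" where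
  "box_bump a b n x =
     (\<Prod>i\<in>Basis. flat 1 (real (Suc n) * (x \<bullet> i - a \<bullet> i)) * flat 1 (real (Suc n) * (b \<bullet> i - x \<bullet> i)))"

lemma Ck_box_bump: "Ck m (box_bump a b n)"
  unfolding box_bump_def[abs_def]
  by (intro Ck_prod Ck_mult Ck_comp_real[OF Ck_flat] Ck_diff Ck_const
      Ck_bounded_linear[OF bounded_linear_inner_left])

lemma flat_1_bounds: "0 \<le> flat 1 x" "flat 1 x \<le> 1" "flat 1 x > 0 \<longleftrightarrow> x > 0"
  by (auto simp: flat_def)

lemma box_bump_bounds: "0 \<le> box_bump a b n x" "box_bump a b n x \<le> 1"
  unfolding box_bump_def
  by (auto intro!: prod_nonneg mult_nonneg_nonneg prod_le_1 mult_le_one simp: flat_1_bounds)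

lemma box_bump_outside: assumes "x \<notin> box a b" shows "box_bump a b n x = 0"
proof -
  from assms obtain i where i: "i \<in> Basis" "x \<bullet> i \<le> a \<bullet> i \<or> b \<bullet> i \<le> x \<bullet> i"
    by (auto simp: mem_box not_less)
  then have "flat 1 (real (Suc n) * (x \<bullet> i - a \<bullet> i)) * flat 1 (real (Suc n) * (b \<bullet> i - x \<bullet> i)) = 0"
    by (auto simp: flat_def zero_less_mult_iff)
  then show ?thesis unfolding box_bump_def using i(1) by (intro prod_zero) auto
qed

lemma box_bump_pos: "x \<in> box a b \<Longrightarrow> box_bump a b n x > 0"
  unfolding box_bump_def by (auto intro!: prod_pos mult_pos_pos simp: flat_1_bounds(3) mem_box)

lemma box_bump_tendsto: "(\<lambda>n. box_bump a b n x) \<longlonglongrightarrow> indicator (box a b) x"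
proof (cases "x \<in> box a b")
  case True
  have *: "(\<lambda>n. flat 1 (real (Suc n) * c)) \<longlonglongrightarrow> 1" if "c > 0" for c
  proof -
    have "(\<lambda>n. exp (- (1 / c * inverse (real (Suc n))))) \<longlonglongrightarrow> exp (- (1 / c * 0))"
      by (intro tendsto_intros LIMSEQ_inverse_real_of_nat)
    moreover have "flat 1 (real (Suc n) * c) = exp (- (1 / c * inverse (real (Suc n))))" for n
      using that by (simp add: flat_def divide_inverse mult.commute del: of_nat_Suc)
    ultimately show ?thesis by simp
  qed
  have "(\<lambda>n. box_bump a b n x) \<longlonglongrightarrow> (\<Prod>i\<in>(Basis::'a set). 1 * 1)"
    unfolding box_bump_def
    using True by (intro tendsto_prod tendsto_mult *) (auto simp: mem_box)
  then show ?thesis using True by simp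
qed (simp add: box_bump_outside)

section \<open>Annular profiles\<close>

text \<open>
  A profile in the variable \<open>N\<close> that vanishes near \<open>0\<close> and near infinity. Composed with \<open>N\<close> it is
  supported in a compact set away from the origin, where powers of \<open>N\<close> are smooth.
\<close>

definition annular :: "(real \<Rightarrow> 'b::zero) \<Rightarrow> bool" where
  "annular \<phi> \<longleftrightarrow> (\<exists>a b. 0 < a \<and> a < b \<and> (\<forall>y. \<phi> y \<noteq> 0 \<longrightarrow> a \<le> y \<and> y \<le> b))"

lemma annularI: "0 < a \<Longrightarrow> a < b \<Longrightarrow> (\<And>y. \<phi> y \<noteq> 0 \<Longrightarrow> a \<le> y \<and> y \<le> b) \<Longrightarrow> annular \<phi>"
  unfolding annular_def by blast

lemma annularE:
  assumes "annular \<phi>"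
  obtains a b where "0 < a" "a < b" "\<And>y. y < a \<Longrightarrow> \<phi> y = 0" "\<And>y. y > b \<Longrightarrow> \<phi> y = 0"
proof -
  from assms obtain a b where "0 < a" "a < b" "\<And>y. \<phi> y \<noteq> 0 \<Longrightarrow> a \<le> y \<and> y \<le> b"
    unfolding annular_def by blast
  then show thesis by (intro that[of a b]) force+
qed

lemma annular_mono: "annular \<phi> \<Longrightarrow> (\<And>y. \<phi> y = 0 \<Longrightarrow> \<psi> y = 0) \<Longrightarrow> annular \<psi>"
  unfolding annular_def by metis

lemma annular_add: "annular \<phi> \<Longrightarrow> annular \<psi> \<Longrightarrow> annular (\<lambda>y. \<phi> y + \<psi> y :: 'b::real_vector)"
proof -
  assume "annular \<phi>" "annular \<psi>"
  then obtain a b a' b' where *: "0 < a" "a < b" "\<And>y. \<phi> y \<noteq> 0 \<Longrightarrow> a \<le> y \<and> y \<le> b"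
    "0 < a'" "a' < b'" "\<And>y. \<psi> y \<noteq> 0 \<Longrightarrow> a' \<le> y \<and> y \<le> b'"
    unfolding annular_def by metis
  show ?thesis
  proof (rule annularI[of "min a a'" "max b b'"])
    show "min a a' \<le> y \<and> y \<le> max b b'" if "\<phi> y + \<psi> y \<noteq> 0" for y
    proof -
      from that have "\<phi> y \<noteq> 0 \<or> \<psi> y \<noteq> 0" by auto
      then show ?thesis using *(3)[of y] *(6)[of y] by auto
    qed
  qed (use * in auto)
qed

lemma annular_derivative:
  assumes "annular (\<phi> :: real \<Rightarrow> 'b::real_normed_vector)"
  shows "annular (\<lambda>y. vector_derivative \<phi> (at y))"
proof -
  obtain a b where ab: "0 < a" "a < b" "\<And>y. y < a \<Longrightarrow> \<phi> y = 0" "\<And>y. y > b \<Longrightarrow> \<phi> y = 0"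
    using annularE[OF assms(1)] by metis
  have *: "vector_derivative \<phi> (at y) = 0" if "y \<in> S" "open S" "\<And>x. x \<in> S \<Longrightarrow> \<phi> x = 0" for y S
  proof -
    have "((\<lambda>_. 0) has_vector_derivative 0) (at y)" by simp
    then have "(\<phi> has_vector_derivative 0) (at y)"
      by (rule has_vector_derivative_transform_within_open[OF _ that(2,1)]) (use that in auto)
    then show ?thesis by (rule vector_derivative_at)
  qed
  show ?thesis
    by (rule annularI[OF ab(1,2)])
       (metis *[of _ "{..<a}"] *[of _ "{b<..}"] ab(3,4) open_lessThan open_greaterThan
         lessThan_iff greaterThan_iff not_le)
qed

text \<open>
  The singularity of a real power at the origin is hidden by a profile that vanishes there.
\<close>

lemma annular_powr_continuous:
  fixes \<zeta> :: "real \<Rightarrow> 'b::real_normed_vector"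
  assumes "annular \<zeta>" "continuous_on UNIV \<zeta>"
  shows "continuous_on UNIV (\<lambda>y. (y powr r) *\<^sub>R \<zeta> y)"
proof -
  obtain a b where ab: "0 < a" "a < b" "\<And>y. y < a \<Longrightarrow> \<zeta> y = 0" "\<And>y. y > b \<Longrightarrow> \<zeta> y = 0"
    using annularE[OF assms(1)] by metis
  have "continuous_on ({0<..} \<union> {..<a}) (\<lambda>y. (y powr r) *\<^sub>R \<zeta> y)"
  proof (rule continuous_on_open_Un)
    show "continuous_on {0<..} (\<lambda>y. (y powr r) *\<^sub>R \<zeta> y)"
      by (intro continuous_intros continuous_on_subset[OF assms(2)]) auto
    have "continuous_on {..<a} (\<lambda>y. 0::'b)" by simp
    then show "continuous_on {..<a} (\<lambda>y. (y powr r) *\<^sub>R \<zeta> y)"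
      by (rule continuous_on_eq) (use ab in auto)
  qed auto
  moreover have "{0<..} \<union> {..<a} = (UNIV::real set)" using ab by auto
  ultimately show ?thesis by simp
qed

lemma annular_powr_derivative:
  fixes \<zeta> :: "real \<Rightarrow> 'b::real_normed_vector"
  assumes "annular \<zeta>" "(\<zeta> has_vector_derivative \<zeta>') (at y)"
  shows "((\<lambda>y. (y powr r) *\<^sub>R \<zeta> y) has_vector_derivative
           (y powr r) *\<^sub>R \<zeta>' + (r * y powr (r - 1)) *\<^sub>R \<zeta> y) (at y)"
proof -
  obtain a b where ab: "0 < a" "a < b" "\<And>y. y < a \<Longrightarrow> \<zeta> y = 0" "\<And>y. y > b \<Longrightarrow> \<zeta> y = 0"
    using annularE[OF assms(1)] by metis
  show ?thesis
  proof (cases "y > 0")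
    case True
    have "((\<lambda>y. y powr r) has_vector_derivative r * y powr (r - 1)) (at y)"
      using True by (auto intro!: derivative_eq_intros simp: has_real_derivative_iff_has_vector_derivative[symmetric])
    from has_vector_derivative_scaleR[OF this[folded has_real_derivative_iff_has_vector_derivative] assms(2)]
    show ?thesis .
  next
    case False
    have "((\<lambda>_. 0) has_vector_derivative 0) (at y)" by simp
    then have 1: "(\<zeta> has_vector_derivative 0) (at y)"
      by (rule has_vector_derivative_transform_within_open[of _ _ _ "{..<a}"]) (use False ab in auto)
    have "((\<lambda>_. 0) has_vector_derivative 0) (at y)" by simp
    then have 2: "((\<lambda>y. (y powr r) *\<^sub>R \<zeta> y) has_vector_derivative 0) (at y)"
      by (rule has_vector_derivative_transform_within_open[of _ _ _ "{..<a}"]) (use False ab in auto)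
    have "\<zeta>' = 0" using vector_derivative_unique_at[OF assms(2) 1] .
    moreover have "\<zeta> y = 0" using False ab by auto
    ultimately show ?thesis using 2 by simp
  qed
qed

lemma Ck_annular_powr:
  fixes \<zeta> :: "real \<Rightarrow> 'b::real_normed_vector"
  assumes "annular \<zeta>" "Ck n \<zeta>"
  shows "Ck n (\<lambda>y. (y powr r) *\<^sub>R \<zeta> y)"
  using assms
proof (induction n arbitrary: r \<zeta>)
  case 0
  then show ?case by (simp add: annular_powr_continuous)
next
  case (Suc n)
  have "Ck n \<zeta>" using Suc.prems by (auto intro: Ck_Suc_imp_Ck simp del: Ck.simps)
  then have "Ck n (\<lambda>y. (y powr r) *\<^sub>R vector_derivative \<zeta> (at y) + r *\<^sub>R ((y powr (r - 1)) *\<^sub>R \<zeta> y))"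
    by (intro Ck_add Ck_scaleR[OF Ck_const] Suc.IH Ck_vector_derivative annular_derivative Suc.prems)
  then show ?case
    using annular_powr_derivative[OF Suc.prems(1) Ck_has_vector_derivative[OF Suc.prems(2)]]
    by (intro Ck_SucI_vector) auto
qed

lemma annular_integrable:
  fixes \<zeta> :: "real \<Rightarrow> complex"
  assumes "annular \<zeta>" "continuous_on UNIV \<zeta>"
  shows "integrable lborel \<zeta>"
proof -
  obtain a b where ab: "0 < a" "a < b" "\<And>y. y < a \<Longrightarrow> \<zeta> y = 0" "\<And>y. y > b \<Longrightarrow> \<zeta> y = 0"
    using annularE[OF assms(1)] by metis
  have "set_integrable lborel {a..b} \<zeta>"
    by (rule borel_integrable_compact[unfolded set_integrable_def[symmetric]])
       (auto intro: continuous_on_subset[OF assms(2)])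
  then show ?thesis unfolding set_integrable_def
    by (rule Bochner_Integration.integrable_cong[THEN iffD1, rotated -1, OF _ refl])
       (use ab in \<open>auto simp: indicator_def not_le\<close>)
qed

text \<open>
  Among the primitives, the one that vanishes near the origin also vanishes near infinity exactly
  when the total integral is zero.
\<close>

lemma antiderivative_annular:
  fixes \<zeta> :: "real \<Rightarrow> complex"
  assumes "annular \<zeta>" "continuous_on UNIV \<zeta>" and zero: "(LINT y|lborel. \<zeta> y) = 0"
  obtains \<theta> where "annular \<theta>" "\<And>y. (\<theta> has_vector_derivative \<zeta> y) (at y)"
proof -
  obtain a b where ab: "0 < a" "a < b" "\<And>y. y < a \<Longrightarrow> \<zeta> y = 0" "\<And>y. y > b \<Longrightarrow> \<zeta> y = 0"
    using annularE[OF assms(1)] by metis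
  obtain F where F: "\<And>y. (F has_vector_derivative \<zeta> y) (at y)"
    using einterval_antiderivative[of "-\<infinity>" "\<infinity>" \<zeta>] assms(2)
    by (auto simp: continuous_on_eq_continuous_at)
  have const: "F x = F y" if "convex S" "\<And>z. z \<in> S \<Longrightarrow> \<zeta> z = 0" "x \<in> S" "y \<in> S" for x y S
  proof -
    have "(F has_vector_derivative 0) (at z within S)" if "z \<in> S" for z
      using F[of z] \<open>\<And>z. z \<in> S \<Longrightarrow> \<zeta> z = 0\<close> that has_vector_derivative_at_within by force
    from has_vector_derivative_zero_constant[OF that(1) this]
    show ?thesis using that(3,4) by metis
  qed
  have clos: "\<zeta> a = 0" "\<zeta> b = 0"
  proof -
    have "closed {y. \<zeta> y = 0}" using assms(2) by (intro closed_Collect_eq) auto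
    moreover have "{..<a} \<subseteq> {y. \<zeta> y = 0}" "{b<..} \<subseteq> {y. \<zeta> y = 0}" using ab by auto
    ultimately have "closure {..<a} \<subseteq> {y. \<zeta> y = 0}" "closure {b<..} \<subseteq> {y. \<zeta> y = 0}"
      by (meson closure_minimal)+
    then show "\<zeta> a = 0" "\<zeta> b = 0" by auto
  qed
  have "(LINT y:{a..b}|lborel. \<zeta> y) = F b - F a"
    unfolding set_lebesgue_integral_def
    by (rule integral_FTC_Icc[OF _ has_vector_derivative_at_within[OF F]])
       (use ab in \<open>auto intro: continuous_on_subset[OF assms(2)]\<close>)
  also have "(LINT y:{a..b}|lborel. \<zeta> y) = (LINT y|lborel. \<zeta> y)"
    unfolding set_lebesgue_integral_def
    by (rule Bochner_Integration.integral_cong) (use ab in \<open>auto simp: indicator_def not_le\<close>)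
  finally have eq: "F b = F a" using zero by simp
  show thesis
  proof
    show "((\<lambda>y. F y - F a) has_vector_derivative \<zeta> y) (at y)" for y
      using has_vector_derivative_diff[OF F has_vector_derivative_const[of "F a"], of y] by simp
    have left: "F y = F a" if "y \<le> a" for y
      using that by (intro const[of "{..a}"]) (use ab clos in \<open>auto simp: le_less\<close>)
    have right: "F y = F b" if "y \<ge> b" for y
      using that by (intro const[of "{b..}"]) (use ab clos in \<open>auto simp: le_less\<close>)
    have "a \<le> y \<and> y \<le> b" if "F y - F a \<noteq> 0" for y
      using that eq left[of y] right[of y] by (cases "y \<le> a"; cases "y \<ge> b") simp_all
    then show "annular (\<lambda>y. F y - F a)" by (rule annularI[OF ab(1,2)])
  qed
qed

lemma ex_annular_bump:
  obtains \<alpha> :: "real \<Rightarrow> complex"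
  where "annular \<alpha>" "\<And>n. Ck n \<alpha>" "(LINT y|lborel. \<alpha> y) = 1"
proof -
  let ?g = "box_bump (1::real) 2 0"
  have cont: "continuous_on UNIV ?g" using Ck_box_bump[of 0] by simp
  have out: "?g y = 0" if "y \<notin> {1..2}" for y using that by (intro box_bump_outside) auto
  have int: "integrable lborel ?g"
  proof -
    have "set_integrable lborel {1..2} ?g"
      by (rule borel_integrable_compact[unfolded set_integrable_def[symmetric]])
         (auto intro: continuous_on_subset[OF cont])
    moreover have "indicator {1..2} y *\<^sub>R ?g y = ?g y" for y
    proof (cases "y \<in> {1..2}")
      case False
      then have "?g y = 0" by (rule out)
      then show ?thesis by simp
    qed simp
    ultimately show ?thesis unfolding set_integrable_def by (simp only:)
  qed
  have "(LINT y|lborel. ?g y) \<noteq> 0"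
  proof
    assume "(LINT y|lborel. ?g y) = 0"
    then have "AE y in lborel. ?g y = 0"
      using integral_nonneg_eq_0_iff_AE[OF int] by (auto simp: box_bump_bounds)
    then have "AE y in lborel. y \<notin> {1<..<2::real}"
      by eventually_elim (use box_bump_pos[of _ 1 "2::real"] in \<open>auto simp: less_le\<close>)
    then have "emeasure lborel {1<..<2::real} = 0"
      by (subst (asm) AE_iff_measurable[of "{1<..<2}"]) auto
    then show False by simp
  qed
  then have "(LINT y|lborel. complex_of_real (?g y / (LINT y|lborel. ?g y))) = 1"
    by (simp del: of_real_divide)
  moreover have "Ck n (\<lambda>y. complex_of_real (?g y / (LINT y|lborel. ?g y)))" for n
    unfolding divide_inverse
    by (intro Ck_linear_comp[OF bounded_linear_of_real] Ck_mult Ck_const Ck_box_bump)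
  moreover have "annular (\<lambda>y. complex_of_real (?g y / (LINT y|lborel. ?g y)))"
  proof (rule annularI[of 1 2])
    show "1 \<le> y \<and> y \<le> 2" if "complex_of_real (?g y / (LINT y|lborel. ?g y)) \<noteq> 0" for y
      using that out[of y] by (cases "y \<in> {1..2}") auto
  qed auto
  ultimately show ?thesis using that by blast
qed

text \<open>
  The equation \<open>y \<psi>' + (r+1) \<psi> = \<zeta>\<close> is \<open>(y\<^bsup>r+1\<^esup> \<psi>)' = y\<^sup>r \<zeta>\<close>, so its solution vanishes near \<open>0\<close>
  and near infinity only if \<open>y\<^sup>r \<zeta>\<close> has integral zero. Subtracting a multiple of one fixed bump
  arranges this. The operator on the left is the one that the divergence of \<open>\<psi>(N) \<nabla>N\<close> produces.
\<close>

lemma euler_equation_solvable: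
  fixes \<zeta> \<alpha> :: "real \<Rightarrow> complex" and r :: real
  assumes \<alpha>: "annular \<alpha>" "\<And>n. Ck n \<alpha>" "(LINT y|lborel. \<alpha> y) = 1"
    and \<zeta>: "annular \<zeta>" "Ck n \<zeta>"
  obtains \<psi> where "annular \<psi>" "\<And>n. Ck n \<zeta> \<Longrightarrow> Ck (Suc n) \<psi>"
    "\<And>y. y *\<^sub>R vector_derivative \<psi> (at y) + (r + 1) *\<^sub>R \<psi> y =
          \<zeta> y - (LINT x|lborel. (x powr r) *\<^sub>R \<zeta> x) * (y powr (- r)) *\<^sub>R \<alpha> y"
proof -
  define \<kappa> where "\<kappa> = (LINT x|lborel. (x powr r) *\<^sub>R \<zeta> x)"
  define \<xi> where "\<xi> y = (y powr r) *\<^sub>R \<zeta> y - \<kappa> * \<alpha> y" for y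
  have ann: "annular (\<lambda>y. (y powr s) *\<^sub>R \<zeta> y)" for s by (rule annular_mono[OF \<zeta>(1)]) auto
  have cont: "continuous_on UNIV (\<lambda>y. (y powr r) *\<^sub>R \<zeta> y)"
    using annular_powr_continuous[OF \<zeta>(1)] Ck_imp_continuous[OF \<zeta>(2)] by blast
  have \<xi>_ann: "annular \<xi>"
  proof -
    have "annular (\<lambda>y. (y powr r) *\<^sub>R \<zeta> y + - (\<kappa> * \<alpha> y))"
      by (intro annular_add ann annular_mono[OF \<alpha>(1)]) auto
    then show ?thesis unfolding \<xi>_def by simp
  qed
  have \<xi>_Ck: "Ck m \<xi>" if "Ck m \<zeta>" for m
    unfolding \<xi>_def by (intro Ck_diff Ck_mult Ck_const \<alpha> Ck_annular_powr \<zeta> that)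
  have "(LINT y|lborel. \<xi> y) = 0"
    unfolding \<xi>_def
    using annular_integrable[OF ann cont] annular_integrable[OF \<alpha>(1) Ck_imp_continuous[OF \<alpha>(2)]]
    by (simp add: \<kappa>_def \<alpha>(3))
  then obtain \<theta> where \<theta>: "annular \<theta>" "\<And>y. (\<theta> has_vector_derivative \<xi> y) (at y)"
    using antiderivative_annular[OF \<xi>_ann Ck_imp_continuous[OF \<xi>_Ck[OF \<zeta>(2)]]] by blast
  define \<psi> where "\<psi> y = (y powr (- r - 1)) *\<^sub>R \<theta> y" for y
  show thesis
  proof
    show "annular \<psi>" unfolding \<psi>_def by (rule annular_mono[OF \<theta>(1)]) auto
    show "Ck (Suc n) \<psi>" if "Ck n \<zeta>" for n
      unfolding \<psi>_def using Ck_SucI_vector[OF \<theta>(2) \<xi>_Ck[OF that]] by (intro Ck_annular_powr \<theta>(1))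
    fix y
    have D: "vector_derivative \<psi> (at y) =
        (y powr (- r - 1)) *\<^sub>R \<xi> y + ((- r - 1) * y powr (- r - 2)) *\<^sub>R \<theta> y"
      using vector_derivative_at[OF annular_powr_derivative[OF \<theta>, of "- r - 1" y]]
      unfolding \<psi>_def by (simp add: diff_diff_eq)
    show "y *\<^sub>R vector_derivative \<psi> (at y) + (r + 1) *\<^sub>R \<psi> y =
          \<zeta> y - (LINT x|lborel. (x powr r) *\<^sub>R \<zeta> x) * (y powr (- r)) *\<^sub>R \<alpha> y"
    proof (cases "y > 0")
      case True
      then have p: "y * y powr (- r - 1) = y powr (- r)" "y * y powr (- r - 2) = y powr (- r - 1)"
        "y powr (- r) * y powr r = 1"
        using powr_mult_base[of y "- r - 1"] powr_mult_base[of y "- r - 2"] powr_add[of y "-r" r]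
        by (simp_all add: minus_diff_commute algebra_simps)
      have "y *\<^sub>R vector_derivative \<psi> (at y) =
          (y * y powr (- r - 1)) *\<^sub>R \<xi> y + ((- r - 1) * (y * y powr (- r - 2))) *\<^sub>R \<theta> y"
        unfolding D by (simp add: scaleR_add_right mult.left_commute)
      also have "\<dots> = (y powr (- r)) *\<^sub>R \<xi> y - (r + 1) *\<^sub>R \<psi> y"
        unfolding p \<psi>_def by (simp add: scaleR_diff_left algebra_simps)
      also have "(y powr (- r)) *\<^sub>R \<xi> y = \<zeta> y - \<kappa> * (y powr (- r)) *\<^sub>R \<alpha> y"
        unfolding \<xi>_def using p(3) by (simp add: scaleR_diff_right)
      finally show ?thesis unfolding \<kappa>_def by simp
    next
      case False
      then have "\<theta> y = 0" "\<zeta> y = 0" "\<alpha> y = 0" "\<xi> y = 0"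
        using \<theta>(1) \<xi>_ann \<zeta>(1) \<alpha>(1) unfolding annular_def by force+
      then show ?thesis unfolding D \<psi>_def by simp
    qed
  qed
qed

section \<open>The fundamental lemma along a continuous map\<close>

text \<open>
  Smooth bumps approximate indicators of open boxes, and open boxes form an intersection-stable
  generator of the Borel sets. Inside one compact box all integrals are finite, so the sets on
  which the conclusion holds are closed under complements and disjoint unions.
\<close>

lemma smooth_test_imp_borel_test:
  fixes T :: "'a \<Rightarrow> 'b::euclidean_space" and h :: "'a \<Rightarrow> complex"
  assumes T: "T \<in> borel_measurable M"
    and int: "integrable M (\<lambda>x. indicat_real (cbox c d) (T x) *\<^sub>R h x)"
    and zero: "\<And>\<phi>. (\<And>n. Ck n \<phi>) \<Longrightarrow> (\<And>y. y \<notin> cbox c d \<Longrightarrow> \<phi> y = 0) \<Longrightarrow>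
                 (LINT x|M. \<phi> (T x) * h x) = 0"
    and A: "A \<in> sets borel"
  shows "(LINT x|M. indicat_real (A \<inter> box c d) (T x) *\<^sub>R h x) = 0"
proof -
  define s where "s x = indicat_real (cbox c d) (T x) *\<^sub>R h x" for x
  have ints: "integrable M s" using int unfolding s_def .
  have sm [measurable]: "s \<in> borel_measurable M" using ints by simp
  note T [measurable]
  have sub: "indicat_real (A \<inter> box c d) (T x) *\<^sub>R h x = indicat_real (A \<inter> box c d) (T x) *\<^sub>R s x" for x A
  proof -
    have "T x \<in> box c d \<Longrightarrow> T x \<in> cbox c d" using box_subset_cbox by blast
    then show ?thesis by (simp add: s_def indicator_def)
  qed
  have intA: "integrable M (\<lambda>x. indicat_real B (T x) *\<^sub>R s x)" if "B \<in> sets borel" for B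
  proof (rule Bochner_Integration.integrable_bound[OF ints])
    show "(\<lambda>x. indicat_real B (T x) *\<^sub>R s x) \<in> borel_measurable M"
      by (intro borel_measurable_scaleR measurable_compose[OF T borel_measurable_indicator] that sm)
    show "AE x in M. norm (indicat_real B (T x) *\<^sub>R s x) \<le> norm (s x)"
      by (rule AE_I2) (auto simp: indicator_def)
  qed
  have box: "(LINT x|M. indicat_real (box a b \<inter> box c d) (T x) *\<^sub>R s x) = 0" for a b
  proof -
    obtain a' b' where ab: "box a b \<inter> box c d = box a' b'" using box_Int_box by blast
    then have out: "box_bump a' b' n y = 0" if "y \<notin> cbox c d" for n y
      using that box_subset_cbox[of c d] by (intro box_bump_outside) auto
    have "(\<lambda>n. LINT x|M. complex_of_real (box_bump a' b' n (T x)) * s x) \<longlonglongrightarrow>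
        (LINT x|M. indicat_real (box a' b') (T x) *\<^sub>R s x)"
    proof (rule integral_dominated_convergence[where w = "\<lambda>x. norm (s x)"])
      have "(\<lambda>y. box_bump a' b' n y) \<in> borel_measurable borel" for n
        using Ck_imp_continuous[OF Ck_box_bump] by (intro borel_measurable_continuous_onI)
      then show "(\<lambda>x. complex_of_real (box_bump a' b' n (T x)) * s x) \<in> borel_measurable M" for n
        by measurable
      show "(\<lambda>x. indicat_real (box a' b') (T x) *\<^sub>R s x) \<in> borel_measurable M" by measurable
      show "AE x in M. (\<lambda>n. complex_of_real (box_bump a' b' n (T x)) * s x) \<longlonglongrightarrow>
          indicat_real (box a' b') (T x) *\<^sub>R s x"
        unfolding scaleR_conv_of_real by (intro always_eventually allI tendsto_mult tendsto_of_real box_bump_tendsto tendsto_const)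
      show "AE x in M. norm (complex_of_real (box_bump a' b' n (T x)) * s x) \<le> norm (s x)" for n
        by (auto simp: norm_mult box_bump_bounds intro!: mult_left_le_one_le)
    qed (use ints in auto)
    moreover have "(LINT x|M. complex_of_real (box_bump a' b' n (T x)) * s x) = 0" for n
    proof -
      have "(LINT x|M. complex_of_real (box_bump a' b' n (T x)) * h x) = 0"
        by (rule zero[of "\<lambda>y. complex_of_real (box_bump a' b' n y)"])
           (auto intro: Ck_linear_comp[OF bounded_linear_of_real] Ck_box_bump simp: out)
      moreover have "complex_of_real (box_bump a' b' n (T x)) * h x = complex_of_real (box_bump a' b' n (T x)) * s x" for x
        using out[of "T x" n] by (auto simp: s_def indicator_def)
      ultimately show ?thesis by simp
    qed
    ultimately show ?thesis unfolding ab by (simp add: LIMSEQ_const_iff)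
  qed
  have whole: "(LINT x|M. indicat_real (box c d) (T x) *\<^sub>R s x) = 0" using box[of c d] by simp
  have "Int_stable (range (\<lambda>(a, b). box a b :: 'b set))"
    by (auto simp: Int_stable_def box_Int_box)
  moreover have "range (\<lambda>(a, b). box a b :: 'b set) \<subseteq> Pow UNIV" by simp
  moreover have "A \<in> sigma_sets UNIV (range (\<lambda>(a, b). box a b :: 'b set))"
    using A by (simp add: borel_eq_box sets_measure_of_conv)
  ultimately have "(LINT x|M. indicat_real (A \<inter> box c d) (T x) *\<^sub>R s x) = 0"
  proof (induction rule: sigma_sets_induct_disjoint)
    case (compl A)
    then have "A \<in> sets borel" by (simp add: borel_eq_box sets_measure_of_conv)
    have "(LINT x|M. indicat_real (box c d) (T x) *\<^sub>R s x) =
        (LINT x|M. indicat_real (A \<inter> box c d) (T x) *\<^sub>R s x + indicat_real ((UNIV - A) \<inter> box c d) (T x) *\<^sub>R s x)"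
      by (rule Bochner_Integration.integral_cong) (auto simp: indicator_def)
    also have "\<dots> = (LINT x|M. indicat_real (A \<inter> box c d) (T x) *\<^sub>R s x)
        + (LINT x|M. indicat_real ((UNIV - A) \<inter> box c d) (T x) *\<^sub>R s x)"
      using \<open>A \<in> sets borel\<close> by (intro Bochner_Integration.integral_add intA) (auto simp: sets.Diff)
    finally show ?case using compl whole by simp
  next
    case (union A)
    then have [measurable]: "A i \<in> sets borel" for i
      by (auto simp: borel_eq_box sets_measure_of_conv)
    have disj: "i \<noteq> j \<Longrightarrow> A i \<inter> A j = {}" for i j
      using union by (auto simp: disjoint_family_on_def)
    let ?B = "\<lambda>i. {x \<in> space M. T x \<in> A i \<inter> box c d}"
    have eq: "indicat_real {x \<in> space M. T x \<in> C} x *\<^sub>R s x = indicat_real C (T x) *\<^sub>R s x" if "x \<in> space M" for x C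
      using that by (auto simp: indicator_def)
    have U: "(\<Union>i. ?B i) = {x \<in> space M. T x \<in> (\<Union>i. A i) \<inter> box c d}" by auto
    have "(LINT x:(\<Union>i. ?B i)|M. s x) = (\<Sum>i. (LINT x:?B i|M. s x))"
    proof (rule lebesgue_integral_countable_add)
      show "set_integrable M (\<Union>i. ?B i) s"
        unfolding U set_integrable_def
        by (rule Bochner_Integration.integrable_cong[THEN iffD2, OF refl eq intA]) auto
    qed (use disj in auto)
    moreover have "(LINT x:?B i|M. s x) = 0" for i
      unfolding set_lebesgue_integral_def using union(3)[of i]
      by (subst Bochner_Integration.integral_cong[OF refl eq]) auto
    moreover have "(LINT x:(\<Union>i. ?B i)|M. s x) = (LINT x|M. indicat_real ((\<Union>i. A i) \<inter> box c d) (T x) *\<^sub>R s x)"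
      unfolding set_lebesgue_integral_def U
      by (subst Bochner_Integration.integral_cong[OF refl eq]) auto
    ultimately show ?case by simp
  qed (auto simp: box)
  then show ?thesis by (simp only: sub)
qed

text \<open>
  For a Lebesgue measurable preimage \<open>T\<^sup>-\<^sup>1(B)\<close> the set \<open>B\<close> itself may fail to be measurable. A
  \<open>\<sigma>\<close>-compact kernel of the preimage repairs this: the image of a compact set is compact, so the
  image of the kernel is a Borel subset of \<open>B\<close> that captures almost all of the preimage.
\<close>

lemma saturated_almost_borel:
  fixes T :: "'a::euclidean_space \<Rightarrow> 'b::euclidean_space"
  assumes T: "continuous_on UNIV T" and S: "T -` B \<in> sets lebesgue"
  obtains A where "A \<in> sets borel" "A \<subseteq> B" "AE x in lebesgue. T x \<in> B \<longrightarrow> T x \<in> A"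
proof -
  obtain C t where C: "fsigma C" "t \<in> null_sets lebesgue" "C \<union> t = T -` B"
    using lebesgue_set_almost_fsigma[OF S] by metis
  obtain F :: "nat \<Rightarrow> 'a set" where F: "range F \<subseteq> Collect compact" "C = \<Union> (range F)"
    using C(1) unfolding fsigma_Union_compact by blast
  have "compact (T ` F i)" for i
    using F(1) by (intro compact_continuous_image continuous_on_subset[OF T]) auto
  then have "(\<Union>i. T ` F i) \<in> sets borel" by (auto intro: borel_compact)
  moreover have "(\<Union>i. T ` F i) \<subseteq> B" using C(3) F(2) by auto
  moreover have "AE x in lebesgue. T x \<in> B \<longrightarrow> T x \<in> (\<Union>i. T ` F i)"
  proof (rule AE_I'[OF C(2)])
    show "{x \<in> space lebesgue. \<not> (T x \<in> B \<longrightarrow> T x \<in> (\<Union>i. T ` F i))} \<subseteq> t"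
      using C(3) F(2) by blast
  qed
  ultimately show thesis using that[of "\<Union>i. T ` F i"] by simp
qed

text \<open>
  The fundamental lemma of the calculus of variations for functions \<open>g \<circ> T\<close>, tested only against
  functions of \<open>T\<close>. With \<open>T\<close> the identity it gives uniqueness of weak derivatives, with \<open>T = N\<close> it
  compares radial functions. Only \<open>g \<circ> T\<close>, and not \<open>g\<close>, is known to be measurable, which is why
  the sets \<open>{g > 0}\<close> are replaced by Borel sets first.
\<close>

lemma fundamental_lemma_along:
  fixes T :: "'a::euclidean_space \<Rightarrow> 'b::euclidean_space" and g :: "'b \<Rightarrow> complex" and w :: "'a \<Rightarrow> real"
  assumes T: "continuous_on UNIV T"
    and meas: "(\<lambda>x. g (T x)) \<in> borel_measurable lebesgue"
    and pos: "AE x in lebesgue. w x > 0"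
    and "open \<Omega>"
    and int: "\<And>c d. cbox c d \<subseteq> \<Omega> \<Longrightarrow> integrable lebesgue (\<lambda>x. indicat_real (cbox c d) (T x) *\<^sub>R (w x *\<^sub>R g (T x)))"
    and zero: "\<And>\<phi> c d. (\<And>n. Ck n \<phi>) \<Longrightarrow> cbox c d \<subseteq> \<Omega> \<Longrightarrow> (\<And>y. y \<notin> cbox c d \<Longrightarrow> \<phi> y = 0) \<Longrightarrow>
                 (LINT x|lebesgue. \<phi> (T x) * (w x *\<^sub>R g (T x))) = 0"
  shows "AE x in lebesgue. T x \<in> \<Omega> \<longrightarrow> g (T x) = 0"
proof -
  have T_meas: "T \<in> borel_measurable lebesgue"
    by (intro measurable_completion) (simp add: borel_measurable_continuous_onI[OF T])
  have part: "AE x in lebesgue. T x \<in> box c d \<longrightarrow> p (g (T x)) \<le> 0"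
    if cd: "cbox c d \<subseteq> \<Omega>" and p: "bounded_linear p" for c d :: 'b and p :: "complex \<Rightarrow> real"
  proof -
    interpret p: bounded_linear p by fact
    have "p \<in> borel_measurable borel"
      by (intro borel_measurable_continuous_onI p.continuous_on continuous_on_id)
    then have "(\<lambda>x. p (g (T x))) \<in> borel_measurable lebesgue" by (rule measurable_compose[OF meas])
    then have "{x \<in> space lebesgue. 0 < p (g (T x))} \<in> sets lebesgue" by measurable
    moreover have "{x \<in> space lebesgue. 0 < p (g (T x))} = T -` {y. 0 < p (g y)}" by auto
    ultimately obtain A where A: "A \<in> sets borel" "A \<subseteq> {y. 0 < p (g y)}"
      "AE x in lebesgue. T x \<in> {y. 0 < p (g y)} \<longrightarrow> T x \<in> A"
      using saturated_almost_borel[OF T, of "{y. 0 < p (g y)}"] by auto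
    let ?f = "\<lambda>x. indicat_real (A \<inter> box c d) (T x) *\<^sub>R (w x *\<^sub>R g (T x))"
    have intf: "integrable lebesgue ?f"
    proof (rule Bochner_Integration.integrable_bound[OF int[OF cd]])
      have sub: "T x \<in> box c d \<Longrightarrow> T x \<in> cbox c d" for x using box_subset_cbox by blast
      then have "?f = (\<lambda>x. indicat_real (A \<inter> box c d) (T x) *\<^sub>R
          (indicat_real (cbox c d) (T x) *\<^sub>R (w x *\<^sub>R g (T x))))"
        by (intro ext) (simp add: indicator_def)
      also have "\<dots> \<in> borel_measurable lebesgue"
        by (intro borel_measurable_scaleR borel_measurable_integrable[OF int[OF cd]]
            measurable_compose[OF T_meas] borel_measurable_indicator sets.Int A(1)) simp
      finally show "?f \<in> borel_measurable lebesgue" .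
      show "AE x in lebesgue. norm (?f x) \<le> norm (indicat_real (cbox c d) (T x) *\<^sub>R (w x *\<^sub>R g (T x)))"
        using sub by (intro AE_I2) (simp add: indicator_def)
    qed
    have "(LINT x|lebesgue. ?f x) = 0"
      by (rule smooth_test_imp_borel_test[OF T_meas int[OF cd] zero A(1)]) (use cd in auto)
    then have "(LINT x|lebesgue. p (?f x)) = 0"
      using integral_bounded_linear[OF p intf] p.zero by simp
    moreover have "AE x in lebesgue. p (?f x) \<ge> 0"
      using pos by eventually_elim (use A(2) in \<open>auto simp: indicator_def p.scaleR p.zero\<close>)
    ultimately have "AE x in lebesgue. p (?f x) = 0"
      using integral_nonneg_eq_0_iff_AE[OF integrable_bounded_linear[OF p intf]] by simp
    then show ?thesis using pos A(3)
    proof eventually_elim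
      case (elim x)
      show ?case
      proof (intro impI, rule ccontr)
        assume "T x \<in> box c d" "\<not> p (g (T x)) \<le> 0"
        with elim show False by (auto simp: p.scaleR)
      qed
    qed
  qed
  have box: "AE x in lebesgue. T x \<in> box c d \<longrightarrow> g (T x) = 0" if "cbox c d \<subseteq> \<Omega>" for c d
    using part[OF that bounded_linear_Re] part[OF that bounded_linear_Im]
      part[OF that bounded_linear_minus[OF bounded_linear_Re]]
      part[OF that bounded_linear_minus[OF bounded_linear_Im]]
    by eventually_elim (auto simp: complex_eq_iff)
  define \<F> where "\<F> = {box c d | c d. cbox c d \<subseteq> \<Omega>}"
  have "\<Union>\<F> = \<Omega>"
  proof
    show "\<Union>\<F> \<subseteq> \<Omega>" using box_subset_cbox unfolding \<F>_def by blast
    show "\<Omega> \<subseteq> \<Union>\<F>"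
    proof
      fix y assume "y \<in> \<Omega>"
      then obtain c d where "cbox c d \<subseteq> \<Omega>" "y \<in> box c d"
        using open_contains_cbox[OF \<open>open \<Omega>\<close>] by metis
      then show "y \<in> \<Union>\<F>" unfolding \<F>_def by blast
    qed
  qed
  moreover obtain \<F>' where \<F>': "\<F>' \<subseteq> \<F>" "countable \<F>'" "\<Union>\<F>' = \<Union>\<F>"
    by (rule Lindelof[of \<F>]) (auto simp: \<F>_def)
  moreover have "AE x in lebesgue. \<forall>X\<in>\<F>'. T x \<in> X \<longrightarrow> g (T x) = 0"
    using \<F>' box by (subst AE_ball_countable) (auto simp: \<F>_def)
  ultimately show ?thesis by (auto elim!: eventually_mono)
qed

section \<open>Integration by parts along the horizontal fields\<close>

lemma continuous_bounded_support_bounded: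
  fixes f :: "'a::euclidean_space \<Rightarrow> 'b::real_normed_vector"
  assumes "continuous_on UNIV f" "bounded {x. f x \<noteq> 0}"
  obtains B where "B > 0" "\<And>x. norm (f x) \<le> B"
proof -
  have "compact (f ` closure {x. f x \<noteq> 0})"
    using assms by (intro compact_continuous_image continuous_on_subset[OF assms(1)]) (auto simp: compact_closure)
  then obtain B where B: "B > 0" "\<And>y. y \<in> f ` closure {x. f x \<noteq> 0} \<Longrightarrow> norm y \<le> B"
    using compact_imp_bounded bounded_pos by metis
  have "norm (f x) \<le> B" for x
  proof (cases "f x = 0")
    case False
    then have "x \<in> closure {x. f x \<noteq> 0}" using closure_subset by fastforce
    then show ?thesis by (intro B(2)) auto
  qed (use B in auto)
  then show thesis using that B(1) by blast
qed

lemma continuous_bounded_support_integrable_lborel: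
  fixes f :: "'a::euclidean_space \<Rightarrow> 'b::euclidean_space"
  assumes "continuous_on UNIV f" "bounded {x. f x \<noteq> 0}"
  shows "integrable lborel f"
proof -
  have "integrable lborel (\<lambda>x. indicat_real (closure {x. f x \<noteq> 0}) x *\<^sub>R f x)"
    using assms by (intro borel_integrable_compact continuous_on_subset[OF assms(1)]) (auto simp: compact_closure)
  moreover have "indicat_real (closure {x. f x \<noteq> 0}) x *\<^sub>R f x = f x" for x
    using closure_subset[of "{x. f x \<noteq> 0}"] by (cases "f x = 0") (auto simp: indicator_def)
  ultimately show ?thesis by simp
qed

lemma continuous_bounded_support_integrable:
  fixes f :: "'a::euclidean_space \<Rightarrow> 'b::euclidean_space"
  assumes "continuous_on UNIV f" "bounded {x. f x \<noteq> 0}"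
  shows "integrable lebesgue f"
  using continuous_bounded_support_integrable_lborel[OF assms] integrable_completion[of f lborel] by auto

lemma frechet_derivative_outside_support:
  assumes "x \<notin> closure {x. f x \<noteq> 0}"
  shows "frechet_derivative f (at x) v = 0"
proof -
  have "((\<lambda>_. 0) has_derivative (\<lambda>_. 0)) (at x)" by simp
  then have "(f has_derivative (\<lambda>_. 0)) (at x)"
  proof (rule has_derivative_transform_within_open[of _ _ _ _ "- closure {x. f x \<noteq> 0}"])
    show "0 = f y" if "y \<in> - closure {x. f x \<noteq> 0}" for y
    proof (rule ccontr)
      assume "0 \<noteq> f y"
      then have "y \<in> {x. f x \<noteq> 0}" by simp
      then have "y \<in> closure {x. f x \<noteq> 0}" by (rule subsetD[OF closure_subset])
      then show False using that by simp
    qed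
  qed (use assms in auto)
  from frechet_derivative_at[OF this, symmetric] show ?thesis by simp
qed

lemma bounded_support_frechet_derivative:
  "bounded {x. f x \<noteq> 0} \<Longrightarrow> bounded {x. frechet_derivative f (at x) v \<noteq> 0}"
  by (rule bounded_subset[OF bounded_closure])
     (assumption, rule subsetI, rule ccontr, simp add: frechet_derivative_outside_support)

text \<open>
  Difference quotients have integral zero by translation invariance, and they converge boundedly
  to the derivative on a fixed bounded set.
\<close>

lemma integral_frechet_derivative:
  fixes f :: "'a::euclidean_space \<Rightarrow> complex"
  assumes f: "Ck 1 f" and supp: "bounded {x. f x \<noteq> 0}"
  shows "(LINT x|lebesgue. frechet_derivative f (at x) v) = 0"
proof -
  let ?D = "\<lambda>x. frechet_derivative f (at x) v"
  have contf: "continuous_on UNIV f" using Ck_imp_continuous[OF f] .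
  have contD: "continuous_on UNIV ?D" using f by simp
  have der: "(f has_derivative frechet_derivative f (at x)) (at x)" for x
    by (rule Ck_Suc_has_derivative[OF f[unfolded One_nat_def]])
  obtain B where B: "B > 0" "\<And>x. norm (?D x) \<le> B"
    using continuous_bounded_support_bounded[OF contD bounded_support_frechet_derivative[OF supp]] by blast
  obtain R where R: "\<And>x. f x \<noteq> 0 \<Longrightarrow> norm x \<le> R" using supp unfolding bounded_iff by auto
  define q where "q n x = real (Suc n) *\<^sub>R (f (x + (1 / real (Suc n)) *\<^sub>R v) - f x)" for n x
  have line: "((\<lambda>t. f (x + t *\<^sub>R v)) has_vector_derivative ?D (x + t *\<^sub>R v)) (at t within S)" for x t S
  proof -
    have "((\<lambda>t. f (x + t *\<^sub>R v)) has_derivative (\<lambda>s. frechet_derivative f (at (x + t *\<^sub>R v)) (s *\<^sub>R v))) (at t within S)"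
      by (rule has_derivative_compose[OF _ der]) (auto intro!: derivative_eq_intros)
    moreover have "linear (frechet_derivative f (at (x + t *\<^sub>R v)))"
      using der has_derivative_linear by blast
    ultimately show ?thesis unfolding has_vector_derivative_def by (simp add: linear_cmul)
  qed
  have lim: "(\<lambda>n. q n x) \<longlonglongrightarrow> ?D x" for x
  proof -
    have "((\<lambda>t. f (x + t *\<^sub>R v)) has_vector_derivative ?D x) (at 0)" using line[of x 0 UNIV] by simp
    then have "((\<lambda>h. norm (f (x + h *\<^sub>R v) - f x - h *\<^sub>R ?D x) / norm h) \<longlongrightarrow> 0) (at 0)"
      by (simp add: has_vector_derivative_def has_derivative_at)
    moreover have "filterlim (\<lambda>n. 1 / real (Suc n)) (at 0) sequentially"
      unfolding filterlim_at using LIMSEQ_inverse_real_of_nat by (auto simp: inverse_eq_divide)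
    ultimately have "(\<lambda>n. norm (f (x + (1 / real (Suc n)) *\<^sub>R v) - f x - (1 / real (Suc n)) *\<^sub>R ?D x)
        / norm (1 / real (Suc n))) \<longlonglongrightarrow> 0"
      by (rule filterlim_compose)
    moreover have "norm (f (x + (1 / real (Suc n)) *\<^sub>R v) - f x - (1 / real (Suc n)) *\<^sub>R ?D x)
        / norm (1 / real (Suc n)) = norm (q n x - ?D x)" for n
    proof -
      have "q n x - ?D x = real (Suc n) *\<^sub>R (f (x + (1 / real (Suc n)) *\<^sub>R v) - f x - (1 / real (Suc n)) *\<^sub>R ?D x)"
        unfolding q_def scaleR_diff_right by simp
      then show ?thesis by (simp add: mult.commute)
    qed
    ultimately show ?thesis by (simp add: LIM_zero_cancel tendsto_norm_zero_iff)
  qed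
  have bound: "norm (q n x) \<le> B" for n x
  proof -
    let ?h = "1 / real (Suc n)"
    have "norm (f (x + ?h *\<^sub>R v) - f (x + 0 *\<^sub>R v)) \<le> B * norm (?h - 0)"
    proof (rule differentiable_bound[where S = UNIV])
      show "((\<lambda>t. f (x + t *\<^sub>R v)) has_derivative (\<lambda>s. s *\<^sub>R ?D (x + t *\<^sub>R v))) (at t within UNIV)" for t
        using line[of x t UNIV] by (simp add: has_vector_derivative_def)
      show "onorm (\<lambda>s. s *\<^sub>R ?D (x + t *\<^sub>R v)) \<le> B" for t
        using B(2)[of "x + t *\<^sub>R v"] by (intro onorm_le) (simp add: mult.commute[of B] mult_left_mono)
    qed auto
    then have "norm (f (x + ?h *\<^sub>R v) - f x) \<le> B * ?h" by simp
    then have "real (Suc n) * norm (f (x + ?h *\<^sub>R v) - f x) \<le> real (Suc n) * (B * ?h)"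
      by (intro mult_left_mono) auto
    then show ?thesis unfolding q_def by simp
  qed
  have qsupp: "q n x = 0" if "norm x > R + norm v" for n x
  proof -
    have "norm v / real (Suc n) \<le> norm v" using mult_left_mono[of 1 "real (Suc n)" "norm v"] by (simp add: divide_le_eq)
    moreover have "norm x \<le> norm (x + (1 / real (Suc n)) *\<^sub>R v) + norm v / real (Suc n)"
      using norm_triangle_ineq4[of "x + (1 / real (Suc n)) *\<^sub>R v" "(1 / real (Suc n)) *\<^sub>R v"] by simp
    ultimately have "norm (x + (1 / real (Suc n)) *\<^sub>R v) > R" using that by linarith
    moreover have "norm x > R" using that norm_ge_zero[of v] by linarith
    ultimately have "f x = 0" "f (x + (1 / real (Suc n)) *\<^sub>R v) = 0" using R by (meson not_le)+
    then show ?thesis unfolding q_def by (simp only:) simp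
  qed
  have intf: "integrable lborel f" by (rule continuous_bounded_support_integrable_lborel[OF contf supp])
  have shift: "integrable lborel (\<lambda>x. f (x + c))" "(LINT x|lborel. f (x + c)) = (LINT x|lborel. f x)" for c
  proof -
    have m: "(+) c \<in> lborel \<rightarrow>\<^sub>M borel" by simp
    have mf: "f \<in> borel_measurable borel" by (rule borel_measurable_continuous_onI[OF contf])
    show "integrable lborel (\<lambda>x. f (x + c))"
      using integrable_distr_eq[OF m mf] intf by (simp add: lborel_distr_plus add.commute)
    show "(LINT x|lborel. f (x + c)) = (LINT x|lborel. f x)"
      using integral_distr[OF m mf] by (simp add: lborel_distr_plus add.commute)
  qed
  have "(LINT x|lborel. q n x) = 0" for n
    unfolding q_def using shift intf by simp
  moreover have "(\<lambda>n. LINT x|lborel. q n x) \<longlonglongrightarrow> (LINT x|lborel. ?D x)"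
  proof (rule integral_dominated_convergence[where w = "\<lambda>x. B * indicat_real (cball 0 (R + norm v)) x"])
    have [measurable]: "f \<in> borel_measurable borel" by (rule borel_measurable_continuous_onI[OF contf])
    show "q n \<in> borel_measurable lborel" for n unfolding q_def by measurable
    show "?D \<in> borel_measurable lborel" using borel_measurable_continuous_onI[OF contD] by simp
    show "AE x in lborel. norm (q n x) \<le> B * indicat_real (cball 0 (R + norm v)) x" for n
      using bound qsupp by (intro AE_I2) (auto simp: indicator_def not_le)
    show "integrable lborel (\<lambda>x. B * indicat_real (cball 0 (R + norm v)) x)"
      by (intro integrable_mult_right integrable_real_indicator) (use emeasure_lborel_cball_finite[of 0 "R + norm v"] in \<open>auto simp: infinity_ennreal_def\<close>)
  qed (use lim in auto)
  ultimately have "(LINT x|lborel. ?D x) = 0" by (simp add: LIMSEQ_const_iff)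
  then show ?thesis
    using integral_completion[of ?D lborel] borel_measurable_continuous_onI[OF contD] by simp
qed

text \<open>
  The quantities \<open>R\<close> and \<open>N\<close>. The fourth power of the Koranyi norm is used as radial variable
  because it is a polynomial, hence smooth also at the origin.
\<close>

definition zsq :: "'d::finite heis \<Rightarrow> real" where
  "zsq p = (norm (fst p))\<^sup>2"

definition koranyi4 :: "'d::finite heis \<Rightarrow> real" where
  "koranyi4 p = (zsq p)\<^sup>2 + (snd p)\<^sup>2"

text \<open>
  The horizontal derivatives of \<open>R\<close>, of \<open>t\<close> and of \<open>N\<close> along the \<open>k\<close>-th field of the frame, as
  explicit polynomials.
\<close>

definition d_zsq :: "'d + 'd \<Rightarrow> 'd::finite heis \<Rightarrow> real" where
  "d_zsq k p = 2 * (fst p \<bullet> fst (horizontal_field k p))"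

definition twist :: "'d + 'd \<Rightarrow> 'd::finite heis \<Rightarrow> real" where
  "twist k p = snd (horizontal_field k p)"

definition d_koranyi4 :: "'d + 'd \<Rightarrow> 'd::finite heis \<Rightarrow> real" where
  "d_koranyi4 k p = 2 * zsq p * d_zsq k p + 2 * snd p * twist k p"

lemma zsq_nonneg: "zsq p \<ge> 0" and koranyi4_nonneg: "koranyi4 p \<ge> 0"
  by (simp_all add: zsq_def koranyi4_def)

lemma zsq_squared_le_koranyi4: "(zsq p)\<^sup>2 \<le> koranyi4 p"
  by (simp add: koranyi4_def)

lemma zsq_has_derivative: "(zsq has_derivative (\<lambda>v. 2 * (fst p \<bullet> fst v))) (at p)"
  unfolding zsq_def[abs_def] power2_norm_eq_inner
  by (auto intro!: derivative_eq_intros simp: inner_commute)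

lemma koranyi4_has_derivative:
  "(koranyi4 has_derivative (\<lambda>v. 2 * zsq p * (2 * (fst p \<bullet> fst v)) + 2 * snd p * snd v)) (at p)"
  unfolding koranyi4_def[abs_def]
  by (auto intro!: derivative_eq_intros zsq_has_derivative)

lemma d_zsq_simps:
  "d_zsq (Inl j) p = 2 * Re (fst p $ j)" "d_zsq (Inr j) p = 2 * Im (fst p $ j)"
  by (simp_all add: d_zsq_def horizontal_field_def inner_axis inner_complex_def)

lemma twist_simps:
  "twist (Inl j) p = 2 * Im (fst p $ j)" "twist (Inr j) p = - 2 * Re (fst p $ j)"
  by (simp_all add: twist_def horizontal_field_def)

lemma bounded_linear_d_zsq: "bounded_linear (d_zsq k)"
  by (cases k)
    (auto simp: d_zsq_simps[abs_def] intro!: bounded_linear_const_mult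
      bounded_linear_compose[OF bounded_linear_Re] bounded_linear_compose[OF bounded_linear_Im]
      bounded_linear_compose[OF bounded_linear_vec_nth bounded_linear_fst])

lemma bounded_linear_twist: "bounded_linear (twist k)"
  by (cases k)
    (auto simp: twist_simps[abs_def] intro!: bounded_linear_const_mult bounded_linear_minus
      bounded_linear_compose[OF bounded_linear_Re] bounded_linear_compose[OF bounded_linear_Im]
      bounded_linear_compose[OF bounded_linear_vec_nth bounded_linear_fst])

lemma sum_fields: "(\<Sum>k\<in>UNIV. f k) = (\<Sum>j\<in>UNIV. f (Inl j) + f (Inr j))"
  for f :: "'d::finite + 'd \<Rightarrow> 'c::comm_monoid_add"
  by (simp add: UNIV_Plus_UNIV[symmetric] sum.Plus sum.distrib del: UNIV_Plus_UNIV)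

lemma zsq_eq_sum: "zsq p = (\<Sum>j\<in>UNIV. (Re (fst p $ j))\<^sup>2 + (Im (fst p $ j))\<^sup>2)"
  by (simp add: zsq_def norm_vec_def L2_set_def sum_nonneg cmod_power2)

text \<open>
  The horizontal gradients of \<open>R\<close> and \<open>t\<close> are orthogonal and have the same length.
\<close>

lemma frame_sums:
  fixes p :: "'d::finite heis"
  shows "(\<Sum>k\<in>UNIV. (d_zsq k p)\<^sup>2) = 4 * zsq p"
    and "(\<Sum>k\<in>UNIV. (twist k p)\<^sup>2) = 4 * zsq p"
    and "(\<Sum>k\<in>UNIV. d_zsq k p * twist k p) = 0"
proof -
  show "(\<Sum>k\<in>UNIV. (d_zsq k p)\<^sup>2) = 4 * zsq p"
    unfolding sum_fields zsq_eq_sum sum_distrib_left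
    by (rule sum.cong) (simp_all add: d_zsq_simps power_mult_distrib)
  show "(\<Sum>k\<in>UNIV. (twist k p)\<^sup>2) = 4 * zsq p"
    unfolding sum_fields zsq_eq_sum sum_distrib_left
    by (rule sum.cong) (simp_all add: twist_simps power_mult_distrib)
  show "(\<Sum>k\<in>UNIV. d_zsq k p * twist k p) = 0"
    unfolding sum_fields by (rule sum.neutral) (simp add: d_zsq_simps twist_simps)
qed

text \<open>
  The two identities on which the orthogonality of \<open>\<nabla>N\<close> and \<open>\<nabla>(R\<^sup>2/N)\<close> rests.
\<close>

lemma gradient_products:
  fixes p :: "'d::finite heis"
  shows "(\<Sum>k\<in>UNIV. d_zsq k p * d_koranyi4 k p) = 8 * (zsq p)\<^sup>2"
    and "(\<Sum>k\<in>UNIV. (d_koranyi4 k p)\<^sup>2) = 16 * koranyi4 p * zsq p"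
proof -
  have "(\<Sum>k\<in>UNIV. d_zsq k p * d_koranyi4 k p)
      = 2 * zsq p * (\<Sum>k\<in>UNIV. (d_zsq k p)\<^sup>2) + 2 * snd p * (\<Sum>k\<in>UNIV. d_zsq k p * twist k p)"
    unfolding sum_distrib_left sum.distrib[symmetric]
    by (rule sum.cong) (simp_all add: d_koranyi4_def power2_eq_square algebra_simps)
  then show "(\<Sum>k\<in>UNIV. d_zsq k p * d_koranyi4 k p) = 8 * (zsq p)\<^sup>2"
    unfolding frame_sums by (simp add: power2_eq_square)
  have "(\<Sum>k\<in>UNIV. (d_koranyi4 k p)\<^sup>2)
      = 4 * (zsq p)\<^sup>2 * (\<Sum>k\<in>UNIV. (d_zsq k p)\<^sup>2) + 8 * zsq p * snd p * (\<Sum>k\<in>UNIV. d_zsq k p * twist k p)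
        + 4 * (snd p)\<^sup>2 * (\<Sum>k\<in>UNIV. (twist k p)\<^sup>2)"
    unfolding sum_distrib_left sum.distrib[symmetric]
    by (rule sum.cong) (simp_all add: d_koranyi4_def power2_eq_square algebra_simps)
  then show "(\<Sum>k\<in>UNIV. (d_koranyi4 k p)\<^sup>2) = 16 * koranyi4 p * zsq p"
    unfolding frame_sums by (simp add: koranyi4_def power2_eq_square algebra_simps)
qed

lemma Ck_zsq: "Ck n zsq"
  unfolding zsq_def[abs_def] power2_norm_eq_inner
  by (intro Ck_bilinear[OF bounded_bilinear_inner] Ck_bounded_linear bounded_linear_fst)

lemma Ck_d_zsq: "Ck n (d_zsq k)" and Ck_twist: "Ck n (twist k)"
  by (simp_all add: Ck_bounded_linear bounded_linear_d_zsq bounded_linear_twist)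

lemma Ck_snd: "Ck n (snd :: 'd::finite heis \<Rightarrow> real)"
  by (simp add: Ck_bounded_linear bounded_linear_snd)

lemma Ck_koranyi4: "Ck n koranyi4"
  unfolding koranyi4_def[abs_def] by (intro Ck_add Ck_power Ck_zsq Ck_snd)

lemma Ck_d_koranyi4: "Ck n (d_koranyi4 k)"
  unfolding d_koranyi4_def[abs_def] by (intro Ck_add Ck_mult Ck_const Ck_zsq Ck_snd Ck_d_zsq Ck_twist)

lemma field_deriv_eq:
  "(f has_derivative f') (at p) \<Longrightarrow> field_deriv k f p = f' (horizontal_field k p)"
  unfolding field_deriv_def using fun_cong[OF frechet_derivative_at[of f f' p], of "horizontal_field k p"] by simp

text \<open>
  A field of the frame is a constant horizontal direction plus a linear multiple of \<open>\<partial>\<^sub>t\<close>, so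
  derivatives along it reduce to derivatives in fixed directions.
\<close>

lemma field_deriv_eq_frame:
  fixes f :: "'d::finite heis \<Rightarrow> complex"
  assumes "f differentiable (at p)"
  shows "field_deriv k f p = frechet_derivative f (at p) (fst (horizontal_field k p), 0)
           + twist k p *\<^sub>R frechet_derivative f (at p) (0, 1)"
proof -
  have lin: "linear (frechet_derivative f (at p))"
    using assms frechet_derivative_works has_derivative_linear by blast
  have "horizontal_field k p = (fst (horizontal_field k p), 0) + twist k p *\<^sub>R (0, 1)"
    by (simp add: twist_def prod_eq_iff)
  then have "frechet_derivative f (at p) (horizontal_field k p) =
      frechet_derivative f (at p) ((fst (horizontal_field k p), 0) + twist k p *\<^sub>R (0, 1))"
    by (rule arg_cong)
  then show ?thesis
    unfolding field_deriv_def by (simp only: linear_add[OF lin] linear_cmul[OF lin])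
qed

lemma fst_horizontal_field_const: "fst (horizontal_field k p) = fst (horizontal_field k q)"
  by (cases k) (simp_all add: horizontal_field_def)

lemma Ck_field_deriv:
  fixes f :: "'d::finite heis \<Rightarrow> complex"
  assumes "Ck (Suc n) f" shows "Ck n (field_deriv k f)"
proof -
  have "field_deriv k f = (\<lambda>p. frechet_derivative f (at p) (fst (horizontal_field k undefined), 0)
           + twist k p *\<^sub>R frechet_derivative f (at p) (0, 1))"
  proof (rule ext)
    fix p
    have "f differentiable (at p)" by (rule differentiableI[OF Ck_Suc_has_derivative[OF assms]])
    then show "field_deriv k f p = frechet_derivative f (at p) (fst (horizontal_field k undefined), 0)
           + twist k p *\<^sub>R frechet_derivative f (at p) (0, 1)"
      using field_deriv_eq_frame[of f p k] fst_horizontal_field_const[of k p undefined] by simp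
  qed
  moreover have "Ck n (\<lambda>p. frechet_derivative f (at p) v)" for v using assms by (simp only: Ck.simps)
  ultimately show ?thesis by (simp add: Ck_add Ck_scaleR Ck_twist)
qed

lemma bounded_support_field_deriv:
  fixes f :: "'d::finite heis \<Rightarrow> complex"
  shows "bounded {x. f x \<noteq> 0} \<Longrightarrow> bounded {x. field_deriv k f x \<noteq> 0}"
  unfolding field_deriv_def
  by (rule bounded_subset[OF bounded_closure])
     (assumption, rule subsetI, rule ccontr, simp add: frechet_derivative_outside_support)

text \<open>
  The coefficient of \<open>\<partial>\<^sub>t\<close> does not depend on \<open>t\<close>, hence it can be moved under the derivative and
  each of the two terms integrates to zero.
\<close>

lemma integral_field_deriv:
  fixes f :: "'d::finite heis \<Rightarrow> complex"
  assumes f: "Ck 1 f" and supp: "bounded {x. f x \<noteq> 0}"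
  shows "(LINT x|lebesgue. field_deriv k f x) = 0"
proof -
  define e where "e = (fst (horizontal_field k (undefined :: 'd heis)), 0 :: real)"
  define m where "m x = twist k x *\<^sub>R f x" for x
  have m: "Ck 1 m" unfolding m_def by (intro Ck_scaleR Ck_twist f)
  have ms: "bounded {x. m x \<noteq> 0}" by (rule bounded_subset[OF supp]) (auto simp: m_def)
  have df: "(f has_derivative frechet_derivative f (at x)) (at x)" for x
    by (rule Ck_Suc_has_derivative[OF f[unfolded One_nat_def]])
  have dm: "(m has_derivative (\<lambda>v. twist k x *\<^sub>R frechet_derivative f (at x) v + twist k v *\<^sub>R f x)) (at x)" for x
    unfolding m_def
    by (rule bounded_bilinear.FDERIV[OF bounded_bilinear_scaleR
        bounded_linear_imp_has_derivative[OF bounded_linear_twist] df])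
  have "frechet_derivative m (at x) (0, 1) = twist k x *\<^sub>R frechet_derivative f (at x) (0, 1) + twist k (0, 1) *\<^sub>R f x" for x
    using fun_cong[OF frechet_derivative_at[OF dm[of x]], of "(0, 1)"] by simp
  moreover have "twist k (0, 1) = 0" by (cases k) (simp_all add: twist_simps)
  ultimately have "field_deriv k f x = frechet_derivative f (at x) e + frechet_derivative m (at x) (0, 1)" for x
    using field_deriv_eq_frame[OF differentiableI[OF df], of k x] fst_horizontal_field_const[of k x undefined]
    by (simp add: e_def)
  moreover have "integrable lebesgue (\<lambda>x. frechet_derivative f (at x) v)" if "Ck 1 f" "bounded {x. f x \<noteq> 0}"
    for f :: "'d heis \<Rightarrow> complex" and v
  proof (rule continuous_bounded_support_integrable[OF _ bounded_support_frechet_derivative[OF that(2)]])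
    show "continuous_on UNIV (\<lambda>x. frechet_derivative f (at x) v)"
      using that(1) by (simp only: One_nat_def Ck.simps)
  qed
  ultimately show ?thesis
    using f m supp ms by (simp add: integral_frechet_derivative del: Ck.simps One_nat_def)
qed

section \<open>Weak horizontal derivatives\<close>

lemma continuous_bounded_support_L2:
  fixes f :: "'d::finite heis \<Rightarrow> complex"
  assumes "continuous_on UNIV f" "bounded {x. f x \<noteq> 0}"
  shows "f \<in> L2"
proof -
  have "integrable lebesgue (\<lambda>p. (norm (f p))\<^sup>2)"
    using assms by (intro continuous_bounded_support_integrable continuous_intros) auto
  moreover have "f \<in> borel_measurable lebesgue"
    using borel_measurable_integrable[OF continuous_bounded_support_integrable[OF assms]] .
  ultimately show ?thesis by (simp add: L2_def)
qed

lemma L2_integrable_cbox: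
  assumes "f \<in> L2"
  shows "integrable lebesgue (\<lambda>x. indicat_real (cbox c d) x *\<^sub>R f x)"
proof (rule Bochner_Integration.integrable_bound)
  show "integrable lebesgue (\<lambda>x. indicat_real (cbox c d) x + (norm (f x))\<^sup>2)"
    using assms by (intro Bochner_Integration.integrable_add integrable_real_indicator)
      (use emeasure_lborel_cbox_finite[of c d] in \<open>auto simp: L2_def infinity_ennreal_def\<close>)
  show "(\<lambda>x. indicat_real (cbox c d) x *\<^sub>R f x) \<in> borel_measurable lebesgue"
    using assms by (intro borel_measurable_scaleR borel_measurable_indicator) (auto simp: L2_def)
  show "AE x in lebesgue. norm (indicat_real (cbox c d) x *\<^sub>R f x) \<le> norm (indicat_real (cbox c d) x + (norm (f x))\<^sup>2)"
  proof (rule AE_I2)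
    fix x
    have "0 \<le> (norm (f x) - 1)\<^sup>2" by simp
    then have "norm (f x) \<le> 1 + (norm (f x))\<^sup>2" by (simp add: power2_eq_square algebra_simps) (use norm_ge_zero[of "f x"] in linarith)
    then show "norm (indicat_real (cbox c d) x *\<^sub>R f x) \<le> norm (indicat_real (cbox c d) x + (norm (f x))\<^sup>2)"
      by (simp add: indicator_def)
  qed
qed

lemma test_times_locally_integrable:
  fixes \<phi> h :: "'a::euclidean_space \<Rightarrow> complex"
  assumes \<phi>: "continuous_on UNIV \<phi>" "\<And>y. y \<notin> cbox c d \<Longrightarrow> \<phi> y = 0"
    and h: "integrable lebesgue (\<lambda>x. indicat_real (cbox c d) x *\<^sub>R h x)"
  shows "integrable lebesgue (\<lambda>x. \<phi> x * h x)"
proof -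
  have supp: "bounded {x. \<phi> x \<noteq> 0}"
    by (rule bounded_subset[OF bounded_cbox[of c d]]) (use \<phi>(2) in auto)
  obtain B where B: "B > 0" "\<And>x. norm (\<phi> x) \<le> B"
    using continuous_bounded_support_bounded[OF \<phi>(1) supp] by blast
  have \<phi>m: "\<phi> \<in> borel_measurable lebesgue"
    using borel_measurable_integrable[OF continuous_bounded_support_integrable[OF \<phi>(1) supp]] .
  have "integrable lebesgue (\<lambda>x. \<phi> x * (indicat_real (cbox c d) x *\<^sub>R h x))"
  proof (rule Bochner_Integration.integrable_bound)
    show "integrable lebesgue (\<lambda>x. B *\<^sub>R (indicat_real (cbox c d) x *\<^sub>R h x))"
      by (intro integrable_scaleR_right h)
    show "(\<lambda>x. \<phi> x * (indicat_real (cbox c d) x *\<^sub>R h x)) \<in> borel_measurable lebesgue"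
      by (intro borel_measurable_times \<phi>m borel_measurable_integrable[OF h])
    show "AE x in lebesgue. norm (\<phi> x * (indicat_real (cbox c d) x *\<^sub>R h x))
        \<le> norm (B *\<^sub>R (indicat_real (cbox c d) x *\<^sub>R h x))"
    proof (rule AE_I2)
      fix x
      let ?s = "indicat_real (cbox c d) x *\<^sub>R h x"
      have "norm (\<phi> x) * norm ?s \<le> \<bar>B\<bar> * norm ?s" using B by (intro mult_right_mono) auto
      then show "norm (\<phi> x * ?s) \<le> norm (B *\<^sub>R ?s)"
        by (simp only: norm_mult[of "\<phi> x" ?s] norm_scaleR[of B ?s])
    qed
  qed
  moreover have "\<phi> x * (indicat_real (cbox c d) x *\<^sub>R h x) = \<phi> x * h x" for x
    using \<phi>(2)[of x] by (cases "x \<in> cbox c d") simp_all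
  ultimately show ?thesis by simp
qed

lemma test_functionI:
  assumes "\<And>n. Ck n \<phi>" "bounded {p. \<phi> p \<noteq> 0}" shows "test_function \<phi>"
  using assms by (simp add: test_function_def compact_closure)

lemma has_weak_deriv_unique:
  assumes w: "w \<in> L2" "w' \<in> L2" and "has_weak_deriv k u w" "has_weak_deriv k u w'"
  shows "AE p in lebesgue. w p = w' p"
proof -
  have "AE p in lebesgue. p \<in> (UNIV :: 'a heis set) \<longrightarrow> w p - w' p = 0"
  proof (rule fundamental_lemma_along[where T = "\<lambda>x. x" and w = "\<lambda>_. 1" and g = "\<lambda>p. w p - w' p"])
    show "(\<lambda>x. w x - w' x) \<in> borel_measurable lebesgue" using w by (auto simp: L2_def)
    show "integrable lebesgue (\<lambda>x. indicat_real (cbox c d) x *\<^sub>R (1 *\<^sub>R (w x - w' x)))" for c d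
      using Bochner_Integration.integrable_diff[OF L2_integrable_cbox[OF w(1), of c d] L2_integrable_cbox[OF w(2), of c d]]
      by (simp only: scaleR_diff_right[symmetric] scaleR_one)
    fix \<phi> :: "'a heis \<Rightarrow> complex" and c d
    assume \<phi>: "\<And>n. Ck n \<phi>" "\<And>y. y \<notin> cbox c d \<Longrightarrow> \<phi> y = 0"
    have "test_function \<phi>"
      by (intro test_functionI \<phi>(1) bounded_subset[OF bounded_cbox[of c d]]) (use \<phi>(2) in auto)
    then have "(LINT p|lebesgue. w p * \<phi> p) = (LINT p|lebesgue. w' p * \<phi> p)"
      using assms(3)[unfolded has_weak_deriv_def, rule_format, of \<phi>]
        assms(4)[unfolded has_weak_deriv_def, rule_format, of \<phi>] by simp
    moreover have "integrable lebesgue (\<lambda>p. \<phi> p * w p)" "integrable lebesgue (\<lambda>p. \<phi> p * w' p)"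
      using w by (auto intro!: test_times_locally_integrable[OF Ck_imp_continuous[OF \<phi>(1)] \<phi>(2)] L2_integrable_cbox)
    ultimately show "(LINT x|lebesgue. \<phi> x * (1 *\<^sub>R (w x - w' x))) = 0"
      by (simp add: right_diff_distrib mult.commute)
  qed auto
  then show ?thesis by simp
qed

lemma weak_deriv_spec:
  assumes "u \<in> H1"
  shows "weak_deriv k u \<in> L2" "has_weak_deriv k u (weak_deriv k u)"
proof -
  have "\<exists>w. w \<in> L2 \<and> has_weak_deriv k u w" using assms unfolding H1_def by blast
  from someI_ex[OF this] show "weak_deriv k u \<in> L2" "has_weak_deriv k u (weak_deriv k u)"
    unfolding weak_deriv_def by auto
qed

lemma field_deriv_bilinear:
  assumes b: "bounded_bilinear pr" and f: "(f has_derivative f') (at p)" and g: "Ck 1 g"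
  shows "field_deriv k (\<lambda>p. pr (f p) (g p)) p
           = pr (f p) (field_deriv k g p) + pr (f' (horizontal_field k p)) (g p)"
  using field_deriv_eq[OF bounded_bilinear.FDERIV[OF b f Ck_Suc_has_derivative[OF g[unfolded One_nat_def]]]]
  by (simp add: field_deriv_def)

lemma horizontal_integration_by_parts:
  fixes f g :: "'d::finite heis \<Rightarrow> complex"
  assumes f: "Ck 1 f" "bounded {x. f x \<noteq> 0}" and g: "Ck 1 g"
  shows "(LINT x|lebesgue. f x * field_deriv k g x) = - (LINT x|lebesgue. field_deriv k f x * g x)"
proof -
  have "field_deriv k (\<lambda>p. f p * g p) p = f p * field_deriv k g p + field_deriv k f p * g p" for p
    using field_deriv_bilinear[OF bounded_bilinear_mult Ck_Suc_has_derivative[OF f(1)[unfolded One_nat_def]] g]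
    by (simp add: field_deriv_def)
  moreover have "(LINT x|lebesgue. field_deriv k (\<lambda>p. f p * g p) x) = 0"
    by (intro integral_field_deriv Ck_mult f g bounded_subset[OF f(2)]) auto
  moreover have "continuous_on UNIV (field_deriv k f)" "continuous_on UNIV (field_deriv k g)"
    using Ck_field_deriv[of 0 f k] Ck_field_deriv[of 0 g k] f g by (simp_all del: Ck.simps(2))
  then have "integrable lebesgue (\<lambda>x. f x * field_deriv k g x)" "integrable lebesgue (\<lambda>x. field_deriv k f x * g x)"
    by (intro continuous_bounded_support_integrable continuous_on_mult Ck_imp_continuous[OF f(1)]
        Ck_imp_continuous[OF g] bounded_subset[OF f(2)] bounded_subset[OF bounded_support_field_deriv[OF f(2), of k]];
        force)+
  ultimately show ?thesis by (simp add: add_eq_0_iff2)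
qed

text \<open>
  Provides the test functions of finite regularity: \<open>f\<close> will only be known to be \<open>C\<^sup>1\<close>, so the
  products \<open>q \<eta>(N) f(N)\<close> are not smooth.
\<close>

lemma C1_weak_deriv:
  fixes v :: "'d::finite heis \<Rightarrow> complex"
  assumes v: "Ck 1 v" "bounded {x. v x \<noteq> 0}"
  shows "v \<in> H1" "AE p in lebesgue. weak_deriv k v p = field_deriv k v p"
proof -
  have L2: "field_deriv k v \<in> L2" for k
    using Ck_field_deriv[of 0 v k] v(1)
    by (intro continuous_bounded_support_L2 bounded_support_field_deriv v(2)) (simp del: Ck.simps(2))
  have weak: "has_weak_deriv k v (field_deriv k v)" for k
    unfolding has_weak_deriv_def test_function_def using horizontal_integration_by_parts[OF v] by blast
  show "v \<in> H1"
    unfolding H1_def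
  proof (intro CollectI conjI allI)
    show "v \<in> L2" by (rule continuous_bounded_support_L2[OF Ck_imp_continuous[OF v(1)] v(2)])
    show "\<exists>w\<in>L2. has_weak_deriv k v w" for k by (rule bexI, rule weak, rule L2)
  qed
  then have "weak_deriv k v \<in> L2" "has_weak_deriv k v (weak_deriv k v)"
    by (rule weak_deriv_spec)+
  then show "AE p in lebesgue. weak_deriv k v p = field_deriv k v p"
    using has_weak_deriv_unique[of "weak_deriv k v" "field_deriv k v" k v] L2[of k] weak[of k] by simp
qed

section \<open>Radial profiles\<close>

text \<open>
  The functions \<open>R\<^sup>m \<phi>(N)\<close>. They are closed under the operations used below, and all integrals in
  the proof are integrals of such functions.
\<close>

definition lift :: "nat \<Rightarrow> (real \<Rightarrow> complex) \<Rightarrow> 'd::finite heis \<Rightarrow> complex" where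
  "lift m \<phi> p = zsq p ^ m *\<^sub>R \<phi> (koranyi4 p)"

lemma Ck_lift: "Ck n \<phi> \<Longrightarrow> Ck n (lift m \<phi>)"
  unfolding lift_def[abs_def] by (rule Ck_scaleR[OF Ck_power[OF Ck_zsq] Ck_comp_real[OF _ Ck_koranyi4]])

lemma bounded_koranyi4_le: "bounded {p :: 'd::finite heis. koranyi4 p \<le> b}"
proof (rule bounded_subset)
  show "bounded (cball 0 (1 + \<bar>b\<bar>) \<times> cball 0 (1 + \<bar>b\<bar>) :: 'd heis set)"
    by (intro bounded_Times) auto
  show "{p :: 'd heis. koranyi4 p \<le> b} \<subseteq> cball 0 (1 + \<bar>b\<bar>) \<times> cball 0 (1 + \<bar>b\<bar>)"
  proof
    fix p :: "'d heis" assume "p \<in> {p. koranyi4 p \<le> b}"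
    then have "koranyi4 p \<le> b" by simp
    moreover have "0 \<le> (snd p)\<^sup>2" "0 \<le> (zsq p)\<^sup>2" by simp_all
    ultimately have *: "(zsq p)\<^sup>2 \<le> \<bar>b\<bar>" "(snd p)\<^sup>2 \<le> \<bar>b\<bar>"
      unfolding koranyi4_def by linarith+
    have step: "y \<le> 1 + \<bar>b\<bar>" if "y\<^sup>2 \<le> 1 + \<bar>b\<bar>" for y :: real
    proof (cases "y \<le> 1")
      case False
      then have "y * 1 \<le> y * y" by (intro mult_left_mono) auto
      then show ?thesis using that by (simp add: power2_eq_square)
    qed simp
    have "zsq p \<le> 1 + \<bar>b\<bar>" using *(1) step[of "zsq p"] by linarith
    then have "norm (fst p) \<le> 1 + \<bar>b\<bar>" unfolding zsq_def by (rule step)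
    moreover have "\<bar>snd p\<bar> \<le> 1 + \<bar>b\<bar>" using *(2) step[of "\<bar>snd p\<bar>"] by simp
    ultimately show "p \<in> cball 0 (1 + \<bar>b\<bar>) \<times> cball 0 (1 + \<bar>b\<bar>)"
      by (simp add: mem_Times_iff)
  qed
qed

lemma bounded_support_lift:
  assumes "annular \<phi>" shows "bounded {p :: 'd::finite heis. lift m \<phi> p \<noteq> 0}"
proof -
  obtain a b where ab: "0 < a" "a < b" "\<And>y. y < a \<Longrightarrow> \<phi> y = 0" "\<And>y. y > b \<Longrightarrow> \<phi> y = 0"
    using annularE[OF assms] by metis
  show ?thesis
  proof (rule bounded_subset[OF bounded_koranyi4_le[of b]], rule subsetI)
    fix p :: "'d heis" assume "p \<in> {p. lift m \<phi> p \<noteq> 0}"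
    then have "\<phi> (koranyi4 p) \<noteq> 0" by (auto simp: lift_def)
    then show "p \<in> {p. koranyi4 p \<le> b}" using ab(4)[of "koranyi4 p"] by (cases "koranyi4 p \<le> b") simp_all
  qed
qed

lemma integrable_lift:
  assumes "annular \<phi>" "continuous_on UNIV \<phi>"
  shows "integrable lebesgue (lift m \<phi> :: 'd::finite heis \<Rightarrow> complex)"
proof -
  have "Ck 0 (lift m \<phi> :: 'd heis \<Rightarrow> complex)" by (rule Ck_lift) (simp add: assms)
  then show ?thesis by (intro continuous_bounded_support_integrable bounded_support_lift assms) simp
qed

lemma field_deriv_lift:
  fixes p :: "'d::finite heis"
  assumes "Ck 1 \<phi>"
  shows "field_deriv k (lift m \<phi>) p = (real m * zsq p ^ (m - 1) * d_zsq k p) *\<^sub>R \<phi> (koranyi4 p)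
           + (zsq p ^ m * d_koranyi4 k p) *\<^sub>R vector_derivative \<phi> (at (koranyi4 p))"
proof -
  have 1: "((\<lambda>p. zsq p ^ m) has_derivative (\<lambda>v. real m * (2 * (fst p \<bullet> fst v)) * zsq p ^ (m - 1))) (at p)"
    by (rule has_derivative_power[OF zsq_has_derivative, THEN has_derivative_eq_rhs]) (simp add: fun_eq_iff mult.assoc)
  have 2: "((\<lambda>p. \<phi> (koranyi4 p)) has_derivative
      (\<lambda>v. (2 * zsq p * (2 * (fst p \<bullet> fst v)) + 2 * snd p * snd v) *\<^sub>R vector_derivative \<phi> (at (koranyi4 p)))) (at p)"
    by (rule has_derivative_compose[OF koranyi4_has_derivative
          Ck_has_vector_derivative[OF assms[unfolded One_nat_def], unfolded has_vector_derivative_def]])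
  from field_deriv_eq[OF bounded_bilinear.FDERIV[OF bounded_bilinear_scaleR 1 2]]
  show ?thesis
    unfolding lift_def[abs_def] d_koranyi4_def d_zsq_def twist_def by (simp add: algebra_simps)
qed

lemma d_zsq_horizontal_field: "d_zsq k (horizontal_field k p) = 2"
  by (cases k) (simp_all add: d_zsq_simps horizontal_field_def)

lemma twist_horizontal_field: "twist k (horizontal_field k p) = 0"
  by (cases k) (simp_all add: twist_simps horizontal_field_def)

text \<open>
  The product rule; the divergence of \<open>\<nabla>R\<close> is \<open>4d\<close>.
\<close>

lemma div_zsq_field:
  fixes v :: "'d::finite heis \<Rightarrow> complex"
  assumes "Ck 1 v"
  shows "(\<Sum>k\<in>UNIV. field_deriv k (\<lambda>p. d_zsq k p *\<^sub>R v p) p)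
           = (4 * real CARD('d)) *\<^sub>R v p + (\<Sum>k\<in>UNIV. d_zsq k p *\<^sub>R field_deriv k v p)"
proof -
  have "(\<Sum>k\<in>(UNIV :: ('d + 'd) set). 2 *\<^sub>R v p) = (\<Sum>k\<in>(UNIV :: ('d + 'd) set). 2) *\<^sub>R v p"
    by (rule scaleR_sum_left[symmetric])
  also have "(\<Sum>k\<in>(UNIV :: ('d + 'd) set). 2) = 4 * real CARD('d)" by simp
  finally show ?thesis
    unfolding field_deriv_bilinear[OF bounded_bilinear_scaleR
        bounded_linear_imp_has_derivative[OF bounded_linear_d_zsq] assms]
      d_zsq_horizontal_field sum.distrib by (simp only: add.commute)
qed

text \<open>
  The product rule; the divergence of \<open>\<nabla>N\<close> is \<open>(8d + 16) R\<close>.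
\<close>

lemma div_koranyi4_field:
  fixes v :: "'d::finite heis \<Rightarrow> complex"
  assumes "Ck 1 v"
  shows "(\<Sum>k\<in>UNIV. field_deriv k (\<lambda>p. d_koranyi4 k p *\<^sub>R v p) p)
           = ((8 * real CARD('d) + 16) * zsq p) *\<^sub>R v p + (\<Sum>k\<in>UNIV. d_koranyi4 k p *\<^sub>R field_deriv k v p)"
proof -
  have "(d_koranyi4 k has_derivative (\<lambda>h. 2 * (zsq p * d_zsq k h + 2 * (fst p \<bullet> fst h) * d_zsq k p)
      + 2 * (snd p * twist k h + snd h * twist k p))) (at p)" for k
    unfolding d_koranyi4_def[abs_def]
    by (auto intro!: derivative_eq_intros zsq_has_derivative
        bounded_linear_imp_has_derivative[OF bounded_linear_d_zsq]
        bounded_linear_imp_has_derivative[OF bounded_linear_twist] simp: fun_eq_iff algebra_simps)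
  note D = field_deriv_bilinear[OF bounded_bilinear_scaleR this assms]
  have "field_deriv k (\<lambda>p. d_koranyi4 k p *\<^sub>R v p) p = d_koranyi4 k p *\<^sub>R field_deriv k v p
      + (4 * zsq p + 2 * (d_zsq k p)\<^sup>2 + 2 * (twist k p)\<^sup>2) *\<^sub>R v p" for k
    unfolding D d_zsq_horizontal_field twist_horizontal_field
    by (simp add: d_zsq_def twist_def power2_eq_square algebra_simps)
  moreover have "(\<Sum>k\<in>UNIV. 4 * zsq p + 2 * (d_zsq k p)\<^sup>2 + 2 * (twist k p)\<^sup>2) = (8 * real CARD('d) + 16) * zsq p"
    unfolding sum.distrib sum_distrib_left[symmetric] frame_sums by (simp add: algebra_simps)
  ultimately show ?thesis by (simp add: sum.distrib scaleR_sum_left[symmetric])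
qed

lemma sum_field_deriv_lift:
  fixes p :: "'d::finite heis"
  assumes "Ck 1 \<phi>"
  shows "(\<Sum>k\<in>UNIV. d_zsq k p *\<^sub>R field_deriv k (lift m \<phi>) p)
           = (4 * real m) *\<^sub>R lift m \<phi> p + 8 *\<^sub>R lift (m + 2) (\<lambda>y. vector_derivative \<phi> (at y)) p"
    and "(\<Sum>k\<in>UNIV. d_koranyi4 k p *\<^sub>R field_deriv k (lift m \<phi>) p)
           = (8 * real m) *\<^sub>R lift (m + 1) \<phi> p + 16 *\<^sub>R lift (m + 1) (\<lambda>y. y *\<^sub>R vector_derivative \<phi> (at y)) p"
proof -
  have p1: "real m * zsq p ^ (m - 1) * (4 * zsq p) = 4 * real m * zsq p ^ m" by (cases m) auto
  have "(\<Sum>k\<in>UNIV. d_zsq k p *\<^sub>R field_deriv k (lift m \<phi>) p)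
      = (real m * zsq p ^ (m - 1) * (\<Sum>k\<in>UNIV. (d_zsq k p)\<^sup>2)) *\<^sub>R \<phi> (koranyi4 p)
        + (zsq p ^ m * (\<Sum>k\<in>UNIV. d_zsq k p * d_koranyi4 k p)) *\<^sub>R vector_derivative \<phi> (at (koranyi4 p))"
    unfolding field_deriv_lift[OF assms] sum_distrib_left scaleR_sum_left sum.distrib[symmetric]
    by (rule sum.cong) (simp_all add: algebra_simps power2_eq_square)
  then show "(\<Sum>k\<in>UNIV. d_zsq k p *\<^sub>R field_deriv k (lift m \<phi>) p)
           = (4 * real m) *\<^sub>R lift m \<phi> p + 8 *\<^sub>R lift (m + 2) (\<lambda>y. vector_derivative \<phi> (at y)) p"
    unfolding frame_sums gradient_products p1 by (simp add: lift_def power_add power2_eq_square mult_ac)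
  have p2: "real m * zsq p ^ (m - 1) * (8 * (zsq p)\<^sup>2) = 8 * real m * zsq p ^ (m + 1)"
    by (cases m) (auto simp: power2_eq_square)
  have "(\<Sum>k\<in>UNIV. d_koranyi4 k p *\<^sub>R field_deriv k (lift m \<phi>) p)
      = (real m * zsq p ^ (m - 1) * (\<Sum>k\<in>UNIV. d_zsq k p * d_koranyi4 k p)) *\<^sub>R \<phi> (koranyi4 p)
        + (zsq p ^ m * (\<Sum>k\<in>UNIV. (d_koranyi4 k p)\<^sup>2)) *\<^sub>R vector_derivative \<phi> (at (koranyi4 p))"
    unfolding field_deriv_lift[OF assms] sum_distrib_left scaleR_sum_left sum.distrib[symmetric]
    by (rule sum.cong) (simp_all add: algebra_simps power2_eq_square)
  then show "(\<Sum>k\<in>UNIV. d_koranyi4 k p *\<^sub>R field_deriv k (lift m \<phi>) p)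
           = (8 * real m) *\<^sub>R lift (m + 1) \<phi> p + 16 *\<^sub>R lift (m + 1) (\<lambda>y. y *\<^sub>R vector_derivative \<phi> (at y)) p"
    unfolding gradient_products p2 by (simp add: lift_def power_add power2_eq_square mult_ac)
qed

section \<open>Moment identities on Koranyi spheres\<close>

lemma integral_divergence:
  fixes F :: "'d + 'd \<Rightarrow> 'd::finite heis \<Rightarrow> complex"
  assumes "\<And>k. Ck 1 (F k)" "\<And>k. bounded {p. F k p \<noteq> 0}"
  shows "(LINT p|lebesgue. (\<Sum>k\<in>UNIV. field_deriv k (F k) p)) = 0"
proof -
  have "integrable lebesgue (field_deriv k (F k))" for k
    using Ck_field_deriv[of 0 "F k" k] assms(1)[of k]
    by (intro continuous_bounded_support_integrable bounded_support_field_deriv assms(2)) (simp del: Ck.simps(2))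
  then show ?thesis
    by (subst Bochner_Integration.integral_sum) (simp_all add: integral_field_deriv[OF assms])
qed

lemma annular_mult_id: "annular \<phi> \<Longrightarrow> annular (\<lambda>y. y *\<^sub>R \<phi> y :: complex)"
  by (rule annular_mono) auto

lemma Ck_mult_id: "Ck n \<phi> \<Longrightarrow> Ck n (\<lambda>y. y *\<^sub>R \<phi> y :: complex)"
  by (rule Ck_scaleR[OF Ck_bounded_linear[OF bounded_linear_ident]])

context
  fixes \<phi> :: "real \<Rightarrow> complex" and dtype :: "'d::finite itself"
  assumes \<phi>: "annular \<phi>" "Ck 1 \<phi>"
begin

private lemma \<phi>_cont: "continuous_on UNIV \<phi>"
  using Ck_imp_continuous[OF \<phi>(2)] .

private lemma \<phi>'_cont: "continuous_on UNIV (\<lambda>y. vector_derivative \<phi> (at y))"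
  using Ck_vector_derivative[OF \<phi>(2)[unfolded One_nat_def]] by simp

text \<open>
  The divergence theorem for \<open>\<phi>(N) R\<^sup>m \<nabla>R\<close>.
\<close>

lemma zsq_divergence_identity:
  "(4 * (real CARD('d) + real m)) *\<^sub>R (LINT p|lebesgue. lift m \<phi> (p :: 'd heis))
     + 8 *\<^sub>R (LINT p|lebesgue. lift (m + 2) (\<lambda>y. vector_derivative \<phi> (at y)) (p :: 'd heis)) = 0"
proof -
  have C: "Ck 1 (lift m \<phi> :: 'd heis \<Rightarrow> complex)" by (rule Ck_lift[OF \<phi>(2)])
  have "(LINT p|lebesgue. (\<Sum>k\<in>UNIV. field_deriv k (\<lambda>p :: 'd heis. d_zsq k p *\<^sub>R lift m \<phi> p) p)) = 0"
    by (intro integral_divergence Ck_scaleR Ck_d_zsq C bounded_subset[OF bounded_support_lift[OF \<phi>(1), of m]]) auto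
  then have "(LINT p|lebesgue. (4 * (real CARD('d) + real m)) *\<^sub>R lift m \<phi> (p :: 'd heis)
      + 8 *\<^sub>R lift (m + 2) (\<lambda>y. vector_derivative \<phi> (at y)) p) = 0"
    unfolding div_zsq_field[OF C] sum_field_deriv_lift(1)[OF \<phi>(2)]
    by (simp only: add.assoc[symmetric] scaleR_add_left[symmetric] distrib_left)
  then show ?thesis
    using integrable_lift[OF \<phi>(1) \<phi>_cont, of m, where ?'d = 'd]
      integrable_lift[OF annular_derivative[OF \<phi>(1)] \<phi>'_cont, of "m + 2", where ?'d = 'd]
    by (simp del: add_2_eq_Suc')
qed

text \<open>
  The divergence theorem for \<open>\<phi>(N) R\<^sup>m \<nabla>N\<close>.
\<close>

lemma koranyi4_divergence_identity:
  "(8 * real CARD('d) + 16 + 8 * real m) *\<^sub>R (LINT p|lebesgue. lift (m + 1) \<phi> (p :: 'd heis))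
     + 16 *\<^sub>R (LINT p|lebesgue. lift (m + 1) (\<lambda>y. y *\<^sub>R vector_derivative \<phi> (at y)) (p :: 'd heis)) = 0"
proof -
  have C: "Ck 1 (lift m \<phi> :: 'd heis \<Rightarrow> complex)" by (rule Ck_lift[OF \<phi>(2)])
  have shift: "((8 * real CARD('d) + 16) * zsq p) *\<^sub>R lift m \<phi> p = (8 * real CARD('d) + 16) *\<^sub>R lift (m + 1) \<phi> p"
    for p :: "'d heis" by (simp add: lift_def mult.assoc)
  have "(LINT p|lebesgue. (\<Sum>k\<in>UNIV. field_deriv k (\<lambda>p :: 'd heis. d_koranyi4 k p *\<^sub>R lift m \<phi> p) p)) = 0"
    by (intro integral_divergence Ck_scaleR Ck_d_koranyi4 C bounded_subset[OF bounded_support_lift[OF \<phi>(1), of m]]) auto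
  then have "(LINT p|lebesgue. (8 * real CARD('d) + 16 + 8 * real m) *\<^sub>R lift (m + 1) \<phi> (p :: 'd heis)
      + 16 *\<^sub>R lift (m + 1) (\<lambda>y. y *\<^sub>R vector_derivative \<phi> (at y)) p) = 0"
    unfolding div_koranyi4_field[OF C] sum_field_deriv_lift(2)[OF \<phi>(2)] shift
    by (simp only: add.assoc[symmetric] scaleR_add_left[symmetric])
  then show ?thesis
    using integrable_lift[OF \<phi>(1) \<phi>_cont, of "m + 1", where ?'d = 'd]
      integrable_lift[OF annular_mult_id[OF annular_derivative[OF \<phi>(1)]], of "m + 1", where ?'d = 'd]
      continuous_on_scaleR[OF continuous_on_id \<phi>'_cont]
    by (simp del: add_2_eq_Suc' Suc_eq_plus1_left Suc_eq_plus1)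
qed

end

text \<open>
  Applying the first divergence identity to \<open>y \<phi>(y)\<close> and the second one to \<open>\<phi>\<close>, with \<open>m + 1\<close> in
  place of \<open>m\<close>, and eliminating the term with \<open>\<phi>'\<close>.
\<close>

lemma moment_identity_C1:
  assumes \<phi>: "annular \<phi>" "Ck 1 \<phi>"
  shows "(real CARD('d) + real m) *\<^sub>R (LINT p|lebesgue. lift m (\<lambda>y. y *\<^sub>R \<phi> y) (p :: 'd::finite heis))
       = (real CARD('d) + real m + 1) *\<^sub>R (LINT p|lebesgue. lift (m + 2) \<phi> (p :: 'd heis))"
proof -
  let ?\<phi>' = "\<lambda>y. vector_derivative \<phi> (at y)"
  let ?I = "\<lambda>\<psi>. LINT p|lebesgue. lift (m + 2) \<psi> (p :: 'd heis)"
  have "vector_derivative (\<lambda>y. y *\<^sub>R \<phi> y) (at y) = \<phi> y + y *\<^sub>R ?\<phi>' y" for y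
  proof (rule vector_derivative_at)
    show "((\<lambda>y. y *\<^sub>R \<phi> y) has_vector_derivative \<phi> y + y *\<^sub>R ?\<phi>' y) (at y)"
      using has_vector_derivative_scaleR[OF DERIV_ident Ck_has_vector_derivative[OF \<phi>(2)[unfolded One_nat_def]]]
      by (simp add: add.commute)
  qed
  moreover have "lift (m + 2) (\<lambda>y. \<phi> y + y *\<^sub>R ?\<phi>' y) = (\<lambda>p :: 'd heis. lift (m + 2) \<phi> p + lift (m + 2) (\<lambda>y. y *\<^sub>R ?\<phi>' y) p)"
    by (simp add: lift_def scaleR_add_right fun_eq_iff)
  moreover have "continuous_on UNIV ?\<phi>'" using Ck_vector_derivative[OF \<phi>(2)[unfolded One_nat_def]] by simp
  then have "integrable lebesgue (lift (m + 2) \<phi> :: 'd heis \<Rightarrow> complex)"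
    "integrable lebesgue (lift (m + 2) (\<lambda>y. y *\<^sub>R ?\<phi>' y) :: 'd heis \<Rightarrow> complex)"
    by (intro integrable_lift \<phi> annular_mult_id annular_derivative Ck_imp_continuous[OF \<phi>(2)]
        continuous_on_scaleR continuous_on_id; assumption)+
  ultimately have "(4 * (real CARD('d) + real m)) *\<^sub>R (LINT p|lebesgue. lift m (\<lambda>y. y *\<^sub>R \<phi> y) (p :: 'd heis))
      + 8 *\<^sub>R (?I \<phi> + ?I (\<lambda>y. y *\<^sub>R ?\<phi>' y)) = 0"
    using zsq_divergence_identity[OF annular_mult_id[OF \<phi>(1)] Ck_mult_id[OF \<phi>(2)], of m, where ?'d = 'd]
    by (simp del: add_2_eq_Suc' scaleR_add_right)
  moreover have "(8 * real CARD('d) + 24 + 8 * real m) *\<^sub>R ?I \<phi> + 16 *\<^sub>R ?I (\<lambda>y. y *\<^sub>R ?\<phi>' y) = 0"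
    using koranyi4_divergence_identity[OF \<phi>, of "m + 1", where ?'d = 'd] by (simp add: add.commute add.left_commute)
  ultimately show ?thesis
    by (simp only: scaleR_conv_of_real of_real_add of_real_mult of_real_numeral of_real_1) algebra
qed

lemma AE_zsq_pos: "AE p in lebesgue. zsq (p :: 'd::finite heis) > 0"
proof -
  obtain j :: 'd where True by blast
  have "negligible {p :: 'd heis. (axis j 1, 0) \<bullet> p = 0}"
    by (rule negligible_hyperplane) (simp add: zero_prod_def)
  then have "{p :: 'd heis. (axis j 1, 0) \<bullet> p = 0} \<in> null_sets lebesgue"
    by (simp add: negligible_iff_null_sets)
  then show ?thesis
  proof (rule AE_I')
    show "{p \<in> space lebesgue. \<not> 0 < zsq p} \<subseteq> {p :: 'd heis. (axis j 1, 0) \<bullet> p = 0}"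
      by (auto simp: zsq_def)
  qed
qed

lemma continuous_zsq: "continuous_on S zsq" and continuous_koranyi4: "continuous_on S koranyi4"
  by (rule Ck_imp_continuous[OF Ck_zsq], rule Ck_imp_continuous[OF Ck_koranyi4])

lemma borel_measurable_zsq: "zsq \<in> borel_measurable lebesgue"
  and borel_measurable_koranyi4: "koranyi4 \<in> borel_measurable lebesgue"
  by (rule measurable_completion, simp add: borel_measurable_continuous_onI continuous_zsq continuous_koranyi4)+

text \<open>
  The integral of \<open>R\<^bsup>m+1\<^esup> \<zeta>(N)\<close> is a functional of \<open>\<zeta>\<close> that vanishes on the range of the Euler
  operator \<open>y \<psi>' + (r+1) \<psi>\<close> with \<open>r = (d+m)/2\<close>, by the divergence identity for \<open>\<nabla>N\<close>. That range
  has codimension one, so the functional is a multiple of \<open>\<integral> y\<^sup>r \<zeta>(y) dy\<close>.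
\<close>

lemma polar_formula:
  obtains C :: complex where
    "\<And>\<zeta>. annular \<zeta> \<Longrightarrow> continuous_on UNIV \<zeta> \<Longrightarrow>
       (LINT p|lebesgue. lift (m + 1) \<zeta> (p :: 'd::finite heis))
         = C * (LINT y|lborel. (y powr ((real CARD('d) + real m) / 2)) *\<^sub>R \<zeta> y)"
proof -
  obtain \<alpha> :: "real \<Rightarrow> complex" where \<alpha>: "annular \<alpha>" "\<And>n. Ck n \<alpha>" "(LINT y|lborel. \<alpha> y) = 1"
    by (rule ex_annular_bump) blast
  define r where "r = (real CARD('d) + real m) / 2"
  \<comment> \<open>A profile with \<open>\<integral> y\<^sup>r \<beta>(y) dy = 1\<close>; the constant is its value under the functional.\<close>
  define \<beta> where "\<beta> y = (y powr (- r)) *\<^sub>R \<alpha> y" for y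
  have \<beta>: "annular \<beta>" "continuous_on UNIV \<beta>"
    unfolding \<beta>_def using annular_powr_continuous[OF \<alpha>(1) Ck_imp_continuous[OF \<alpha>(2)]]
    by (auto intro: annular_mono[OF \<alpha>(1)])
  show thesis
  proof
    fix \<zeta> :: "real \<Rightarrow> complex" assume \<zeta>: "annular \<zeta>" "continuous_on UNIV \<zeta>"
    define \<kappa> where "\<kappa> = (LINT y|lborel. (y powr r) *\<^sub>R \<zeta> y)"
    obtain \<psi> where \<psi>: "annular \<psi>" "\<And>n. Ck n \<zeta> \<Longrightarrow> Ck (Suc n) \<psi>"
      "\<And>y. y *\<^sub>R vector_derivative \<psi> (at y) + (r + 1) *\<^sub>R \<psi> y = \<zeta> y - \<kappa> * (y powr (- r)) *\<^sub>R \<alpha> y"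
      using euler_equation_solvable[OF \<alpha>, of \<zeta> 0 r] \<zeta> unfolding \<kappa>_def by auto
    have C1: "Ck 1 \<psi>" using \<psi>(2)[of 0] \<zeta>(2) by simp
    let ?\<psi>' = "\<lambda>y. y *\<^sub>R vector_derivative \<psi> (at y)"
    have "continuous_on UNIV ?\<psi>'"
      using Ck_vector_derivative[OF C1[unfolded One_nat_def]] by (intro continuous_on_scaleR continuous_on_id) simp
    then have int: "integrable lebesgue (lift (m + 1) \<psi> :: 'd heis \<Rightarrow> complex)"
      "integrable lebesgue (lift (m + 1) ?\<psi>' :: 'd heis \<Rightarrow> complex)"
      "integrable lebesgue (lift (m + 1) \<zeta> :: 'd heis \<Rightarrow> complex)"
      "integrable lebesgue (lift (m + 1) \<beta> :: 'd heis \<Rightarrow> complex)"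
      using \<zeta> \<beta> \<psi>(1) Ck_imp_continuous[OF C1]
      by (auto intro!: integrable_lift annular_mult_id annular_derivative simp del: add_2_eq_Suc' Suc_eq_plus1_left Suc_eq_plus1)
    have "lift (m + 1) \<zeta> p - \<kappa> * lift (m + 1) \<beta> p = lift (m + 1) ?\<psi>' p + (r + 1) *\<^sub>R lift (m + 1) \<psi> p" for p :: "'d heis"
    proof -
      have "lift (m + 1) \<zeta> p - \<kappa> * lift (m + 1) \<beta> p
          = zsq p ^ (m + 1) *\<^sub>R (\<zeta> (koranyi4 p) - \<kappa> * (koranyi4 p powr (- r)) *\<^sub>R \<alpha> (koranyi4 p))"
        by (simp add: lift_def \<beta>_def scaleR_diff_right)
      also have "\<dots> = lift (m + 1) ?\<psi>' p + (r + 1) *\<^sub>R lift (m + 1) \<psi> p"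
        unfolding \<psi>(3)[symmetric] by (simp add: lift_def scaleR_add_right)
      finally show ?thesis .
    qed
    note pointwise = this
    let ?I = "\<lambda>\<phi>. LINT p|lebesgue. lift (m + 1) \<phi> (p :: 'd heis)"
    have "?I \<zeta> - \<kappa> * ?I \<beta> = (LINT p|lebesgue. lift (m + 1) \<zeta> (p :: 'd heis) - \<kappa> * lift (m + 1) \<beta> p)"
      by (subst Bochner_Integration.integral_diff[OF int(3) integrable_mult_right[OF int(4)]]) simp
    also have "\<dots> = (LINT p|lebesgue. lift (m + 1) ?\<psi>' (p :: 'd heis) + (r + 1) *\<^sub>R lift (m + 1) \<psi> p)"
      unfolding pointwise ..
    also have "\<dots> = ?I ?\<psi>' + (r + 1) *\<^sub>R ?I \<psi>"
      by (subst Bochner_Integration.integral_add[OF int(2) integrable_scaleR_right[OF int(1)]]) simp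
    finally have "?I \<zeta> - \<kappa> * ?I \<beta> = ?I ?\<psi>' + (r + 1) *\<^sub>R ?I \<psi>" .
    then have "16 *\<^sub>R (?I \<zeta> - \<kappa> * ?I \<beta>) = 16 *\<^sub>R (?I ?\<psi>' + (r + 1) *\<^sub>R ?I \<psi>)" by simp
    also have "\<dots> = (8 * real CARD('d) + 16 + 8 * real m) *\<^sub>R ?I \<psi> + 16 *\<^sub>R ?I ?\<psi>'"
    proof -
      have "16 * (r + 1) = 8 * real CARD('d) + 16 + 8 * real m" by (simp add: r_def)
      then show ?thesis unfolding scaleR_add_right scaleR_scaleR by (simp only: add.commute)
    qed
    also have "\<dots> = 0" by (rule koranyi4_divergence_identity[OF \<psi>(1) C1])
    finally show "(LINT p|lebesgue. lift (m + 1) \<zeta> (p :: 'd heis))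
        = (LINT p|lebesgue. lift (m + 1) \<beta> (p :: 'd heis)) * (LINT y|lborel. (y powr ((real CARD('d) + real m) / 2)) *\<^sub>R \<zeta> y)"
      unfolding \<kappa>_def r_def by (simp add: mult.commute)
  qed
qed

text \<open>
  Both sides are multiples of the same one-dimensional integral by \<open>polar_formula\<close>, so the
  differentiable case, applied to one bump, fixes the ratio for all continuous profiles.
\<close>

lemma moment_identity:
  assumes \<phi>: "annular \<phi>" "continuous_on UNIV \<phi>"
  shows "(real CARD('d) + real m + 1) *\<^sub>R (LINT p|lebesgue. lift (m + 1) (\<lambda>y. y *\<^sub>R \<phi> y) (p :: 'd::finite heis))
       = (real CARD('d) + real m + 2) *\<^sub>R (LINT p|lebesgue. lift (m + 3) \<phi> (p :: 'd heis))"
proof -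
  define r where "r = (real CARD('d) + real m) / 2"
  have r: "(real CARD('d) + real (m + 2)) / 2 = r + 1" by (simp add: r_def field_simps)
  obtain C where C: "\<And>\<zeta>. annular \<zeta> \<Longrightarrow> continuous_on UNIV \<zeta> \<Longrightarrow>
       (LINT p|lebesgue. lift (m + 1) \<zeta> (p :: 'd heis)) = C * (LINT y|lborel. (y powr r) *\<^sub>R \<zeta> y)"
    using polar_formula[of m, where ?'d = 'd] unfolding r_def by blast
  obtain C' where C': "\<And>\<zeta>. annular \<zeta> \<Longrightarrow> continuous_on UNIV \<zeta> \<Longrightarrow>
       (LINT p|lebesgue. lift (m + 3) \<zeta> (p :: 'd heis)) = C' * (LINT y|lborel. (y powr (r + 1)) *\<^sub>R \<zeta> y)"
  proof -
    have "m + 2 + 1 = m + 3" by simp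
    then show thesis using polar_formula[of "m + 2", where ?'d = 'd] that unfolding r by metis
  qed
  have pw: "(y powr r) *\<^sub>R (y *\<^sub>R \<phi> y) = (y powr (r + 1)) *\<^sub>R \<phi> y" if "annular \<phi>" for \<phi> :: "real \<Rightarrow> complex" and y
  proof (cases "y > 0")
    case False
    then have "\<phi> y = 0" using that unfolding annular_def by force
    then show ?thesis by simp
  qed (simp add: powr_add)
  have eq: "(LINT p|lebesgue. lift (m + 1) (\<lambda>y. y *\<^sub>R \<phi> y) (p :: 'd heis)) = C * (LINT y|lborel. (y powr (r + 1)) *\<^sub>R \<phi> y)"
    if "annular \<phi>" "continuous_on UNIV \<phi>" for \<phi>
    unfolding C[OF annular_mult_id[OF that(1)] continuous_on_scaleR[OF continuous_on_id that(2)]] pw[OF that(1)] ..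
  obtain \<alpha> :: "real \<Rightarrow> complex" where \<alpha>: "annular \<alpha>" "\<And>n. Ck n \<alpha>" "(LINT y|lborel. \<alpha> y) = 1"
    by (rule ex_annular_bump) blast
  \<comment> \<open>A bump with \<open>\<integral> y\<^bsup>r+1\<^esup> \<beta>(y) dy = 1\<close> reads off the two constants.\<close>
  define \<beta> where "\<beta> y = (y powr (- (r + 1))) *\<^sub>R \<alpha> y" for y
  have \<beta>: "annular \<beta>" "Ck 1 \<beta>"
    unfolding \<beta>_def by (rule annular_mono[OF \<alpha>(1)], simp, rule Ck_annular_powr[OF \<alpha>(1,2)])
  have "(y powr (r + 1)) *\<^sub>R \<beta> y = \<alpha> y" for y
  proof (cases "y > 0")
    case True
    then have "y powr (r + 1) * y powr (- (r + 1)) = 1" using powr_add[of y "r + 1" "- (r + 1)"] by simp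
    then show ?thesis by (simp add: \<beta>_def)
  next
    case False
    then have "\<alpha> y = 0" using \<alpha>(1) unfolding annular_def by force
    then show ?thesis by (simp add: \<beta>_def)
  qed
  then have "(real CARD('d) + real m + 1) *\<^sub>R C = (real CARD('d) + real m + 2) *\<^sub>R C'"
    using moment_identity_C1[OF \<beta>, of "m + 1", where ?'d = 'd] eq[OF \<beta>(1) Ck_imp_continuous[OF \<beta>(2)]]
      C'[OF \<beta>(1) Ck_imp_continuous[OF \<beta>(2)]] \<alpha>(3)
    by (simp add: numeral_3_eq_3 add_ac)
  then show ?thesis
    unfolding eq[OF \<phi>] C'[OF \<phi>] by (metis mult_scaleR_left)
qed

lemma annular_of_cbox:
  fixes \<phi> :: "real \<Rightarrow> complex"
  assumes "cbox c d \<subseteq> {0<..}" "\<And>y. y \<notin> cbox c d \<Longrightarrow> \<phi> y = 0"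
  shows "annular \<phi>"
proof (cases "c \<le> d")
  case True
  then have "c > 0" using assms(1) by auto
  then show ?thesis using assms(2) True by (intro annularI[of "c" "d + 1"]) force+
next
  case False
  then have "\<phi> y = 0" for y using assms(2) by auto
  then show ?thesis by (intro annularI[of 1 2]) auto
qed

text \<open>
  Otherwise every annular function times \<open>R\<close> would have integral zero, and the fundamental lemma
  along \<open>N\<close> would show that almost every point is the origin.
\<close>

lemma polar_constant_nonzero:
  assumes "\<And>\<zeta>. annular \<zeta> \<Longrightarrow> continuous_on UNIV \<zeta> \<Longrightarrow>
       (LINT p|lebesgue. lift 1 \<zeta> (p :: 'd::finite heis)) = C * (LINT y|lborel. (y powr r) *\<^sub>R \<zeta> y)"
  shows "C \<noteq> 0"
proof
  assume "C = 0"
  have "AE p in lebesgue. koranyi4 (p :: 'd heis) \<in> {0<..} \<longrightarrow> (1 :: complex) = 0"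
  proof (rule fundamental_lemma_along[where g = "\<lambda>_. 1" and w = zsq])
    show "integrable lebesgue (\<lambda>x :: 'd heis. indicat_real (cbox c d) (koranyi4 x) *\<^sub>R (zsq x *\<^sub>R (1 :: complex)))" for c d
    proof -
      have "integrable lebesgue (\<lambda>x :: 'd heis. indicat_real (koranyi4 -` cbox c d) x *\<^sub>R (zsq x *\<^sub>R (1 :: complex)))"
      proof -
        have cl: "closed (koranyi4 -` cbox c d :: 'd heis set)"
          by (intro closed_vimage continuous_koranyi4 closed_cbox)
        have "bounded (koranyi4 -` cbox c d :: 'd heis set)"
          by (rule bounded_subset[OF bounded_koranyi4_le[of d]]) auto
        then have "compact (koranyi4 -` cbox c d :: 'd heis set)" using cl by (simp add: compact_eq_bounded_closed)
        then have "integrable lborel (\<lambda>x :: 'd heis. indicat_real (koranyi4 -` cbox c d) x *\<^sub>R (zsq x *\<^sub>R (1 :: complex)))"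
          by (intro borel_integrable_compact continuous_intros continuous_zsq)
        then show ?thesis using integrable_completion borel_measurable_integrable by blast
      qed
      then show ?thesis by (simp add: indicator_def)
    qed
    fix \<phi> :: "real \<Rightarrow> complex" and c d :: real
    assume \<phi>: "\<And>n. Ck n \<phi>" "cbox c d \<subseteq> {0<..}" "\<And>y. y \<notin> cbox c d \<Longrightarrow> \<phi> y = 0"
    have "annular \<phi>" by (rule annular_of_cbox[OF \<phi>(2,3)])
    from assms[OF this Ck_imp_continuous[OF \<phi>(1)]] \<open>C = 0\<close>
    show "(LINT x|lebesgue. \<phi> (koranyi4 (x :: 'd heis)) * (zsq x *\<^sub>R 1)) = 0"
      by (simp add: lift_def scaleR_conv_of_real mult.commute)
  qed (auto simp: continuous_koranyi4 AE_zsq_pos)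
  then have "AE p in lebesgue. (p :: 'd heis) \<noteq> p"
    using AE_zsq_pos
  proof eventually_elim
    case (elim p)
    have "koranyi4 p > 0" using elim(2) by (simp add: koranyi4_def add_pos_nonneg)
    with elim(1) have False by simp
    then show ?case ..
  qed
  then have "ae_filter (lebesgue :: 'd heis measure) = bot" by (simp add: eventually_False)
  then show False unfolding ae_filter_eq_bot_iff by simp
qed

section \<open>Functions integrable over annuli\<close>

text \<open>
  Local integrability away from the origin, which is what radial test functions see.
\<close>

definition annulus_integrable :: "('d::finite heis \<Rightarrow> complex) \<Rightarrow> bool" where
  "annulus_integrable h \<longleftrightarrow>
     (\<forall>a b. 0 < a \<longrightarrow> integrable lebesgue (\<lambda>p. indicat_real {a..b} (koranyi4 p) *\<^sub>R h p))"

lemma annular_bounded: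
  fixes \<phi> :: "real \<Rightarrow> 'b::real_normed_vector"
  assumes "annular \<phi>" "continuous_on UNIV \<phi>"
  obtains B where "B > 0" "\<And>y. norm (\<phi> y) \<le> B"
proof -
  obtain a b where ab: "0 < a" "a < b" "\<And>y. y < a \<Longrightarrow> \<phi> y = 0" "\<And>y. y > b \<Longrightarrow> \<phi> y = 0"
    using annularE[OF assms(1)] by metis
  have "bounded {y. \<phi> y \<noteq> 0}"
  proof (rule bounded_subset[of "{a..b}"])
    show "{y. \<phi> y \<noteq> 0} \<subseteq> {a..b}"
    proof
      fix y assume "y \<in> {y. \<phi> y \<noteq> 0}"
      then show "y \<in> {a..b}" using ab(3)[of y] ab(4)[of y] by (cases "y < a"; cases "y > b") auto
    qed
  qed simp
  from continuous_bounded_support_bounded[OF assms(2) this] that show thesis by blast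
qed

lemma annulus_integrable_mult:
  fixes h :: "'d::finite heis \<Rightarrow> complex"
  assumes \<phi>: "annular \<phi>" "continuous_on UNIV \<phi>" and h: "annulus_integrable h"
  shows "integrable lebesgue (\<lambda>p. \<phi> (koranyi4 p) * h p)"
proof -
  obtain a b where ab: "0 < a" "a < b" "\<And>y. y < a \<Longrightarrow> \<phi> y = 0" "\<And>y. y > b \<Longrightarrow> \<phi> y = 0"
    using annularE[OF \<phi>(1)] by metis
  obtain B where B: "B > 0" "\<And>y. norm (\<phi> y) \<le> B"
    using annular_bounded[OF \<phi>] by blast
  let ?s = "\<lambda>p. indicat_real {a..b} (koranyi4 p) *\<^sub>R h p"
  have s: "integrable lebesgue ?s" using h ab(1) unfolding annulus_integrable_def by blast
  have "\<phi> \<in> borel_measurable borel" using \<phi>(2) by (rule borel_measurable_continuous_onI)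
  then have m: "(\<lambda>p :: 'd heis. \<phi> (koranyi4 p)) \<in> borel_measurable lebesgue"
    by (rule measurable_compose[OF borel_measurable_koranyi4])
  have "integrable lebesgue (\<lambda>p. \<phi> (koranyi4 p) * ?s p)"
  proof (rule Bochner_Integration.integrable_bound)
    show "integrable lebesgue (\<lambda>p. B *\<^sub>R ?s p)" by (intro integrable_scaleR_right s)
    show "(\<lambda>p. \<phi> (koranyi4 p) * ?s p) \<in> borel_measurable lebesgue"
      by (intro borel_measurable_times m borel_measurable_integrable[OF s])
    show "AE p in lebesgue. norm (\<phi> (koranyi4 p) * ?s p) \<le> norm (B *\<^sub>R ?s p)"
    proof (rule AE_I2)
      fix p
      have "norm (\<phi> (koranyi4 p)) * norm (?s p) \<le> \<bar>B\<bar> * norm (?s p)"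
        using B by (intro mult_right_mono) auto
      then show "norm (\<phi> (koranyi4 p) * ?s p) \<le> norm (B *\<^sub>R ?s p)"
        by (simp only: norm_mult[of "\<phi> (koranyi4 p)" "?s p"] norm_scaleR[of B "?s p"])
    qed
  qed
  moreover have "\<phi> (koranyi4 p) * ?s p = \<phi> (koranyi4 p) * h p" for p
    using ab(3)[of "koranyi4 p"] ab(4)[of "koranyi4 p"]
    by (cases "koranyi4 p < a"; cases "koranyi4 p > b") (auto simp: indicator_def)
  ultimately show ?thesis by simp
qed

lemma emeasure_koranyi4_Icc_finite:
  "emeasure lebesgue {p :: 'd::finite heis. koranyi4 p \<in> {a..b}} < \<infinity>"
  and sets_koranyi4_Icc: "{p :: 'd::finite heis. koranyi4 p \<in> {a..b}} \<in> sets lebesgue"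
proof -
  have cl: "closed {p :: 'd heis. koranyi4 p \<in> {a..b}}"
    using closed_vimage[OF closed_atLeastAtMost continuous_koranyi4, of a b] by (simp add: vimage_def)
  then show "{p :: 'd heis. koranyi4 p \<in> {a..b}} \<in> sets lebesgue" by simp
  have "emeasure lborel {p :: 'd heis. koranyi4 p \<in> {a..b}} < \<infinity>"
    by (rule emeasure_bounded_finite[OF bounded_subset[OF bounded_koranyi4_le[of b]]]) auto
  then show "emeasure lebesgue {p :: 'd heis. koranyi4 p \<in> {a..b}} < \<infinity>"
    using cl by simp
qed

lemma integrable_annulus_indicator:
  "integrable lebesgue (\<lambda>p :: 'd::finite heis. indicat_real {a..b} (koranyi4 p))"
proof -
  have "indicat_real {p :: 'd heis. koranyi4 p \<in> {a..b}} = (\<lambda>p. indicat_real {a..b} (koranyi4 p))"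
    by (simp add: indicator_def fun_eq_iff)
  moreover have "integrable lebesgue (indicat_real {p :: 'd heis. koranyi4 p \<in> {a..b}})"
    by (rule integrable_real_indicator[OF sets_koranyi4_Icc emeasure_koranyi4_Icc_finite])
  ultimately show ?thesis by (simp only:)
qed

lemma annulus_integrableI:
  fixes h :: "'d::finite heis \<Rightarrow> complex"
  assumes h: "h \<in> borel_measurable lebesgue"
    and bound: "\<And>a b. 0 < a \<Longrightarrow> \<exists>W. integrable lebesgue W \<and>
          (AE p in lebesgue. koranyi4 p \<in> {a..b} \<longrightarrow> norm (h p) \<le> W p) \<and> (AE p in lebesgue. 0 \<le> W p)"
  shows "annulus_integrable h"
  unfolding annulus_integrable_def
proof (intro allI impI)
  fix a b :: real assume "0 < a"
  then obtain W where W: "integrable lebesgue W"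
    "AE p in lebesgue. koranyi4 p \<in> {a..b} \<longrightarrow> norm (h p) \<le> W p" "AE p in lebesgue. 0 \<le> W p"
    using bound by blast
  show "integrable lebesgue (\<lambda>p. indicat_real {a..b} (koranyi4 p) *\<^sub>R h p)"
  proof (rule Bochner_Integration.integrable_bound[OF W(1)])
    show "(\<lambda>p. indicat_real {a..b} (koranyi4 p) *\<^sub>R h p) \<in> borel_measurable lebesgue"
      by (intro borel_measurable_scaleR h borel_measurable_integrable[OF integrable_annulus_indicator])
    show "AE p in lebesgue. norm (indicat_real {a..b} (koranyi4 p) *\<^sub>R h p) \<le> norm (W p)"
      using W(2,3) by eventually_elim (simp add: indicator_def)
  qed
qed

text \<open>
  On sets of finite measure \<open>|f| \<le> 1 + |f|\<^sup>2\<close> is integrable.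
\<close>

lemma L2_annulus_integrable:
  assumes "f \<in> L2" shows "annulus_integrable f"
proof (rule annulus_integrableI)
  show "f \<in> borel_measurable lebesgue" using assms by (simp add: L2_def)
  fix a b :: real
  have "norm (f p) \<le> indicat_real {a..b} (koranyi4 p) + (norm (f p))\<^sup>2" if "koranyi4 p \<in> {a..b}" for p
  proof -
    have "0 \<le> (norm (f p) - 1)\<^sup>2" by simp
    then have "2 * norm (f p) \<le> 1 + (norm (f p))\<^sup>2" by (simp add: power2_eq_square algebra_simps)
    then have "norm (f p) \<le> 1 + (norm (f p))\<^sup>2" using norm_ge_zero[of "f p"] by linarith
    then show ?thesis using that by (simp add: indicator_def)
  qed
  moreover have "integrable lebesgue (\<lambda>p. indicat_real {a..b} (koranyi4 p) + (norm (f p))\<^sup>2)"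
    using assms by (intro Bochner_Integration.integrable_add integrable_annulus_indicator) (simp add: L2_def)
  ultimately show "\<exists>W. integrable lebesgue W \<and>
          (AE p in lebesgue. koranyi4 p \<in> {a..b} \<longrightarrow> norm (f p) \<le> W p) \<and> (AE p in lebesgue. 0 \<le> W p)"
    by (intro exI[of _ "\<lambda>p. indicat_real {a..b} (koranyi4 p) + (norm (f p))\<^sup>2"]) auto
qed

lemma annulus_integrable_continuous_mult:
  fixes m :: "'d::finite heis \<Rightarrow> real"
  assumes m: "continuous_on UNIV m" and h: "annulus_integrable h"
  shows "annulus_integrable (\<lambda>p. m p *\<^sub>R h p)"
  unfolding annulus_integrable_def
proof (intro allI impI)
  fix a b :: real assume "0 < a"
  then have i: "integrable lebesgue (\<lambda>p. indicat_real {a..b} (koranyi4 p) *\<^sub>R h p)" (is "integrable _ ?s")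
    using h unfolding annulus_integrable_def by blast
  have "compact {p :: 'd heis. koranyi4 p \<le> b}"
    using closed_vimage[OF closed_atMost continuous_koranyi4, of b] bounded_koranyi4_le[of b, where ?'d = 'd]
    by (simp add: vimage_def compact_eq_bounded_closed)
  then have "bounded (m ` {p. koranyi4 p \<le> b})"
    by (intro compact_imp_bounded compact_continuous_image continuous_on_subset[OF m]) auto
  then obtain B where B: "B > 0" "\<forall>x \<in> m ` {p. koranyi4 p \<le> b}. norm x \<le> B" using bounded_pos by metis
  show "integrable lebesgue (\<lambda>p. indicat_real {a..b} (koranyi4 p) *\<^sub>R m p *\<^sub>R h p)"
  proof (rule Bochner_Integration.integrable_bound)
    show "integrable lebesgue (\<lambda>p. B *\<^sub>R ?s p)" by (intro integrable_scaleR_right i)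
    have "m \<in> borel_measurable lebesgue"
      by (rule measurable_completion) (simp add: borel_measurable_continuous_onI m)
    then have "(\<lambda>p. m p *\<^sub>R ?s p) \<in> borel_measurable lebesgue"
      by (intro borel_measurable_scaleR borel_measurable_integrable[OF i])
    then show "(\<lambda>p. indicat_real {a..b} (koranyi4 p) *\<^sub>R m p *\<^sub>R h p) \<in> borel_measurable lebesgue"
      by (simp add: mult.commute)
    show "AE p in lebesgue. norm (indicat_real {a..b} (koranyi4 p) *\<^sub>R m p *\<^sub>R h p) \<le> norm (B *\<^sub>R ?s p)"
    proof (rule AE_I2)
      fix p
      show "norm (indicat_real {a..b} (koranyi4 p) *\<^sub>R m p *\<^sub>R h p) \<le> norm (B *\<^sub>R ?s p)"
      proof (cases "koranyi4 p \<in> {a..b}")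
        case True
        then have "m p \<in> m ` {p. koranyi4 p \<le> b}" by (intro imageI) simp
        then have "\<bar>m p\<bar> \<le> B" using B(2) by (auto simp only: real_norm_def)
        then have "\<bar>m p\<bar> * norm (h p) \<le> B * norm (h p)" by (intro mult_right_mono) auto
        then show ?thesis using True B(1) by simp
      qed simp
    qed
  qed
qed

lemma annular_mult_continuous:
  fixes \<zeta> m :: "real \<Rightarrow> complex"
  assumes "annular \<zeta>" "continuous_on UNIV \<zeta>" "continuous_on {0<..} m"
  shows "continuous_on UNIV (\<lambda>y. \<zeta> y * m y)"
proof -
  obtain a b where ab: "0 < a" "a < b" "\<And>y. y < a \<Longrightarrow> \<zeta> y = 0" "\<And>y. y > b \<Longrightarrow> \<zeta> y = 0"
    using annularE[OF assms(1)] by metis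
  have "continuous_on ({0<..} \<union> {..<a}) (\<lambda>y. \<zeta> y * m y)"
  proof (rule continuous_on_open_Un)
    show "continuous_on {0<..} (\<lambda>y. \<zeta> y * m y)"
      by (intro continuous_on_mult continuous_on_subset[OF assms(2)] assms(3)) simp
    have "continuous_on {..<a} (\<lambda>y. 0::complex)" by simp
    then show "continuous_on {..<a} (\<lambda>y. \<zeta> y * m y)"
      by (rule continuous_on_eq) (use ab in auto)
  qed auto
  moreover have "{0<..} \<union> {..<a} = (UNIV::real set)" using ab by auto
  ultimately show ?thesis by simp
qed

section \<open>The layer integral\<close>

text \<open>
  The signed indicator of the layer between the levels \<open>1\<close> and \<open>y\<close>. Starting at the level \<open>1\<close>
  instead of \<open>0\<close> avoids integrating over a neighbourhood of the origin, where integrability is not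
  known.
\<close>

definition layer_kernel :: "real \<Rightarrow> real \<Rightarrow> real" where
  "layer_kernel y n = indicat_real {..y} n - indicat_real {..<1} n"

definition layer_integral :: "('d::finite heis \<Rightarrow> complex) \<Rightarrow> real \<Rightarrow> complex" where
  "layer_integral h y = (LINT p|lebesgue. layer_kernel y (koranyi4 p) *\<^sub>R h p)"

lemma layer_kernel_bound: "\<bar>layer_kernel y n\<bar> \<le> indicat_real {min y 1..max y 1} n"
  by (cases "n \<le> y"; cases "n < 1") (auto simp: layer_kernel_def)

text \<open>
  Completion does not change the measure of the Borel sets that exhaust the space. Fubini's
  theorem is applied below to the completed measure.
\<close>

lemma sigma_finite_lebesgue: "sigma_finite_measure (lebesgue :: 'a::euclidean_space measure)"
proof
  obtain A :: "'a set set" where A: "countable A" "A \<subseteq> sets lborel" "\<Union>A = space lborel" "\<forall>a\<in>A. emeasure lborel a \<noteq> \<infinity>"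
    using lborel.sigma_finite_countable by blast
  show "\<exists>A::'a set set. countable A \<and> A \<subseteq> sets lebesgue \<and> \<Union>A = space lebesgue \<and> (\<forall>a\<in>A. emeasure lebesgue a \<noteq> \<infinity>)"
    using A by (intro exI[of _ A]) auto
qed

text \<open>
  For fixed \<open>z\<close> the equation \<open>N(z,t) = y\<close> has at most two solutions \<open>t\<close>.
\<close>

lemma AE_koranyi4_neq: "AE p in lebesgue. koranyi4 (p :: 'd::finite heis) \<noteq> y"
proof -
  have "AE p in lborel \<Otimes>\<^sub>M lborel. koranyi4 (p :: 'd heis) \<noteq> y"
  proof (rule lborel_pair.AE_pair_measure)
    have "{p \<in> space lborel. koranyi4 (p :: 'd heis) \<noteq> y} \<in> sets lborel"
    proof -
      have "(koranyi4 :: 'd heis \<Rightarrow> real) \<in> borel_measurable lborel"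
        by (simp add: borel_measurable_continuous_onI continuous_koranyi4)
      then show ?thesis by measurable
    qed
    then show "{p \<in> space (lborel \<Otimes>\<^sub>M lborel). koranyi4 (p :: 'd heis) \<noteq> y} \<in> sets (lborel \<Otimes>\<^sub>M lborel)"
      by (simp only: lborel_prod)
    show "AE z in lborel. AE t in lborel. koranyi4 ((z, t) :: 'd heis) \<noteq> y"
    proof (rule AE_I2)
      fix z :: "complex ^ 'd"
      let ?c = "y - ((norm z)\<^sup>2)\<^sup>2"
      have "{sqrt ?c, - sqrt ?c} \<in> null_sets lborel" by (intro finite_imp_null_set_lborel) auto
      then show "AE t in lborel. koranyi4 ((z, t) :: 'd heis) \<noteq> y"
      proof (rule AE_I')
        show "{t \<in> space lborel. \<not> koranyi4 ((z, t) :: 'd heis) \<noteq> y} \<subseteq> {sqrt ?c, - sqrt ?c}"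
        proof
          fix t assume "t \<in> {t \<in> space lborel. \<not> koranyi4 ((z, t) :: 'd heis) \<noteq> y}"
          then have "t\<^sup>2 = ?c" by (simp add: koranyi4_def zsq_def)
          then have "\<bar>t\<bar> = sqrt ?c" by (metis real_sqrt_abs)
          then show "t \<in> {sqrt ?c, - sqrt ?c}" by (auto simp: abs_if split: if_splits)
        qed
      qed
    qed
  qed
  then have "AE p in lborel. koranyi4 (p :: 'd heis) \<noteq> y" by (simp only: lborel_prod)
  then show ?thesis by (rule AE_completion)
qed

lemma borel_measurable_layer_kernel: "layer_kernel y \<in> borel_measurable borel"
  unfolding layer_kernel_def[abs_def] by measurable

lemma layer_bound:
  assumes "0 < a" "a \<le> 1" "1 \<le> b" "a \<le> y" "y \<le> b"
  shows "norm (layer_kernel y n *\<^sub>R (z :: complex)) \<le> norm (indicat_real {a..b} n *\<^sub>R z)"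
proof -
  have "\<bar>layer_kernel y n\<bar> \<le> indicat_real {min y 1..max y 1} n" by (rule layer_kernel_bound)
  also have "\<dots> \<le> indicat_real {a..b} n" using assms by (auto simp: indicator_def)
  finally have "\<bar>layer_kernel y n\<bar> * norm z \<le> indicat_real {a..b} n * norm z" by (intro mult_right_mono) auto
  then show ?thesis by simp
qed

lemma layer_integral_continuous:
  fixes h :: "'d::finite heis \<Rightarrow> complex"
  assumes h: "annulus_integrable h" "h \<in> borel_measurable lebesgue"
  shows "continuous_on {0<..} (layer_integral h)"
  unfolding continuous_on_sequentially
proof (intro allI ballI impI)
  fix x :: "nat \<Rightarrow> real" and y :: real
  assume "(\<forall>n. x n \<in> {0<..}) \<and> x \<longlonglongrightarrow> y" and "y \<in> {0<..}"
  then have x: "x \<longlonglongrightarrow> y" "y > 0" by auto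
  \<comment> \<open>A fixed annulus that contains the layers for all levels close to \<open>y\<close>.\<close>
  define a b where "a = min (y / 2) 1" and "b = max (2 * y) 1"
  have ab: "0 < a" "a \<le> 1" "1 \<le> b" "a < y" "y < b" using x(2) by (auto simp: a_def b_def)
  have "\<forall>\<^sub>F n in sequentially. a < x n \<and> x n < b"
    by (intro eventually_conj order_tendstoD[OF x(1)] ab)
  then obtain n0 where n0: "\<And>n. n \<ge> n0 \<Longrightarrow> a < x n \<and> x n < b"
    unfolding eventually_sequentially by blast
  have i: "integrable lebesgue (\<lambda>p. indicat_real {a..b} (koranyi4 p) *\<^sub>R h p)"
    using h(1) ab(1) unfolding annulus_integrable_def by blast
  have m: "(\<lambda>p. layer_kernel y (koranyi4 p) *\<^sub>R h p) \<in> borel_measurable lebesgue" for y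
    by (intro borel_measurable_scaleR h measurable_compose[OF borel_measurable_koranyi4 borel_measurable_layer_kernel])
  have "(\<lambda>n. layer_integral h (x (n + n0))) \<longlonglongrightarrow> layer_integral h y"
    unfolding layer_integral_def
  proof (rule integral_dominated_convergence[where w = "\<lambda>p. norm (indicat_real {a..b} (koranyi4 p) *\<^sub>R h p)"])
    show "AE p in lebesgue. (\<lambda>n. layer_kernel (x (n + n0)) (koranyi4 p) *\<^sub>R h p) \<longlonglongrightarrow> layer_kernel y (koranyi4 p) *\<^sub>R h p"
      using AE_koranyi4_neq[of y]
    proof eventually_elim
      case (elim p)
      have x': "(\<lambda>n. x (n + n0)) \<longlonglongrightarrow> y" by (rule LIMSEQ_ignore_initial_segment[OF x(1)])
      have "\<forall>\<^sub>F n in sequentially. layer_kernel (x (n + n0)) (koranyi4 p) = layer_kernel y (koranyi4 p)"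
      proof (cases "koranyi4 p < y")
        case True
        from order_tendstoD(1)[OF x' this] show ?thesis
          by (rule eventually_mono) (use True in \<open>simp add: layer_kernel_def indicator_def\<close>)
      next
        case False
        with elim have "y < koranyi4 p" by simp
        from order_tendstoD(2)[OF x' this] show ?thesis
          by (rule eventually_mono) (use False elim in \<open>simp add: layer_kernel_def indicator_def\<close>)
      qed
      then show ?case by (intro tendsto_scaleR tendsto_const tendsto_eventually)
    qed
    show "AE p in lebesgue. norm (layer_kernel (x (n + n0)) (koranyi4 p) *\<^sub>R h p)
        \<le> norm (indicat_real {a..b} (koranyi4 p) *\<^sub>R h p)" for n
      using n0[of "n + n0"] by (intro AE_I2 layer_bound ab) auto
    show "integrable lebesgue (\<lambda>p. norm (indicat_real {a..b} (koranyi4 p) *\<^sub>R h p))"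
      by (rule integrable_norm[OF i])
  qed (rule m)+
  then have "(\<lambda>n. layer_integral h (x n)) \<longlonglongrightarrow> layer_integral h y" by (rule LIMSEQ_offset)
  then show "(layer_integral h \<circ> x) \<longlonglongrightarrow> layer_integral h y" by (simp add: o_def)
qed

text \<open>
  The fundamental theorem of calculus on a half line and on the whole line.
\<close>

lemma annular_tail_integral:
  assumes \<phi>: "annular \<phi>" "Ck 1 (\<phi> :: real \<Rightarrow> complex)"
  shows "(LINT y|lborel. indicat_real {n..} y *\<^sub>R vector_derivative \<phi> (at y)) = - \<phi> n"
    and "(LINT y|lborel. vector_derivative \<phi> (at y)) = 0"
proof -
  let ?\<phi>' = "\<lambda>y. vector_derivative \<phi> (at y)"
  obtain a b where ab: "0 < a" "a < b" "\<And>y. y < a \<Longrightarrow> \<phi> y = 0" "\<And>y. y > b \<Longrightarrow> \<phi> y = 0"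
    using annularE[OF \<phi>(1)] by metis
  obtain a' b' where ab': "0 < a'" "a' < b'" "\<And>y. y < a' \<Longrightarrow> ?\<phi>' y = 0" "\<And>y. y > b' \<Longrightarrow> ?\<phi>' y = 0"
    using annularE[OF annular_derivative[OF \<phi>(1)]] by metis
  have cont: "continuous_on UNIV ?\<phi>'" using Ck_vector_derivative[OF \<phi>(2)[unfolded One_nat_def]] by simp
  have tail: "(LINT y|lborel. indicat_real {n..} y *\<^sub>R ?\<phi>' y) = - \<phi> n" for n
  proof -
    define B where "B = max n (max b b') + 1"
    have "(LINT y|lborel. indicat_real {n..B} y *\<^sub>R ?\<phi>' y) = \<phi> B - \<phi> n"
      by (rule integral_FTC_Icc[OF _ has_vector_derivative_at_within[OF Ck_has_vector_derivative[OF \<phi>(2)[unfolded One_nat_def]]]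
            continuous_on_subset[OF cont]]) (auto simp: B_def)
    also have "\<phi> B = 0" by (rule ab(4)) (simp add: B_def)
    also have "(LINT y|lborel. indicat_real {n..B} y *\<^sub>R ?\<phi>' y) = (LINT y|lborel. indicat_real {n..} y *\<^sub>R ?\<phi>' y)"
    proof (rule Bochner_Integration.integral_cong[OF refl])
      fix y
      show "indicat_real {n..B} y *\<^sub>R ?\<phi>' y = indicat_real {n..} y *\<^sub>R ?\<phi>' y"
      proof (cases "y \<le> B")
        case False
        then have "?\<phi>' y = 0" by (intro ab'(4)) (simp add: B_def)
        then show ?thesis by simp
      qed (simp add: indicator_def)
    qed
    finally show ?thesis by simp
  qed
  show "(LINT y|lborel. indicat_real {n..} y *\<^sub>R ?\<phi>' y) = - \<phi> n" by (rule tail)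
  have "?\<phi>' y = indicat_real {0..} y *\<^sub>R ?\<phi>' y" for y
    using ab'(1) ab'(3)[of y] by (cases "y < 0") (auto simp: indicator_def)
  then have "(LINT y|lborel. ?\<phi>' y) = (LINT y|lborel. indicat_real {0..} y *\<^sub>R ?\<phi>' y)" by (rule Bochner_Integration.integral_cong[OF refl])
  also have "\<dots> = - \<phi> 0" by (rule tail)
  finally show "(LINT y|lborel. ?\<phi>' y) = 0" using ab(1,3) by simp
qed

text \<open>
  Write \<open>\<phi>(N)\<close> as an integral of \<open>\<phi>'\<close> and exchange the two integrations. The part of the kernel
  below the level \<open>1\<close> contributes the total integral of \<open>\<phi>'\<close>, which is zero.
\<close>

lemma layer_integral_by_parts:
  fixes h :: "'d::finite heis \<Rightarrow> complex"
  assumes \<phi>: "annular \<phi>" "Ck 1 \<phi>" and h: "annulus_integrable h" "h \<in> borel_measurable lebesgue"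
  shows "(LINT p|lebesgue. \<phi> (koranyi4 p) * h p)
           = - (LINT y|lborel. vector_derivative \<phi> (at y) * layer_integral h y)"
proof -
  interpret pair_sigma_finite "lebesgue :: 'd heis measure" "lborel :: real measure"
    by (intro pair_sigma_finite.intro sigma_finite_lebesgue sigma_finite_lborel)
  let ?\<phi>' = "\<lambda>y. vector_derivative \<phi> (at y)"
  have ann: "annular ?\<phi>'" by (rule annular_derivative[OF \<phi>(1)])
  obtain a b where ab: "0 < a" "a < b" "\<And>y. y < a \<Longrightarrow> ?\<phi>' y = 0" "\<And>y. y > b \<Longrightarrow> ?\<phi>' y = 0"
    using annularE[OF ann] by metis
  have cont: "continuous_on UNIV ?\<phi>'" using Ck_vector_derivative[OF \<phi>(2)[unfolded One_nat_def]] by simp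
  have int\<phi>': "integrable lborel ?\<phi>'" by (rule annular_integrable[OF ann cont])
  \<comment> \<open>The layers start at the level \<open>1\<close>, which may lie outside the support of \<open>\<phi>'\<close>.\<close>
  define a' b' where "a' = min a 1" and "b' = max b 1"
  have ab': "0 < a'" "a' \<le> 1" "1 \<le> b'" using ab by (auto simp: a'_def b'_def)
  let ?s = "\<lambda>p. indicat_real {a'..b'} (koranyi4 p) *\<^sub>R h p"
  have s: "integrable lebesgue ?s" using h(1) ab'(1) unfolding annulus_integrable_def by blast
  let ?F = "\<lambda>p y. ?\<phi>' y * (layer_kernel y (koranyi4 p) *\<^sub>R h p)"
  have bound: "norm (?F p y) \<le> norm (?\<phi>' y) * norm (?s p)" for p y
  proof (cases "y < a \<or> y > b")
    case True
    then have "?\<phi>' y = 0" using ab(3,4) by blast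
    then show ?thesis by simp
  next
    case False
    have "norm (layer_kernel y (koranyi4 p) *\<^sub>R h p) \<le> norm (?s p)"
      by (rule layer_bound[OF ab']) (use False in \<open>auto simp: a'_def b'_def\<close>)
    then show ?thesis unfolding norm_mult by (rule mult_left_mono) simp
  qed
  have m\<phi>: "?\<phi>' \<in> borel_measurable borel" by (rule borel_measurable_continuous_onI[OF cont])
  have mF: "case_prod ?F \<in> borel_measurable (lebesgue \<Otimes>\<^sub>M lborel)"
  proof -
    note borel_measurable_koranyi4[measurable] h(2)[measurable] m\<phi>[measurable]
    have "(\<lambda>x :: 'd heis \<times> real. layer_kernel (snd x) (koranyi4 (fst x))) \<in> borel_measurable (lebesgue \<Otimes>\<^sub>M lborel)"
      unfolding layer_kernel_def indicator_def atMost_iff lessThan_iff by measurable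
    then show ?thesis unfolding split_beta by measurable
  qed
  have int2: "integrable lborel (?F p)" for p
  proof (rule Bochner_Integration.integrable_bound)
    show "integrable lborel (\<lambda>y. norm (?\<phi>' y) * norm (?s p))" by (intro integrable_mult_left integrable_norm int\<phi>')
    show "?F p \<in> borel_measurable lborel" using measurable_Pair2[OF mF, of p] by simp
    show "AE y in lborel. norm (?F p y) \<le> norm (norm (?\<phi>' y) * norm (?s p))" using bound by (intro AE_I2) simp
  qed
  have intF: "integrable (lebesgue \<Otimes>\<^sub>M lborel) (case_prod ?F)"
  proof (rule Fubini_integrable[OF mF])
    show "integrable lebesgue (\<lambda>p. LINT y|lborel. norm (case (p, y) of (p, y) \<Rightarrow> ?F p y))"
    proof (rule Bochner_Integration.integrable_bound)
      show "integrable lebesgue (\<lambda>p. (LINT y|lborel. norm (?\<phi>' y)) * norm (?s p))"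
        by (intro integrable_mult_right integrable_norm s)
      show "(\<lambda>p. LINT y|lborel. norm (case (p, y) of (p, y) \<Rightarrow> ?F p y)) \<in> borel_measurable lebesgue"
        using measurable_compose[OF mF borel_measurable_norm]
        by (intro lborel.borel_measurable_lebesgue_integral) (simp only: case_prod_beta' fst_conv snd_conv)
      show "AE p in lebesgue. norm (LINT y|lborel. norm (case (p, y) of (p, y) \<Rightarrow> ?F p y))
          \<le> norm ((LINT y|lborel. norm (?\<phi>' y)) * norm (?s p))"
      proof (rule AE_I2)
        fix p :: "'d heis"
        have "(LINT y|lborel. norm (?F p y)) \<le> (LINT y|lborel. norm (?\<phi>' y) * norm (?s p))"
          by (intro integral_mono integrable_norm int2 integrable_mult_left int\<phi>' bound)
        then show "norm (LINT y|lborel. norm (case (p, y) of (p, y) \<Rightarrow> ?F p y))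
          \<le> norm ((LINT y|lborel. norm (?\<phi>' y)) * norm (?s p))" by simp
      qed
    qed
    show "AE p in lebesgue. integrable lborel (\<lambda>y. case (p, y) of (p, y) \<Rightarrow> ?F p y)"
      using int2 by (intro AE_I2) simp
  qed
  have inner: "(LINT y|lborel. ?F p y) = - (\<phi> (koranyi4 p) * h p)" for p
  proof -
    let ?n = "koranyi4 p"
    have int_ind: "integrable lborel (\<lambda>y. indicat_real {?n..} y *\<^sub>R ?\<phi>' y)"
      by (intro integrable_mult_indicator int\<phi>') simp
    have "?F p y = (indicat_real {?n..} y *\<^sub>R ?\<phi>' y) * h p - (indicat_real {..<1} ?n *\<^sub>R ?\<phi>' y) * h p" for y
      by (simp add: layer_kernel_def indicator_def)
    then have "(LINT y|lborel. ?F p y)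
        = (LINT y|lborel. (indicat_real {?n..} y *\<^sub>R ?\<phi>' y) * h p - (indicat_real {..<1} ?n *\<^sub>R ?\<phi>' y) * h p)"
      by (rule Bochner_Integration.integral_cong[OF refl])
    also have "\<dots> = (LINT y|lborel. indicat_real {?n..} y *\<^sub>R ?\<phi>' y) * h p
        - (indicat_real {..<1} ?n *\<^sub>R (LINT y|lborel. ?\<phi>' y)) * h p"
      by (simp only: Bochner_Integration.integral_diff[OF integrable_mult_left[OF int_ind]
            integrable_mult_left[OF integrable_scaleR_right[OF int\<phi>']]]
          integral_mult_left_zero integral_scaleR_right)
    finally show ?thesis using annular_tail_integral[OF \<phi>] by simp
  qed
  have "(LINT y|lborel. (LINT p|lebesgue. ?F p y)) = (LINT p|lebesgue. (LINT y|lborel. ?F p y))"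
    by (rule Fubini_integral[OF intF])
  also have "(\<lambda>y. LINT p|lebesgue. ?F p y) = (\<lambda>y. ?\<phi>' y * layer_integral h y)"
    unfolding layer_integral_def by (simp only: integral_mult_right_zero)
  finally show ?thesis unfolding inner by simp
qed

section \<open>Cut-offs\<close>

text \<open>
  The primitive of the positive part of \<open>6x(1-x)\<close>, that is, the cubic \<open>3x\<^sup>2 - 2x\<^sup>3\<close> on the unit
  interval. One continuous derivative is enough, and the explicit form gives the constant \<open>2\<close>.
\<close>

lemma ex_unit_step:
  obtains \<sigma> \<sigma>' :: "real \<Rightarrow> real" where
    "\<And>x. (\<sigma> has_real_derivative \<sigma>' x) (at x)" "continuous_on UNIV \<sigma>'"
    "\<And>x. 0 \<le> \<sigma>' x" "\<And>x. \<sigma>' x \<le> 2" "\<And>x. x \<le> 0 \<or> 1 \<le> x \<Longrightarrow> \<sigma>' x = 0"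
    "\<And>x. x \<le> 0 \<Longrightarrow> \<sigma> x = 0" "\<And>x. 1 \<le> x \<Longrightarrow> \<sigma> x = 1" "\<And>x. 0 \<le> \<sigma> x" "\<And>x. \<sigma> x \<le> 1"
proof -
  define \<sigma>' :: "real \<Rightarrow> real" where "\<sigma>' x = max 0 (6 * x * (1 - x))" for x
  have cont: "continuous_on UNIV \<sigma>'" unfolding \<sigma>'_def by (intro continuous_intros)
  obtain S where S: "\<And>x. (S has_vector_derivative \<sigma>' x) (at x)"
    using einterval_antiderivative[of "-\<infinity>" "\<infinity>" \<sigma>'] cont
    by (auto simp: continuous_on_eq_continuous_at)
  define \<sigma> where "\<sigma> x = S x - S 0" for x
  have der: "(\<sigma> has_real_derivative \<sigma>' x) (at x)" for x
    unfolding \<sigma>_def using S[of x]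
    by (auto intro!: derivative_eq_intros simp: has_real_derivative_iff_has_vector_derivative)
  have nonneg: "0 \<le> \<sigma>' x" for x by (simp add: \<sigma>'_def)
  have le2: "\<sigma>' x \<le> 2" for x
  proof -
    have "0 \<le> 6 * (x - 1 / 2)\<^sup>2 + 1 / 2" by simp
    then show ?thesis by (simp add: \<sigma>'_def power2_eq_square algebra_simps)
  qed
  have zero: "\<sigma>' x = 0" if "x \<le> 0 \<or> 1 \<le> x" for x
    using that by (auto simp: \<sigma>'_def max_def mult_le_0_iff zero_le_mult_iff)
  have mono: "x \<le> y \<Longrightarrow> \<sigma> x \<le> \<sigma> y" for x y
    using DERIV_nonneg_imp_nondecreasing[of x y \<sigma>] der nonneg by blast
  have const: "\<sigma> y = \<sigma> x" if "x < y" "\<And>z. x < z \<Longrightarrow> z < y \<Longrightarrow> z \<le> 0 \<or> 1 \<le> z" for x y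
  proof (rule DERIV_isconst_end[OF that(1) DERIV_continuous_on[OF has_field_derivative_at_within[OF der]]])
    show "(\<sigma> has_real_derivative 0) (at z)" if "x < z" "z < y" for z
      using der[of z] zero[OF \<open>\<And>z. x < z \<Longrightarrow> z < y \<Longrightarrow> z \<le> 0 \<or> 1 \<le> z\<close>[OF that]] by simp
  qed
  have left: "\<sigma> x = 0" if "x \<le> 0" for x
  proof (cases "x = 0")
    case False
    have "\<sigma> 0 = \<sigma> x"
      by (rule const) (use False that in auto)
    then show ?thesis by (simp add: \<sigma>_def)
  qed (simp add: \<sigma>_def)
  have one: "\<sigma> 1 = 1"
  proof -
    let ?D = "\<lambda>x::real. \<sigma> x - (3 * x ^ 2 - 2 * x ^ 3)"
    have D: "(?D has_real_derivative \<sigma>' x - 6 * x * (1 - x)) (at x)" for x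
      by (auto intro!: derivative_eq_intros der simp: power2_eq_square algebra_simps)
    have "?D 1 = ?D 0"
    proof (rule DERIV_isconst_end[of 0 1 ?D])
      show "continuous_on {0..1} ?D" by (rule DERIV_continuous_on[OF has_field_derivative_at_within[OF D]])
      show "(?D has_real_derivative 0) (at x)" if "0 < x" "x < 1" for x
      proof -
        have "0 \<le> 6 * x * (1 - x)" using that by simp
        then have "\<sigma>' x - 6 * x * (1 - x) = 0" by (simp add: \<sigma>'_def max_def)
        then show ?thesis using D[of x] by simp
      qed
    qed simp
    then show ?thesis by (simp add: \<sigma>_def)
  qed
  have right: "\<sigma> x = 1" if "1 \<le> x" for x
  proof (cases "x = 1")
    case False
    have "\<sigma> x = \<sigma> 1"
      by (rule const) (use False that in auto)
    then show ?thesis using one by simp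
  qed (simp add: one)
  have "0 \<le> \<sigma> x" "\<sigma> x \<le> 1" for x
    using mono[of 0 x] mono[of x 1] left[of x] right[of x] left[of 0] one by (cases "x \<le> 0"; cases "1 \<le> x"; simp)+
  then show thesis using that[of \<sigma> \<sigma>'] der cont nonneg le2 zero left right by blast
qed

text \<open>
  The bounds on \<open>\<eta>'\<close> make \<open>N |\<eta>'(N)|\<close> bounded by a constant, uniformly in \<open>n\<close>, so that the error
  terms that they produce in the energy vanish in the limit by dominated convergence. The
  one-sided bound is for the Hardy inequality, where only the outer slope has the unfavourable
  sign.
\<close>

lemma ex_cutoffs:
  obtains \<eta> \<eta>' :: "nat \<Rightarrow> real \<Rightarrow> real" where
    "\<And>n y. (\<eta> n has_real_derivative \<eta>' n y) (at y)" "\<And>n. continuous_on UNIV (\<eta>' n)"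
    "\<And>n y. 0 \<le> \<eta> n y" "\<And>n y. \<eta> n y \<le> 1" "\<And>n. annular (\<eta> n)"
    "\<And>n y. 2 / real (Suc n) \<le> y \<Longrightarrow> y \<le> real (Suc n) \<Longrightarrow> \<eta> n y = 1 \<and> \<eta>' n y = 0"
    "\<And>n y. - \<eta>' n y \<le> 2 / real (Suc n) * indicat_real {real (Suc n)..2 * real (Suc n)} y"
    "\<And>n y. \<bar>\<eta>' n y\<bar> \<le> 2 * real (Suc n) * indicat_real {1 / real (Suc n)..2 / real (Suc n)} y
        + 2 / real (Suc n) * indicat_real {real (Suc n)..2 * real (Suc n)} y"
proof -
  obtain \<sigma> \<sigma>' :: "real \<Rightarrow> real" where s: "\<And>x. (\<sigma> has_real_derivative \<sigma>' x) (at x)" "continuous_on UNIV \<sigma>'"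
    "\<And>x. 0 \<le> \<sigma>' x" "\<And>x. \<sigma>' x \<le> 2" "\<And>x. x \<le> 0 \<or> 1 \<le> x \<Longrightarrow> \<sigma>' x = 0"
    "\<And>x. x \<le> 0 \<Longrightarrow> \<sigma> x = 0" "\<And>x. 1 \<le> x \<Longrightarrow> \<sigma> x = 1" "\<And>x. 0 \<le> \<sigma> x" "\<And>x. \<sigma> x \<le> 1"
    by (rule ex_unit_step) blast
  let ?m = "\<lambda>n. real (Suc n)"
  \<comment> \<open>\<open>A\<close> rises from \<open>0\<close> to \<open>1\<close> on \<open>[1/m, 2/m]\<close>, and \<open>B\<close> falls from \<open>1\<close> to \<open>0\<close> on \<open>[m, 2m]\<close>.\<close>
  define A where "A n y = \<sigma> (?m n * y - 1)" for n y
  define B where "B n y = 1 - \<sigma> (y / ?m n - 1)" for n y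
  define A' where "A' n y = ?m n * \<sigma>' (?m n * y - 1)" for n y
  define B' where "B' n y = (1 / ?m n) * \<sigma>' (y / ?m n - 1)" for n y
  have m: "?m n > 0" "?m n \<ge> 1" for n by auto
  have \<sigma>cont: "continuous_on UNIV \<sigma>" by (rule DERIV_continuous_on[OF has_field_derivative_at_within[OF s(1)]])
  have comp: "continuous_on UNIV (\<lambda>y. g (c * y - 1))" if "continuous_on UNIV g" for g :: "real \<Rightarrow> real" and c
    by (rule continuous_on_compose2[OF that]) (auto intro!: continuous_intros)
  have AB: "0 \<le> A n y" "A n y \<le> 1" "0 \<le> B n y" "B n y \<le> 1" "0 \<le> A' n y" "0 \<le> B' n y" for n y
    using s(3,8,9) by (auto simp: A_def B_def A'_def B'_def)
  have A'_le: "A' n y \<le> 2 * ?m n * indicat_real {1 / ?m n..2 / ?m n} y" for n y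
  proof (cases "y \<in> {1 / ?m n..2 / ?m n}")
    case True
    then show ?thesis using mult_left_mono[OF s(4), of "?m n" "?m n * y - 1"] m(1)[of n] unfolding A'_def by (simp del: of_nat_Suc add: mult.commute)
  next
    case False
    then have "?m n * y - 1 \<le> 0 \<or> 1 \<le> ?m n * y - 1" using m(1)[of n] by (auto simp: field_simps simp del: of_nat_Suc)
    then have "\<sigma>' (?m n * y - 1) = 0" by (rule s(5))
    then show ?thesis using False unfolding A'_def by (simp del: of_nat_Suc)
  qed
  have B'_le: "B' n y \<le> 2 / ?m n * indicat_real {?m n..2 * ?m n} y" for n y
  proof (cases "y \<in> {?m n..2 * ?m n}")
    case True
    have "1 / ?m n * \<sigma>' (y / ?m n - 1) \<le> 1 / ?m n * 2" by (intro mult_left_mono s(4)) simp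
    then show ?thesis using True unfolding B'_def by (simp del: of_nat_Suc)
  next
    case False
    then have "y / ?m n - 1 \<le> 0 \<or> 1 \<le> y / ?m n - 1" using m(1)[of n] by (auto simp: field_simps simp del: of_nat_Suc)
    then have "\<sigma>' (y / ?m n - 1) = 0" by (rule s(5))
    then show ?thesis using False unfolding B'_def by (simp del: of_nat_Suc)
  qed
  have le1: "x * b \<le> x" if "0 \<le> x" "b \<le> 1" for x b :: real using mult_left_mono[OF that(2,1)] by simp
  show thesis
  proof (rule that[of "\<lambda>n y. A n y * B n y" "\<lambda>n y. A' n y * B n y - A n y * B' n y"])
    fix n y
    have "(A n has_real_derivative A' n y) (at y)"
      unfolding A_def A'_def by (rule DERIV_chain2[OF s(1), THEN DERIV_cong]) (auto intro!: derivative_eq_intros)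
    moreover have "(B n has_real_derivative - B' n y) (at y)"
    proof -
      have "((\<lambda>y. y / ?m n - 1) has_real_derivative 1 / ?m n) (at y)" by (auto intro!: derivative_eq_intros)
      from DERIV_chain2[OF s(1) this] have "((\<lambda>y. \<sigma> (y / ?m n - 1)) has_real_derivative \<sigma>' (y / ?m n - 1) * (1 / ?m n)) (at y)" .
      from DERIV_diff[OF DERIV_const[of 1] this] show ?thesis unfolding B_def B'_def by simp
    qed
    ultimately show "((\<lambda>y. A n y * B n y) has_real_derivative A' n y * B n y - A n y * B' n y) (at y)"
      by (auto intro!: derivative_eq_intros)
    show "0 \<le> A n y * B n y" using AB by simp
    show "A n y * B n y \<le> 1" using AB by (simp add: mult_le_one)
    show "A n y * B n y = 1 \<and> A' n y * B n y - A n y * B' n y = 0" if "2 / ?m n \<le> y" "y \<le> ?m n"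
    proof -
      have *: "1 \<le> ?m n * y - 1" "y / ?m n - 1 \<le> 0" using that m(1)[of n] by (auto simp: field_simps simp del: of_nat_Suc)
      then have "A n y = 1" "B n y = 1" "A' n y = 0" "B' n y = 0"
        using s(5)[of "?m n * y - 1"] s(5)[of "y / ?m n - 1"] s(7)[of "?m n * y - 1"] s(6)[of "y / ?m n - 1"]
        unfolding A_def B_def A'_def B'_def by (simp_all del: of_nat_Suc)
      then show ?thesis by simp
    qed
    have up: "A n y * B' n y \<le> B' n y" "A' n y * B n y \<le> A' n y" "0 \<le> A' n y * B n y" "0 \<le> A n y * B' n y"
      using le1[OF AB(6,2)] le1[OF AB(5,4)] AB by (auto simp: mult.commute)
    show "- (A' n y * B n y - A n y * B' n y) \<le> 2 / ?m n * indicat_real {?m n..2 * ?m n} y"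
      using up B'_le[of n y] by linarith
    show "\<bar>A' n y * B n y - A n y * B' n y\<bar> \<le> 2 * ?m n * indicat_real {1 / ?m n..2 / ?m n} y
        + 2 / ?m n * indicat_real {?m n..2 * ?m n} y"
      using up A'_le[of n y] B'_le[of n y] by linarith
  next
    fix n
    show "continuous_on UNIV (\<lambda>y. A' n y * B n y - A n y * B' n y)"
      unfolding A_def B_def A'_def B'_def
      using comp[OF s(2), of "1 / ?m n"] comp[OF \<sigma>cont, of "1 / ?m n"]
      by (intro continuous_intros comp s(2) \<sigma>cont) (simp_all del: of_nat_Suc)
    show "annular (\<lambda>y. A n y * B n y)"
    proof (rule annularI[of "1 / ?m n" "2 * ?m n"])
      show "1 / ?m n < 2 * ?m n"
      proof -
        have "1 / x < 2 * x" if "1 \<le> x" for x :: real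
        proof -
          have "1 / x \<le> 1" using that by simp
          then show ?thesis using that by linarith
        qed
        then show ?thesis using m(2) by blast
      qed
      fix y assume "A n y * B n y \<noteq> 0"
      then have "A n y \<noteq> 0" "B n y \<noteq> 0" by auto
      then have "\<not> ?m n * y - 1 \<le> 0" "\<not> 1 \<le> y / ?m n - 1"
        using s(6)[of "?m n * y - 1"] s(7)[of "y / ?m n - 1"] unfolding A_def B_def by auto
      then show "1 / ?m n \<le> y \<and> y \<le> 2 * ?m n" using m(1)[of n] by (auto simp: field_simps simp del: of_nat_Suc)
    qed simp
  qed
qed

text \<open>
  Cutting off turns a profile that is differentiable on the open half line only into one that is
  \<open>C\<^sup>1\<close> on the whole line.
\<close>

lemma annular_profile_mult:
  fixes f f' \<eta> \<eta>' :: "real \<Rightarrow> complex"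
  assumes \<eta>: "annular \<eta>" "\<And>y. (\<eta> has_vector_derivative \<eta>' y) (at y)" "continuous_on UNIV \<eta>'"
    and f: "\<And>y. y > 0 \<Longrightarrow> (f has_vector_derivative f' y) (at y)" "continuous_on {0<..} f'"
  shows "annular (\<lambda>y. \<eta> y * f y)" "Ck 1 (\<lambda>y. \<eta> y * f y)"
    "vector_derivative (\<lambda>y. \<eta> y * f y) (at y) = \<eta> y * f' y + \<eta>' y * f y"
proof -
  obtain a b where ab: "0 < a" "a < b" "\<And>y. y < a \<Longrightarrow> \<eta> y = 0" "\<And>y. y > b \<Longrightarrow> \<eta> y = 0"
    using annularE[OF \<eta>(1)] by metis
  have der: "((\<lambda>y. \<eta> y * f y) has_vector_derivative \<eta> y * f' y + \<eta>' y * f y) (at y)" for y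
  proof (cases "y > 0")
    case True
    show ?thesis by (rule has_vector_derivative_mult[OF \<eta>(2) f(1)[OF True]])
  next
    case False
    have "((\<lambda>_. 0) has_vector_derivative 0) (at y)" by simp
    then have "(\<eta> has_vector_derivative 0) (at y)"
      by (rule has_vector_derivative_transform_within_open[of _ _ _ "{..<a}"]) (use False ab in auto)
    then have "\<eta>' y = 0" using vector_derivative_unique_at[OF \<eta>(2)] by blast
    moreover have "\<eta> y = 0" using False ab by auto
    moreover have "((\<lambda>_. 0) has_vector_derivative 0) (at y)" by simp
    then have "((\<lambda>y. \<eta> y * f y) has_vector_derivative 0) (at y)"
      by (rule has_vector_derivative_transform_within_open[of _ _ _ "{..<a}"]) (use False ab in auto)
    ultimately show ?thesis by simp
  qed
  show "vector_derivative (\<lambda>y. \<eta> y * f y) (at y) = \<eta> y * f' y + \<eta>' y * f y"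
    by (rule vector_derivative_at[OF der])
  show "annular (\<lambda>y. \<eta> y * f y)" by (rule annular_mono[OF \<eta>(1)]) simp
  have contf: "continuous_on {0<..} f"
    by (rule continuous_on_vector_derivative[OF has_vector_derivative_at_within[OF f(1)]]) simp
  have ann': "annular \<eta>'"
    using annular_derivative[OF \<eta>(1)] vector_derivative_at[OF \<eta>(2)] by simp
  have "continuous_on UNIV (\<lambda>y. \<eta> y * f' y + \<eta>' y * f y)"
    by (intro continuous_on_add annular_mult_continuous \<eta>(1,3) ann' f(2) contf
        continuous_on_vector_derivative[OF has_vector_derivative_at_within[OF \<eta>(2)]])
  then have "Ck 0 (\<lambda>y. \<eta> y * f' y + \<eta>' y * f y)" by simp
  then show "Ck 1 (\<lambda>y. \<eta> y * f y)"
    unfolding One_nat_def by (rule Ck_SucI_vector[OF der])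
qed

section \<open>Regularity of radial solutions\<close>

text \<open>
  The product \<open>\<nabla>N \<sqdot> \<nabla>u\<close>, which is all that radial test functions see of \<open>\<nabla>u\<close>.
\<close>

definition radial_pairing :: "('d::finite heis \<Rightarrow> complex) \<Rightarrow> 'd heis \<Rightarrow> complex" where
  "radial_pairing u p = (\<Sum>k\<in>UNIV. d_koranyi4 k p *\<^sub>R weak_deriv k u p)"

lemma continuous_d_koranyi4: "continuous_on S (d_koranyi4 k)"
  by (rule Ck_imp_continuous[OF Ck_d_koranyi4])

lemma annulus_integrable_sum:
  assumes "\<And>k. k \<in> K \<Longrightarrow> annulus_integrable (f k)"
  shows "annulus_integrable (\<lambda>p. \<Sum>k\<in>K. f k p)"
  using assms unfolding annulus_integrable_def scaleR_sum_right
  by (intro allI impI Bochner_Integration.integrable_sum) blast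

lemma annulus_integrable_radial_pairing:
  assumes "u \<in> H1" shows "annulus_integrable (radial_pairing u)"
  unfolding radial_pairing_def[abs_def]
  by (intro annulus_integrable_sum annulus_integrable_continuous_mult continuous_d_koranyi4
      L2_annulus_integrable weak_deriv_spec(1)[OF assms])

lemma borel_measurable_weak_deriv: "u \<in> H1 \<Longrightarrow> weak_deriv k u \<in> borel_measurable lebesgue"
  using weak_deriv_spec(1)[of u k] by (simp add: L2_def)

lemma borel_measurable_d_koranyi4: "d_koranyi4 k \<in> borel_measurable lebesgue"
  by (rule measurable_completion) (simp add: borel_measurable_continuous_onI continuous_d_koranyi4)

lemma lift_0: "lift 0 \<phi> p = \<phi> (koranyi4 p)"
  by (simp add: lift_def)

lemma field_deriv_lift_0:
  "Ck 1 \<phi> \<Longrightarrow> field_deriv k (lift 0 \<phi>) p = d_koranyi4 k p *\<^sub>R vector_derivative \<phi> (at (koranyi4 p))"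
  by (simp add: field_deriv_lift)

text \<open>
  The equation tested against \<open>v = cnj \<phi>(N)\<close>, whose gradient is \<open>cnj \<phi>'(N) \<nabla>N\<close>.
\<close>

lemma weak_solution_radial_test:
  fixes V :: "'d::finite heis \<Rightarrow> complex"
  assumes sol: "weak_solution V ev u"
    and h: "annulus_integrable (\<lambda>p. (V p - ev) * u p)"
    and \<phi>: "annular \<phi>" "Ck 1 \<phi>"
  shows "(LINT p|lebesgue. vector_derivative \<phi> (at (koranyi4 p)) * radial_pairing u p)
           = - (LINT p|lebesgue. \<phi> (koranyi4 p) * ((V p - ev) * u p))"
proof -
  have u: "u \<in> H1" using sol by (simp add: weak_solution_def)
  let ?\<psi> = "\<lambda>y. cnj (\<phi> y)"
  let ?\<phi>' = "\<lambda>y. vector_derivative \<phi> (at y)"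
  define v :: "'d heis \<Rightarrow> complex" where "v = lift 0 ?\<psi>"
  have \<psi>: "annular ?\<psi>" "Ck 1 ?\<psi>"
    by (rule annular_mono[OF \<phi>(1)], simp, rule Ck_linear_comp[OF bounded_linear_cnj \<phi>(2)])
  have d\<psi>: "vector_derivative ?\<psi> (at y) = cnj (?\<phi>' y)" for y
    by (rule vector_derivative_at[OF bounded_linear.has_vector_derivative[OF bounded_linear_cnj
          Ck_has_vector_derivative[OF \<phi>(2)[unfolded One_nat_def]]]])
  have v: "Ck 1 v" "bounded {p. v p \<noteq> 0}"
    unfolding v_def by (rule Ck_lift[OF \<psi>(2)], rule bounded_support_lift[OF \<psi>(1)])
  note vH1 = C1_weak_deriv[OF v]
  have "AE p in lebesgue. \<forall>k\<in>UNIV. weak_deriv k v p = field_deriv k v p"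
    by (rule AE_finite_allI) (simp_all add: vH1(2))
  then have ae: "AE p in lebesgue. (\<Sum>k\<in>UNIV. cnj (hgrad v p $ k) * hgrad u p $ k) = ?\<phi>' (koranyi4 p) * radial_pairing u p"
  proof eventually_elim
    case (elim p)
    then show ?case
      unfolding hgrad_def v_def radial_pairing_def sum_distrib_left
      by (intro sum.cong) (simp_all add: field_deriv_lift_0[OF \<psi>(2)] d\<psi> mult.left_commute scaleR_conv_of_real)
  qed
  have cont: "continuous_on UNIV ?\<phi>'" using Ck_vector_derivative[OF \<phi>(2)[unfolded One_nat_def]] by simp
  have "hgrad_inner v u = (LINT p|lebesgue. ?\<phi>' (koranyi4 p) * radial_pairing u p)"
    unfolding hgrad_inner_def
  proof (rule integral_cong_AE[OF _ _ ae])
    show "(\<lambda>p. \<Sum>k\<in>UNIV. cnj (hgrad v p $ k) * hgrad u p $ k) \<in> borel_measurable lebesgue"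
    proof (rule borel_measurable_sum)
      fix k :: "'d + 'd"
      have "(\<lambda>p. cnj (weak_deriv k v p)) \<in> borel_measurable lebesgue"
        by (rule measurable_compose[OF borel_measurable_weak_deriv[OF vH1(1)]])
           (intro borel_measurable_continuous_onI continuous_intros)
      then show "(\<lambda>p. cnj (hgrad v p $ k) * hgrad u p $ k) \<in> borel_measurable lebesgue"
        unfolding hgrad_def using borel_measurable_weak_deriv[OF u, of k] by (simp add: borel_measurable_times)
    qed
    show "(\<lambda>p. ?\<phi>' (koranyi4 p) * radial_pairing u p) \<in> borel_measurable lebesgue"
      by (intro borel_measurable_integrable annulus_integrable_mult annular_derivative \<phi>(1) cont
          annulus_integrable_radial_pairing u)
  qed
  moreover have "cnj (v p) = \<phi> (koranyi4 p)" for p by (simp add: v_def lift_0)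
  then have "L2_inner v (\<lambda>p. V p * u p) = (LINT p|lebesgue. \<phi> (koranyi4 p) * (V p * u p))"
    "L2_inner v u = (LINT p|lebesgue. \<phi> (koranyi4 p) * u p)"
    unfolding L2_inner_def by simp_all
  moreover have "hgrad_inner v u + L2_inner v (\<lambda>p. V p * u p) = ev * L2_inner v u"
    using sol vH1(1) unfolding weak_solution_def by blast
  ultimately have eq: "(LINT p|lebesgue. ?\<phi>' (koranyi4 p) * radial_pairing u p)
      = ev * (LINT p|lebesgue. \<phi> (koranyi4 p) * u p) - (LINT p|lebesgue. \<phi> (koranyi4 p) * (V p * u p))"
    by (simp add: algebra_simps)
  have i1: "integrable lebesgue (\<lambda>p. \<phi> (koranyi4 p) * ((V p - ev) * u p))"
    by (rule annulus_integrable_mult[OF \<phi>(1) Ck_imp_continuous[OF \<phi>(2)] h])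
  have i2: "integrable lebesgue (\<lambda>p. \<phi> (koranyi4 p) * u p)"
    using u by (intro annulus_integrable_mult \<phi>(1) Ck_imp_continuous[OF \<phi>(2)] L2_annulus_integrable) (simp add: H1_def)
  have "(LINT p|lebesgue. \<phi> (koranyi4 p) * (V p * u p))
      = (LINT p|lebesgue. \<phi> (koranyi4 p) * ((V p - ev) * u p) + ev * (\<phi> (koranyi4 p) * u p))"
    by (rule Bochner_Integration.integral_cong) (auto simp: algebra_simps)
  also have "\<dots> = (LINT p|lebesgue. \<phi> (koranyi4 p) * ((V p - ev) * u p)) + ev * (LINT p|lebesgue. \<phi> (koranyi4 p) * u p)"
    by (simp only: Bochner_Integration.integral_add[OF i1 integrable_mult_right[OF i2]] integral_mult_right_zero)
  finally show ?thesis unfolding eq by simp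
qed

text \<open>
  Rewriting the right-hand side of the tested equation by \<open>layer_integral_by_parts\<close> shows that the
  pairing with \<open>\<phi>'(N)\<close> has the density \<open>L\<close>, the layer integral of \<open>(V - \<lambda>) u\<close>, for each derivative
  \<open>\<phi>'\<close>. Derivatives of annular profiles are the annular profiles of integral zero, so the density
  is \<open>L + c\<close> for a constant \<open>c\<close>. The layer integral is continuous because spheres are null sets.
\<close>

lemma radial_flux:
  fixes V :: "'d::finite heis \<Rightarrow> complex"
  assumes sol: "weak_solution V ev u" and V: "V \<in> borel_measurable lebesgue"
    and h: "annulus_integrable (\<lambda>p. (V p - ev) * u p)"
  obtains M :: "real \<Rightarrow> complex" where "continuous_on {0<..} M"
    "\<And>\<psi>. annular \<psi> \<Longrightarrow> continuous_on UNIV \<psi> \<Longrightarrow>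
       (LINT p|lebesgue. \<psi> (koranyi4 p) * radial_pairing u p) = (LINT y|lborel. \<psi> y * M y)"
proof -
  have u: "u \<in> H1" using sol by (simp add: weak_solution_def)
  let ?h = "\<lambda>p. (V p - ev) * u p"
  have um: "u \<in> borel_measurable lebesgue" using u by (simp add: H1_def L2_def)
  have hm: "?h \<in> borel_measurable lebesgue" using V um by measurable
  let ?L = "layer_integral ?h"
  have L: "continuous_on {0<..} ?L" by (rule layer_integral_continuous[OF h hm])
  obtain \<alpha> :: "real \<Rightarrow> complex" where \<alpha>: "annular \<alpha>" "\<And>n. Ck n \<alpha>" "(LINT y|lborel. \<alpha> y) = 1"
    by (rule ex_annular_bump) blast
  have \<alpha>c: "continuous_on UNIV \<alpha>" by (rule Ck_imp_continuous[OF \<alpha>(2)])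
  let ?G = "\<lambda>\<psi>. LINT p|lebesgue. \<psi> (koranyi4 p) * radial_pairing u p"
  have iG: "integrable lebesgue (\<lambda>p. \<psi> (koranyi4 p) * radial_pairing u p)" if "annular \<psi>" "continuous_on UNIV \<psi>" for \<psi>
    by (intro annulus_integrable_mult that annulus_integrable_radial_pairing u)
  have ann: "annular (\<lambda>y. \<psi> y * m y)" if "annular \<psi>" for \<psi> m :: "real \<Rightarrow> complex"
    by (rule annular_mono[OF that]) simp
  have iL: "integrable lborel (\<lambda>y. \<psi> y * ?L y)" if "annular \<psi>" "continuous_on UNIV \<psi>" for \<psi>
    by (intro annular_integrable ann annular_mult_continuous L that)
  \<comment> \<open>Subtracting a multiple of \<open>\<alpha>\<close> makes the integral of \<open>\<psi>\<close> zero; \<open>c\<close> records what \<open>\<alpha>\<close> contributes.\<close>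
  define c where "c = ?G \<alpha> - (LINT y|lborel. \<alpha> y * ?L y)"
  have main: "?G \<psi> = (LINT y|lborel. \<psi> y * (?L y + c))" if \<psi>: "annular \<psi>" "continuous_on UNIV \<psi>" for \<psi>
  proof -
    define \<kappa> where "\<kappa> = (LINT y|lborel. \<psi> y)"
    let ?\<xi> = "\<lambda>y. \<psi> y - \<kappa> * \<alpha> y"
    have \<xi>: "annular ?\<xi>" "continuous_on UNIV ?\<xi>"
    proof -
      have "annular (\<lambda>y. \<psi> y + - (\<kappa> * \<alpha> y))"
        by (intro annular_add \<psi>(1) annular_mono[OF \<alpha>(1)]) simp
      then show "annular ?\<xi>" by simp
      show "continuous_on UNIV ?\<xi>" by (intro continuous_intros \<psi> \<alpha>c)
    qed
    have "(LINT y|lborel. ?\<xi> y) = 0"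
      using annular_integrable[OF \<psi>] annular_integrable[OF \<alpha>(1) \<alpha>c] \<alpha>(3) by (simp add: \<kappa>_def)
    then obtain \<theta> where \<theta>: "annular \<theta>" "\<And>y. (\<theta> has_vector_derivative ?\<xi> y) (at y)"
      using antiderivative_annular[OF \<xi>] by blast
    have \<theta>1: "Ck 1 \<theta>" unfolding One_nat_def by (rule Ck_SucI_vector[OF \<theta>(2)]) (simp add: \<xi>(2))
    have d\<theta>: "vector_derivative \<theta> (at y) = ?\<xi> y" for y by (rule vector_derivative_at[OF \<theta>(2)])
    have "?G ?\<xi> = - (LINT p|lebesgue. \<theta> (koranyi4 p) * ?h p)"
      using weak_solution_radial_test[OF sol h \<theta>(1) \<theta>1] unfolding d\<theta> .
    also have "\<dots> = (LINT y|lborel. ?\<xi> y * ?L y)"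
      using layer_integral_by_parts[OF \<theta>(1) \<theta>1 h hm] unfolding d\<theta> by simp
    finally have eq: "?G ?\<xi> = (LINT y|lborel. ?\<xi> y * ?L y)" .
    have split_G: "?G ?\<xi> = ?G \<psi> - \<kappa> * ?G \<alpha>"
    proof -
      have "?G ?\<xi> = (LINT p|lebesgue. \<psi> (koranyi4 p) * radial_pairing u p - \<kappa> * (\<alpha> (koranyi4 p) * radial_pairing u p))"
        by (rule Bochner_Integration.integral_cong) (auto simp: algebra_simps)
      also have "\<dots> = ?G \<psi> - \<kappa> * ?G \<alpha>"
        by (simp only: Bochner_Integration.integral_diff[OF iG[OF \<psi>] integrable_mult_right[OF iG[OF \<alpha>(1) \<alpha>c]]]
            integral_mult_right_zero)
      finally show ?thesis .
    qed
    have split_L: "(LINT y|lborel. ?\<xi> y * ?L y) = (LINT y|lborel. \<psi> y * ?L y) - \<kappa> * (LINT y|lborel. \<alpha> y * ?L y)"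
    proof -
      have "(LINT y|lborel. ?\<xi> y * ?L y) = (LINT y|lborel. \<psi> y * ?L y - \<kappa> * (\<alpha> y * ?L y))"
        by (rule Bochner_Integration.integral_cong) (auto simp: algebra_simps)
      also have "\<dots> = (LINT y|lborel. \<psi> y * ?L y) - \<kappa> * (LINT y|lborel. \<alpha> y * ?L y)"
        by (simp only: Bochner_Integration.integral_diff[OF iL[OF \<psi>] integrable_mult_right[OF iL[OF \<alpha>(1) \<alpha>c]]]
            integral_mult_right_zero)
      finally show ?thesis .
    qed
    have "?G \<psi> = (LINT y|lborel. \<psi> y * ?L y) + \<kappa> * c"
    proof -
      have "a = b + \<kappa> * (a' - b')" if "x = a - \<kappa> * a'" "y = b - \<kappa> * b'" "x = y" for x y a b a' b' :: complex
        using that by (simp add: algebra_simps)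
      from this[OF split_G split_L eq] show ?thesis unfolding c_def .
    qed
    also have "\<dots> = (LINT y|lborel. \<psi> y * ?L y + \<psi> y * c)"
      by (simp only: Bochner_Integration.integral_add[OF iL[OF \<psi>] integrable_mult_left[OF annular_integrable[OF \<psi>]]]
          integral_mult_left_zero \<kappa>_def)
    finally show ?thesis by (simp only: distrib_left)
  qed
  show thesis
    by (rule that[of "\<lambda>y. ?L y + c"]) (intro continuous_intros L, rule main)
qed

text \<open>
  The weak derivatives of \<open>u\<close> tested against the components of the smooth field \<open>\<psi>(N) \<nabla>N\<close>; no
  equation for \<open>u\<close> is involved.
\<close>

lemma weak_deriv_radial_test:
  fixes u :: "'d::finite heis \<Rightarrow> complex"
  assumes u: "u \<in> H1" and \<psi>: "annular \<psi>" "\<And>n. Ck n \<psi>"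
  shows "(LINT p|lebesgue. u p * ((8 * real CARD('d) + 16) *\<^sub>R lift 1 \<psi> p
             + 16 *\<^sub>R lift 1 (\<lambda>y. y *\<^sub>R vector_derivative \<psi> (at y)) p))
           = - (LINT p|lebesgue. \<psi> (koranyi4 p) * radial_pairing u p)"
proof -
  let ?F = "\<lambda>k p. d_koranyi4 k p *\<^sub>R lift 0 \<psi> p :: complex"
  have FC: "Ck n (?F k :: 'd heis \<Rightarrow> complex)" for n k
    by (intro Ck_scaleR Ck_d_koranyi4 Ck_lift \<psi>(2))
  have Fb: "bounded {p :: 'd heis. ?F k p \<noteq> 0}" for k
    by (rule bounded_subset[OF bounded_support_lift[OF \<psi>(1), of 0]]) auto
  have weak: "(LINT p|lebesgue. u p * field_deriv k (?F k) p) = - (LINT p|lebesgue. weak_deriv k u p * ?F k p)" for k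
    using weak_deriv_spec(2)[OF u, of k] test_functionI[OF FC Fb] unfolding has_weak_deriv_def by blast
  have uL2: "u \<in> L2" using u by (simp add: H1_def)
  have i: "integrable lebesgue (\<lambda>p. f p * g p)"
    if f: "f \<in> L2" and g: "continuous_on UNIV g" "bounded {p. g p \<noteq> 0}" for f g :: "'d heis \<Rightarrow> complex"
  proof -
    obtain c where c: "{p. g p \<noteq> 0} \<subseteq> cbox (- c) c" using bounded_subset_cbox_symmetric[OF g(2)] by blast
    have "integrable lebesgue (\<lambda>p. g p * f p)"
      by (rule test_times_locally_integrable[OF g(1) _ L2_integrable_cbox[OF f]]) (use c in blast)
    then show ?thesis by (simp add: mult.commute)
  qed
  have i1: "integrable lebesgue (\<lambda>p. u p * field_deriv k (?F k) p)" for k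
    using Ck_field_deriv[OF FC[of "Suc 0" k], of k]
    by (intro i uL2 bounded_support_field_deriv Fb Ck_imp_continuous)
  have i2: "integrable lebesgue (\<lambda>p. weak_deriv k u p * ?F k p)" for k
    by (intro i weak_deriv_spec(1)[OF u] Ck_imp_continuous[OF FC[of 0]] Fb)
  have C1: "Ck 1 (lift 0 \<psi> :: 'd heis \<Rightarrow> complex)" by (rule Ck_lift[OF \<psi>(2)])
  have div: "(\<Sum>k\<in>UNIV. field_deriv k (?F k) p) = (8 * real CARD('d) + 16) *\<^sub>R lift 1 \<psi> p
             + 16 *\<^sub>R lift 1 (\<lambda>y. y *\<^sub>R vector_derivative \<psi> (at y)) p" for p :: "'d heis"
    unfolding div_koranyi4_field[OF C1] sum_field_deriv_lift(2)[OF \<psi>(2)] by (simp add: lift_def)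
  have "(LINT p|lebesgue. u p * ((8 * real CARD('d) + 16) *\<^sub>R lift 1 \<psi> p
             + 16 *\<^sub>R lift 1 (\<lambda>y. y *\<^sub>R vector_derivative \<psi> (at y)) p))
      = (LINT p|lebesgue. (\<Sum>k\<in>UNIV. u p * field_deriv k (?F k) p))"
    unfolding div[symmetric] sum_distrib_left ..
  also have "\<dots> = (\<Sum>k\<in>UNIV. LINT p|lebesgue. u p * field_deriv k (?F k) p)"
    by (rule Bochner_Integration.integral_sum) (rule i1)
  also have "\<dots> = - (\<Sum>k\<in>UNIV. LINT p|lebesgue. weak_deriv k u p * ?F k p)"
    unfolding weak sum_negf ..
  also have "(\<Sum>k\<in>UNIV. LINT p|lebesgue. weak_deriv k u p * ?F k p) = (LINT p|lebesgue. (\<Sum>k\<in>UNIV. weak_deriv k u p * ?F k p))"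
    by (rule Bochner_Integration.integral_sum[symmetric]) (rule i2)
  also have "(\<lambda>p. \<Sum>k\<in>UNIV. weak_deriv k u p * ?F k p) = (\<lambda>p. \<psi> (koranyi4 p) * radial_pairing u p)"
    by (auto simp: radial_pairing_def sum_distrib_left lift_0 fun_eq_iff scaleR_conv_of_real mult_ac intro!: sum.cong)
  finally show ?thesis .
qed

lemma borel_measurable_lebesgue_AE_cong:
  fixes f g :: "'a::euclidean_space \<Rightarrow> complex"
  assumes f: "f \<in> borel_measurable lebesgue" and ae: "AE x in lebesgue. f x = g x"
  shows "g \<in> borel_measurable lebesgue"
proof (rule measurableI)
  fix A :: "complex set" assume A: "A \<in> sets borel"
  have sets: "f -` A \<inter> space lebesgue \<in> sets lebesgue" by (rule measurable_sets[OF f A])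
  have "AE x in lebesgue. x \<in> f -` A \<inter> space lebesgue \<longleftrightarrow> x \<in> g -` A \<inter> space lebesgue"
    using ae by eventually_elim (simp only: vimage_eq Int_iff)
  from completion.in_sets_AE[OF this sets] show "g -` A \<inter> space lebesgue \<in> sets lebesgue"
    by simp
qed simp

lemma AE_koranyi4_pos: "AE p in lebesgue. koranyi4 (p :: 'd::finite heis) > 0"
  using AE_zsq_pos by eventually_elim (simp add: koranyi4_def add_pos_nonneg)

lemma koranyi_norm_eq: "koranyi_norm p = root 4 (koranyi4 p)"
  by (simp add: koranyi_norm_def koranyi4_def zsq_def power_mult[symmetric])

text \<open>
  Off the origin the composition is Borel; the values of \<open>f\<close> outside the open half line matter
  only on a null set.
\<close>

lemma borel_measurable_profile:
  fixes f :: "real \<Rightarrow> complex"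
  assumes "continuous_on {0<..} f"
  shows "(\<lambda>p :: 'd::finite heis. f (koranyi4 p)) \<in> borel_measurable lebesgue"
proof (rule borel_measurable_lebesgue_AE_cong)
  have "(\<lambda>y. indicat_real {0<..} y *\<^sub>R f y) \<in> borel_measurable borel"
    by (rule borel_measurable_continuous_on_indicator[OF _ assms]) simp
  then show "(\<lambda>p :: 'd heis. indicat_real {0<..} (koranyi4 p) *\<^sub>R f (koranyi4 p)) \<in> borel_measurable lebesgue"
    by (rule measurable_compose[OF borel_measurable_koranyi4])
  show "AE p in lebesgue. indicat_real {0<..} (koranyi4 (p :: 'd heis)) *\<^sub>R f (koranyi4 p) = f (koranyi4 p)"
    using AE_koranyi4_pos by eventually_elim simp
qed

lemma annulus_integrable_profile:
  fixes f :: "real \<Rightarrow> complex"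
  assumes "continuous_on {0<..} f"
  shows "annulus_integrable (\<lambda>p :: 'd::finite heis. f (koranyi4 p))"
proof (rule annulus_integrableI[OF borel_measurable_profile[OF assms]])
  fix a b :: real assume "0 < a"
  then have "compact (f ` {a..b})"
    by (intro compact_continuous_image continuous_on_subset[OF assms]) auto
  then obtain B where B: "B > 0" "\<forall>x \<in> f ` {a..b}. norm x \<le> B"
    using compact_imp_bounded bounded_pos by metis
  have "AE p in lebesgue. koranyi4 (p :: 'd heis) \<in> {a..b} \<longrightarrow> norm (f (koranyi4 p)) \<le> B * indicat_real {a..b} (koranyi4 p)"
    using B(2) by (intro AE_I2) simp
  moreover have "AE p in lebesgue. 0 \<le> B * indicat_real {a..b} (koranyi4 (p :: 'd heis))"
    using B(1) by (intro AE_I2) simp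
  moreover have iB: "integrable lebesgue (\<lambda>p :: 'd heis. B * indicat_real {a..b} (koranyi4 p))"
    by (rule integrable_mult_right[OF integrable_annulus_indicator])
  ultimately show "\<exists>W. integrable lebesgue W \<and>
      (AE p in lebesgue. koranyi4 (p :: 'd heis) \<in> {a..b} \<longrightarrow> norm (f (koranyi4 p)) \<le> W p) \<and> (AE p in lebesgue. 0 \<le> W p)"
    using iB by blast
qed

lemma lift_mult_profile: "lift m (\<lambda>y. \<psi> y * f y) p = f (koranyi4 p) * lift m \<psi> p"
  by (simp add: lift_def mult.commute)

text \<open>
  If \<open>u = f(N)\<close>, then \<open>\<nabla>N \<sqdot> \<nabla>u = 16 N R f'(N)\<close>, so by the polar formula the flux density is \<open>M =
  16 C y\<^bsup>r+1\<^esup> f'\<close> with \<open>r = d/2\<close>. Conversely, let \<open>P\<close> be a primitive of \<open>M / (16 C y\<^bsup>r+1\<^esup>)\<close>. Then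
  \<open>u\<close> and \<open>P(N)\<close> have the same integrals against the divergence of each \<open>\<psi>(N) \<nabla>N\<close>. As these
  divergences have codimension one among the functions \<open>R \<zeta>(N)\<close>, the difference \<open>u - P(N)\<close> pairs
  with such functions like a constant, and being radial it is constant almost everywhere.
\<close>

lemma radial_solution_profile:
  fixes V :: "'d::finite heis \<Rightarrow> complex"
  assumes sol: "weak_solution V ev u" and V: "V \<in> borel_measurable lebesgue"
    and h: "annulus_integrable (\<lambda>p. (V p - ev) * u p)"
    and g: "radial g" "AE p in lebesgue. u p = g p"
  obtains f f' :: "real \<Rightarrow> complex" where
    "\<And>y. y > 0 \<Longrightarrow> (f has_vector_derivative f' y) (at y)" "continuous_on {0<..} f'"
    "AE p in lebesgue. u p = f (koranyi4 p)"
proof -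
  have u: "u \<in> H1" using sol by (simp add: weak_solution_def)
  then have uL2: "u \<in> L2" and um: "u \<in> borel_measurable lebesgue" by (simp_all add: H1_def L2_def)
  define r where "r = real CARD('d) / 2"
  obtain C where C: "\<And>\<zeta>. annular \<zeta> \<Longrightarrow> continuous_on UNIV \<zeta> \<Longrightarrow>
      (LINT p|lebesgue. lift 1 \<zeta> (p :: 'd heis)) = C * (LINT y|lborel. (y powr r) *\<^sub>R \<zeta> y)"
    using polar_formula[of 0, where ?'d = 'd] unfolding r_def by auto
  have C0: "C \<noteq> 0" by (rule polar_constant_nonzero[OF C])
  obtain M where M: "continuous_on {0<..} M"
    "\<And>\<psi>. annular \<psi> \<Longrightarrow> continuous_on UNIV \<psi> \<Longrightarrow>
       (LINT p|lebesgue. \<psi> (koranyi4 p) * radial_pairing u p) = (LINT y|lborel. \<psi> y * M y)"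
    using radial_flux[OF sol V h] by blast
  define P' where "P' y = (y powr (- (r + 1))) *\<^sub>R M y / (16 * C)" for y
  have P'c: "continuous_on {0<..} P'"
    unfolding P'_def using C0 by (intro continuous_intros M(1)) auto
  obtain P where P: "\<And>y. y > 0 \<Longrightarrow> (P has_vector_derivative P' y) (at y)"
  proof -
    have "\<exists>F. \<forall>x::real. 0 < ereal x \<longrightarrow> ereal x < \<infinity> \<longrightarrow> (F has_vector_derivative P' x) (at x)"
    proof (rule einterval_antiderivative)
      fix x :: real assume "0 < ereal x"
      then show "isCont P' x"
        using P'c continuous_on_eq_continuous_at[of "{0<..}" P'] by auto
    qed simp
    then show thesis using that by auto
  qed
  have Pc: "continuous_on {0<..} P"
    by (rule continuous_on_vector_derivative[OF has_vector_derivative_at_within[OF P]]) simp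
  \<comment> \<open>The divergence of \<open>\<psi>(N) \<nabla>N\<close>.\<close>
  define T where "T \<psi> p = (8 * real CARD('d) + 16) *\<^sub>R lift 1 \<psi> p
             + 16 *\<^sub>R lift 1 (\<lambda>y. y *\<^sub>R vector_derivative \<psi> (at y)) p" for \<psi> and p :: "'d heis"
  have iu: "integrable lebesgue (\<lambda>p. u p * lift 1 \<zeta> p)" if "annular \<zeta>" "continuous_on UNIV \<zeta>" for \<zeta>
  proof -
    have "integrable lebesgue (\<lambda>p. \<zeta> (koranyi4 p) * (zsq p *\<^sub>R u p))"
      by (intro annulus_integrable_mult that annulus_integrable_continuous_mult continuous_zsq L2_annulus_integrable uL2)
    then show ?thesis by (simp add: lift_def mult.commute)
  qed
  have annP: "annular (\<lambda>y. \<zeta> y * m y)" if "annular \<zeta>" for \<zeta> m :: "real \<Rightarrow> complex"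
    by (rule annular_mono[OF that]) simp
  have iP: "integrable lebesgue (\<lambda>p :: 'd heis. P (koranyi4 p) * lift 1 \<zeta> p)" if "annular \<zeta>" "continuous_on UNIV \<zeta>" for \<zeta>
    using integrable_lift[OF annP[OF that(1)] annular_mult_continuous[OF that Pc], of 1, where ?'d = 'd]
    unfolding lift_mult_profile .
  have uT: "(LINT p|lebesgue. u p * T \<psi> p) = (LINT p|lebesgue. P (koranyi4 p) * T \<psi> p)"
    if \<psi>: "annular \<psi>" "\<And>n. Ck n \<psi>" for \<psi>
  proof -
    have \<psi>c: "continuous_on UNIV \<psi>" by (rule Ck_imp_continuous[OF \<psi>(2)])
    let ?\<psi>' = "\<lambda>y. vector_derivative \<psi> (at y)"
    have \<psi>'c: "continuous_on UNIV ?\<psi>'" by (rule Ck_imp_continuous[OF Ck_vector_derivative[OF \<psi>(2)]])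
    have \<psi>d: "(\<psi> has_vector_derivative ?\<psi>' y) (at y)" for y by (rule Ck_has_vector_derivative[OF \<psi>(2)])
    have prof: "annular (\<lambda>y. \<psi> y * P y)" "Ck 1 (\<lambda>y. \<psi> y * P y)"
      "vector_derivative (\<lambda>y. \<psi> y * P y) (at y) = \<psi> y * P' y + ?\<psi>' y * P y" for y
      by (rule annular_profile_mult[OF \<psi>(1) \<psi>d \<psi>'c _ P'c], rule P, assumption)+
    \<comment> \<open>The divergence of \<open>\<psi>(N) P(N) \<nabla>N\<close> has integral zero, which moves the derivative from \<open>\<psi>\<close> to \<open>P\<close>.\<close>
    let ?w = "\<lambda>y. y *\<^sub>R (\<psi> y * P' y)"
    have w: "annular ?w" "continuous_on UNIV ?w"
      by (intro annular_mult_id annP \<psi>(1), intro continuous_on_scaleR continuous_on_id annular_mult_continuous \<psi>(1) \<psi>c P'c)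
    have ann\<psi>': "annular (\<lambda>y. y *\<^sub>R ?\<psi>' y)" "continuous_on UNIV (\<lambda>y. y *\<^sub>R ?\<psi>' y)"
      by (intro annular_mult_id annular_derivative \<psi>(1), intro continuous_on_scaleR continuous_on_id \<psi>'c)
    have "lift 1 (\<lambda>y. y *\<^sub>R (\<psi> y * P' y + ?\<psi>' y * P y)) p
        = lift 1 ?w p + P (koranyi4 p) * lift 1 (\<lambda>y. y *\<^sub>R ?\<psi>' y) p" for p :: "'d heis"
      by (simp add: lift_def algebra_simps scaleR_conv_of_real)
    then have "(LINT p|lebesgue. lift 1 (\<lambda>y. y *\<^sub>R (\<psi> y * P' y + ?\<psi>' y * P y)) (p :: 'd heis))
        = (LINT p|lebesgue. lift 1 ?w (p :: 'd heis)) + (LINT p|lebesgue. P (koranyi4 p) * lift 1 (\<lambda>y. y *\<^sub>R ?\<psi>' y) (p :: 'd heis))"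
      by (simp only: Bochner_Integration.integral_add[OF integrable_lift[OF w] iP[OF ann\<psi>']])
    then have "(8 * real CARD('d) + 16) *\<^sub>R (LINT p|lebesgue. P (koranyi4 p) * lift 1 \<psi> (p :: 'd heis))
        + 16 *\<^sub>R ((LINT p|lebesgue. lift 1 ?w (p :: 'd heis)) + (LINT p|lebesgue. P (koranyi4 p) * lift 1 (\<lambda>y. y *\<^sub>R ?\<psi>' y) (p :: 'd heis))) = 0"
      using koranyi4_divergence_identity[OF prof(1,2), of 0, where ?'d = 'd]
      by (simp only: prof(3) lift_mult_profile add_0 of_nat_0 mult_zero_right add_0_right)
    moreover have "(LINT p|lebesgue. P (koranyi4 p) * T \<psi> p)
        = (8 * real CARD('d) + 16) *\<^sub>R (LINT p|lebesgue. P (koranyi4 p) * lift 1 \<psi> (p :: 'd heis))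
        + 16 *\<^sub>R (LINT p|lebesgue. P (koranyi4 p) * lift 1 (\<lambda>y. y *\<^sub>R ?\<psi>' y) (p :: 'd heis))"
      unfolding T_def distrib_left mult_scaleR_right
      by (simp only: Bochner_Integration.integral_add[OF integrable_scaleR_right[OF iP[OF \<psi>(1) \<psi>c]]
            integrable_scaleR_right[OF iP[OF ann\<psi>']]] integral_scaleR_right)
    ultimately have PT: "(LINT p|lebesgue. P (koranyi4 p) * T \<psi> p) = - (16 *\<^sub>R (LINT p|lebesgue. lift 1 ?w (p :: 'd heis)))"
      by (simp add: scaleR_add_right add_eq_0_iff2 algebra_simps)
    have "(y powr r) *\<^sub>R ?w y = \<psi> y * M y / (16 * C)" for y
    proof (cases "y > 0")
      case True
      then have "y powr r * (y * y powr (- (r + 1))) = 1"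
        using powr_mult_base[of y "- (r + 1)"] powr_add[of y r "- r"] by simp
      then have "complex_of_real (y powr r) * (complex_of_real y * complex_of_real (y powr (- (r + 1)))) = 1"
        unfolding of_real_mult[symmetric] by simp
      then show ?thesis
        unfolding P'_def scaleR_conv_of_real by (simp add: field_simps)
    next
      case False
      then have "\<psi> y = 0" using \<psi>(1) unfolding annular_def by force
      then show ?thesis by simp
    qed
    then have "16 *\<^sub>R (LINT p|lebesgue. lift 1 ?w (p :: 'd heis)) = (LINT y|lborel. \<psi> y * M y)"
      unfolding C[OF w] using C0 by (simp add: scaleR_conv_of_real)
    then show ?thesis
      unfolding PT using weak_deriv_radial_test[OF u \<psi>] M(2)[OF \<psi>(1) \<psi>c] unfolding T_def by simp
  qed
  let ?D = "\<lambda>p. u p - P (koranyi4 p)"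
  have iD: "integrable lebesgue (\<lambda>p. ?D p * lift 1 \<zeta> p)" if "annular \<zeta>" "continuous_on UNIV \<zeta>" for \<zeta>
    using Bochner_Integration.integrable_diff[OF iu[OF that] iP[OF that]] by (simp only: left_diff_distrib)
  obtain \<alpha> :: "real \<Rightarrow> complex" where \<alpha>: "annular \<alpha>" "\<And>n. Ck n \<alpha>" "(LINT y|lborel. \<alpha> y) = 1"
    by (rule ex_annular_bump) blast
  define \<beta> where "\<beta> y = (y powr (- r)) *\<^sub>R \<alpha> y" for y
  have \<beta>: "annular \<beta>" "continuous_on UNIV \<beta>"
    unfolding \<beta>_def by (rule annular_mono[OF \<alpha>(1)], simp, rule annular_powr_continuous[OF \<alpha>(1) Ck_imp_continuous[OF \<alpha>(2)]])
  define c where "c = (LINT p|lebesgue. ?D p * lift 1 \<beta> p) / C"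
  have const: "(LINT p|lebesgue. ?D p * lift 1 \<zeta> p) = c * (LINT p|lebesgue. lift 1 \<zeta> (p :: 'd heis))"
    if \<zeta>: "annular \<zeta>" "\<And>n. Ck n \<zeta>" for \<zeta>
  proof -
    have \<zeta>c: "continuous_on UNIV \<zeta>" by (rule Ck_imp_continuous[OF \<zeta>(2)])
    define \<kappa> where "\<kappa> = (LINT y|lborel. (y powr r) *\<^sub>R \<zeta> y)"
    obtain \<psi> where \<psi>: "annular \<psi>" "\<And>n. Ck n \<zeta> \<Longrightarrow> Ck (Suc n) \<psi>"
      "\<And>y. y *\<^sub>R vector_derivative \<psi> (at y) + (r + 1) *\<^sub>R \<psi> y = \<zeta> y - \<kappa> * (y powr (- r)) *\<^sub>R \<alpha> y"
      using euler_equation_solvable[OF \<alpha> \<zeta>(1) \<zeta>(2)[of 0], of r] unfolding \<kappa>_def by auto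
    have \<psi>C: "Ck n \<psi>" for n using Ck_Suc_imp_Ck[OF \<psi>(2)[OF \<zeta>(2)]] .
    have T\<psi>: "T \<psi> p = 16 *\<^sub>R (lift 1 \<zeta> p - \<kappa> * lift 1 \<beta> p)" for p
    proof -
      have "8 * real CARD('d) + 16 = 16 * (r + 1)" by (simp add: r_def)
      then have "T \<psi> p = 16 *\<^sub>R (zsq p *\<^sub>R (koranyi4 p *\<^sub>R vector_derivative \<psi> (at (koranyi4 p)) + (r + 1) *\<^sub>R \<psi> (koranyi4 p)))"
        unfolding T_def by (simp add: lift_def scaleR_add_right add.commute mult.commute mult.left_commute)
      then show ?thesis unfolding \<psi>(3) by (simp add: lift_def \<beta>_def scaleR_diff_right)
    qed
    have i\<psi>: "integrable lebesgue (\<lambda>p. F p * T \<psi> p)"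
      if "\<And>\<zeta>. annular \<zeta> \<Longrightarrow> continuous_on UNIV \<zeta> \<Longrightarrow> integrable lebesgue (\<lambda>p. F p * lift 1 \<zeta> p)" for F :: "'d heis \<Rightarrow> complex"
    proof -
      have "integrable lebesgue (\<lambda>p. 16 *\<^sub>R (F p * lift 1 \<zeta> p) - 16 *\<^sub>R (\<kappa> * (F p * lift 1 \<beta> p)))"
        by (intro Bochner_Integration.integrable_diff integrable_scaleR_right integrable_mult_right that \<zeta>(1) \<zeta>c \<beta>)
      then show ?thesis unfolding T\<psi> by (simp add: algebra_simps)
    qed
    have "(LINT p|lebesgue. ?D p * T \<psi> p) = 0"
      unfolding left_diff_distrib
      by (simp only: Bochner_Integration.integral_diff[OF i\<psi>[OF iu] i\<psi>[OF iP]] uT[OF \<psi>(1) \<psi>C] diff_self)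
    also have "(LINT p|lebesgue. ?D p * T \<psi> p)
        = (LINT p|lebesgue. 16 *\<^sub>R (?D p * lift 1 \<zeta> p - \<kappa> * (?D p * lift 1 \<beta> p)))"
      unfolding T\<psi> by (rule Bochner_Integration.integral_cong) (auto simp: algebra_simps)
    also have "\<dots> = 16 *\<^sub>R ((LINT p|lebesgue. ?D p * lift 1 \<zeta> p) - \<kappa> * (LINT p|lebesgue. ?D p * lift 1 \<beta> p))"
      by (simp only: Bochner_Integration.integral_diff[OF iD[OF \<zeta>(1) \<zeta>c] integrable_mult_right[OF iD[OF \<beta>]]]
          integral_scaleR_right integral_mult_right_zero)
    finally have "(LINT p|lebesgue. ?D p * lift 1 \<zeta> p) = \<kappa> * (LINT p|lebesgue. ?D p * lift 1 \<beta> p)" by simp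
    then show ?thesis unfolding C[OF \<zeta>(1) \<zeta>c] \<kappa>_def[symmetric] c_def using C0 by simp
  qed
  obtain g0 where g0: "\<And>p. g p = g0 (koranyi_norm p)" using g(1) unfolding radial_def by blast
  \<comment> \<open>The profile \<open>g\<^sub>0\<close> is arbitrary; measurability is available only after composition with \<open>N\<close>.\<close>
  define g1 where "g1 y = g0 (root 4 y) - P y - c" for y
  have g1: "g1 (koranyi4 p) = g p - P (koranyi4 p) - c" for p by (simp add: g1_def g0 koranyi_norm_eq)
  have gm: "g \<in> borel_measurable lebesgue" by (rule borel_measurable_lebesgue_AE_cong[OF um g(2)])
  have g1m: "(\<lambda>p :: 'd heis. g1 (koranyi4 p)) \<in> borel_measurable lebesgue"
    unfolding g1 by (intro borel_measurable_diff gm borel_measurable_profile Pc borel_measurable_const)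
  have "AE p in lebesgue. koranyi4 (p :: 'd heis) \<in> {0<..} \<longrightarrow> g1 (koranyi4 p) = 0"
  proof (rule fundamental_lemma_along[OF continuous_koranyi4 g1m AE_zsq_pos open_greaterThan])
    fix a b :: real assume ab: "cbox a b \<subseteq> {0<..}"
    show "integrable lebesgue (\<lambda>p :: 'd heis. indicat_real (cbox a b) (koranyi4 p) *\<^sub>R zsq p *\<^sub>R g1 (koranyi4 p))"
    proof (cases "a \<le> b")
      case True
      then have "0 < a" using ab by auto
      have D: "annulus_integrable (\<lambda>p. zsq p *\<^sub>R F p)" if "annulus_integrable F" for F
        by (rule annulus_integrable_continuous_mult[OF continuous_zsq that])
      note parts = D[OF L2_annulus_integrable[OF uL2]] D[OF annulus_integrable_profile[OF Pc]]
        D[OF annulus_integrable_profile[of "\<lambda>_. c"]]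
      have "integrable lebesgue (\<lambda>p. indicat_real {a..b} (koranyi4 p) *\<^sub>R zsq p *\<^sub>R u p
          - indicat_real {a..b} (koranyi4 p) *\<^sub>R zsq p *\<^sub>R P (koranyi4 p)
          - indicat_real {a..b} (koranyi4 p) *\<^sub>R zsq p *\<^sub>R c)"
        using parts \<open>0 < a\<close> unfolding annulus_integrable_def
        by (intro Bochner_Integration.integrable_diff) auto
      then show ?thesis
      proof (rule integrable_cong_AE_imp)
        show "(\<lambda>p :: 'd heis. indicat_real (cbox a b) (koranyi4 p) *\<^sub>R zsq p *\<^sub>R g1 (koranyi4 p)) \<in> borel_measurable lebesgue"
          by (intro borel_measurable_scaleR g1m borel_measurable_zsq)
             (simp add: borel_measurable_integrable[OF integrable_annulus_indicator])
        show "AE p in lebesgue. indicat_real {a..b} (koranyi4 p) *\<^sub>R zsq p *\<^sub>R u p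
          - indicat_real {a..b} (koranyi4 p) *\<^sub>R zsq p *\<^sub>R P (koranyi4 p)
          - indicat_real {a..b} (koranyi4 p) *\<^sub>R zsq p *\<^sub>R c
          = indicat_real (cbox a b) (koranyi4 p) *\<^sub>R zsq p *\<^sub>R g1 (koranyi4 p)"
          using g(2) by eventually_elim (simp add: g1 scaleR_diff_right)
      qed
    qed simp
  next
    fix \<phi> :: "real \<Rightarrow> complex" and a b :: real
    assume \<phi>: "\<And>n. Ck n \<phi>" "cbox a b \<subseteq> {0<..}" "\<And>y. y \<notin> cbox a b \<Longrightarrow> \<phi> y = 0"
    have ann: "annular \<phi>" by (rule annular_of_cbox[OF \<phi>(2,3)])
    have \<phi>c: "continuous_on UNIV \<phi>" by (rule Ck_imp_continuous[OF \<phi>(1)])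
    have "(LINT p|lebesgue. \<phi> (koranyi4 p) * (zsq p *\<^sub>R g1 (koranyi4 (p :: 'd heis))))
        = (LINT p|lebesgue. ?D p * lift 1 \<phi> p - c * lift 1 \<phi> p)"
    proof (rule integral_cong_AE)
      show "(\<lambda>p :: 'd heis. \<phi> (koranyi4 p) * (zsq p *\<^sub>R g1 (koranyi4 p))) \<in> borel_measurable lebesgue"
        by (intro borel_measurable_times borel_measurable_scaleR g1m borel_measurable_zsq
            measurable_compose[OF borel_measurable_koranyi4 borel_measurable_continuous_onI[OF \<phi>c]])
      show "(\<lambda>p. ?D p * lift 1 \<phi> p - c * lift 1 \<phi> p) \<in> borel_measurable lebesgue"
        by (intro borel_measurable_integrable Bochner_Integration.integrable_diff iD integrable_mult_right integrable_lift ann \<phi>c)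
      show "AE p in lebesgue. \<phi> (koranyi4 p) * (zsq p *\<^sub>R g1 (koranyi4 p)) = ?D p * lift 1 \<phi> p - c * lift 1 \<phi> p"
        using g(2) by eventually_elim (simp add: g1 lift_def algebra_simps scaleR_conv_of_real)
    qed
    also have "\<dots> = (LINT p|lebesgue. ?D p * lift 1 \<phi> p) - c * (LINT p|lebesgue. lift 1 \<phi> (p :: 'd heis))"
      by (simp only: Bochner_Integration.integral_diff[OF iD[OF ann \<phi>c] integrable_mult_right[OF integrable_lift[OF ann \<phi>c]]]
          integral_mult_right_zero)
    also have "\<dots> = 0" using const[OF ann \<phi>(1)] by simp
    finally show "(LINT p|lebesgue. \<phi> (koranyi4 p) * (zsq p *\<^sub>R g1 (koranyi4 (p :: 'd heis)))) = 0" .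
  qed
  then have "AE p in lebesgue. u p = P (koranyi4 p) + c"
    using g(2) AE_koranyi4_pos by eventually_elim (simp add: g1 algebra_simps)
  moreover have "((\<lambda>y. P y + c) has_vector_derivative P' y) (at y)" if "y > 0" for y
    using has_vector_derivative_add[OF P[OF that] has_vector_derivative_const[of c]] by simp
  ultimately show thesis using that[of "\<lambda>y. P y + c" P'] P'c by blast
qed

text \<open>
  Away from the origin the chain rule holds classically, and on the support of a given test
  function \<open>f(N)\<close> can be replaced by a cut-off \<open>C\<^sup>1\<close> function. The origin is a null set.
\<close>

lemma radial_weak_gradient:
  fixes u :: "'d::finite heis \<Rightarrow> complex" and f f' :: "real \<Rightarrow> complex"
  assumes u: "u \<in> H1" "AE p in lebesgue. u p = f (koranyi4 p)"
    and f: "\<And>y. y > 0 \<Longrightarrow> (f has_vector_derivative f' y) (at y)" "continuous_on {0<..} f'"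
  shows "AE p in lebesgue. weak_deriv k u p = d_koranyi4 k p *\<^sub>R f' (koranyi4 p)"
proof -
  define w where "w = weak_deriv k u"
  have w: "w \<in> L2" "has_weak_deriv k u w" unfolding w_def by (rule weak_deriv_spec[OF u(1)])+
  have um: "u \<in> borel_measurable lebesgue" using u(1) by (simp add: H1_def L2_def)
  let ?\<Omega> = "{p :: 'd heis. 0 < koranyi4 p}"
  let ?G = "\<lambda>p :: 'd heis. d_koranyi4 k p *\<^sub>R f' (koranyi4 p)"
  obtain \<eta> \<eta>' :: "nat \<Rightarrow> real \<Rightarrow> real" where \<eta>:
    "\<And>n y. (\<eta> n has_real_derivative \<eta>' n y) (at y)" "\<And>n. continuous_on UNIV (\<eta>' n)"
    "\<And>n. annular (\<eta> n)"
    "\<And>n y. 2 / real (Suc n) \<le> y \<Longrightarrow> y \<le> real (Suc n) \<Longrightarrow> \<eta> n y = 1 \<and> \<eta>' n y = 0"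
    by (rule ex_cutoffs) blast
  have Gint: "integrable lebesgue (\<lambda>p. indicat_real (cbox c d) p *\<^sub>R ?G p)" if "cbox c d \<subseteq> ?\<Omega>" for c d
  proof -
    have "continuous_on (cbox c d) ?G"
      by (intro continuous_on_scaleR continuous_d_koranyi4 continuous_on_compose2[OF f(2) continuous_koranyi4])
         (use that in auto)
    then have *: "integrable lborel (\<lambda>p. indicat_real (cbox c d) p *\<^sub>R ?G p)"
      by (intro borel_integrable_compact compact_cbox)
    then show ?thesis using integrable_completion[OF borel_measurable_integrable[OF *]] by blast
  qed
  have "AE p in lebesgue. p \<in> ?\<Omega> \<longrightarrow> w p - ?G p = 0"
  proof (rule fundamental_lemma_along[where T = "\<lambda>p. p" and w = "\<lambda>_. 1" and g = "\<lambda>p. w p - ?G p"])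
    show "(\<lambda>p. w p - ?G p) \<in> borel_measurable lebesgue"
      using w(1) by (intro borel_measurable_diff borel_measurable_scaleR borel_measurable_d_koranyi4
          borel_measurable_profile f(2)) (simp add: L2_def)
    show "open ?\<Omega>" by (rule open_Collect_less[OF continuous_on_const continuous_koranyi4])
    fix c d :: "'d heis" assume cd: "cbox c d \<subseteq> ?\<Omega>"
    show "integrable lebesgue (\<lambda>p. indicat_real (cbox c d) p *\<^sub>R (1 *\<^sub>R (w p - ?G p)))"
      using Bochner_Integration.integrable_diff[OF L2_integrable_cbox[OF w(1), of c d] Gint[OF cd]]
      by (simp only: scaleR_diff_right[symmetric] scaleR_one)
    fix \<phi> :: "'d heis \<Rightarrow> complex"
    assume \<phi>: "\<And>n. Ck n \<phi>" "\<And>p. p \<notin> cbox c d \<Longrightarrow> \<phi> p = 0"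
    have \<phi>c: "continuous_on UNIV \<phi>" by (rule Ck_imp_continuous[OF \<phi>(1)])
    have supp: "{p. \<phi> p \<noteq> 0} \<subseteq> cbox c d" using \<phi>(2) by blast
    have bs: "bounded {p. \<phi> p \<noteq> 0}" by (rule bounded_subset[OF bounded_cbox supp])
    have X0: "field_deriv k \<phi> p = 0" if "p \<notin> cbox c d" for p
    proof -
      have "closure {p. \<phi> p \<noteq> 0} \<subseteq> cbox c d" by (rule closure_minimal[OF supp closed_cbox])
      then have "p \<notin> closure {p. \<phi> p \<noteq> 0}" using that by blast
      then show ?thesis unfolding field_deriv_def by (rule frechet_derivative_outside_support)
    qed
    \<comment> \<open>The box stays away from the origin, so one of the cut-offs equals one on all of it.\<close>
    obtain n where n: "\<And>p. p \<in> cbox c d \<Longrightarrow> 2 / real (Suc n) \<le> koranyi4 p \<and> koranyi4 p \<le> real (Suc n)"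
    proof (cases "cbox c d = {}")
      case False
      have cpt: "compact (koranyi4 ` cbox c d)"
        by (rule compact_continuous_image[OF continuous_koranyi4 compact_cbox])
      have ne: "koranyi4 ` cbox c d \<noteq> {}" using False by simp
      obtain m1 where m1: "m1 \<in> koranyi4 ` cbox c d" "\<And>y. y \<in> koranyi4 ` cbox c d \<Longrightarrow> m1 \<le> y"
        using compact_attains_inf[OF cpt ne] by blast
      obtain m2 where m2: "\<And>y. y \<in> koranyi4 ` cbox c d \<Longrightarrow> y \<le> m2"
        using compact_attains_sup[OF cpt ne] by blast
      have "m1 > 0" using m1(1) cd by blast
      obtain n where n: "real n > max (2 / m1) m2" using reals_Archimedean2 by blast
      then have "2 / m1 < real (Suc n)" "m2 < real (Suc n)" by auto
      then have "2 / real (Suc n) \<le> m1" using \<open>m1 > 0\<close> by (simp add: field_simps del: of_nat_Suc)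
      then have "2 / real (Suc n) \<le> koranyi4 p \<and> koranyi4 p \<le> real (Suc n)" if "p \<in> cbox c d" for p
        using m1(2)[OF imageI[OF that]] m2[OF imageI[OF that]] \<open>m2 < real (Suc n)\<close> by linarith
      then show thesis using that by blast
    qed (use that in blast)
    define e where "e y = complex_of_real (\<eta> n y)" for y
    define e' where "e' y = complex_of_real (\<eta>' n y)" for y
    have e: "annular e" "(e has_vector_derivative e' y) (at y)" "continuous_on UNIV e'" for y
    proof -
      show "annular e" by (rule annular_mono[OF \<eta>(3)[of n]]) (simp add: e_def)
      show "(e has_vector_derivative e' y) (at y)"
        unfolding e_def e'_def
        by (rule has_vector_derivative_of_real[OF \<eta>(1)])
      show "continuous_on UNIV e'" unfolding e'_def by (intro continuous_on_of_real \<eta>(2))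
    qed
    have prof: "annular (\<lambda>y. e y * f y)" "Ck 1 (\<lambda>y. e y * f y)"
      "vector_derivative (\<lambda>y. e y * f y) (at y) = e y * f' y + e' y * f y" for y
      by (rule annular_profile_mult[OF e _ f(2)], rule f(1), assumption)+
    define F :: "'d heis \<Rightarrow> complex" where "F = lift 0 (\<lambda>y. e y * f y)"
    have F: "Ck 1 F" "bounded {p. F p \<noteq> 0}"
      unfolding F_def by (rule Ck_lift[OF prof(2)], rule bounded_support_lift[OF prof(1)])
    have K: "F p = f (koranyi4 p)" "field_deriv k F p = ?G p" if "p \<in> cbox c d" for p
      using \<eta>(4)[of n "koranyi4 p"] n[OF that] unfolding F_def field_deriv_lift_0[OF prof(2)] prof(3)
      by (simp_all add: lift_0 e_def e'_def)
    have "(LINT p|lebesgue. w p * \<phi> p) = - (LINT p|lebesgue. u p * field_deriv k \<phi> p)"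
      using w(2) test_functionI[OF \<phi>(1) bs] unfolding has_weak_deriv_def by simp
    also have "(LINT p|lebesgue. u p * field_deriv k \<phi> p) = (LINT p|lebesgue. F p * field_deriv k \<phi> p)"
    proof (rule integral_cong_AE)
      have "continuous_on UNIV (field_deriv k \<phi>)" by (rule Ck_imp_continuous[OF Ck_field_deriv[OF \<phi>(1)]])
      from borel_measurable_integrable[OF continuous_bounded_support_integrable[OF this bounded_support_field_deriv[OF bs]]]
      have m: "field_deriv k \<phi> \<in> borel_measurable lebesgue" .
      have m': "F \<in> borel_measurable lebesgue"
        by (rule borel_measurable_integrable[OF continuous_bounded_support_integrable[OF Ck_imp_continuous[OF F(1)] F(2)]])
      show "(\<lambda>p. u p * field_deriv k \<phi> p) \<in> borel_measurable lebesgue"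
        "(\<lambda>p. F p * field_deriv k \<phi> p) \<in> borel_measurable lebesgue"
        by (intro borel_measurable_times um m m')+
      show "AE p in lebesgue. u p * field_deriv k \<phi> p = F p * field_deriv k \<phi> p"
        using u(2)
      proof eventually_elim
        case (elim p)
        then show ?case using K(1)[of p] X0[of p] by (cases "p \<in> cbox c d") simp_all
      qed
    qed
    also have "\<dots> = - (LINT p|lebesgue. field_deriv k F p * \<phi> p)"
      by (rule horizontal_integration_by_parts[OF F \<phi>(1)])
    also have "(\<lambda>p. field_deriv k F p * \<phi> p) = (\<lambda>p. ?G p * \<phi> p)"
    proof
      fix p show "field_deriv k F p * \<phi> p = ?G p * \<phi> p"
        using K(2)[of p] \<phi>(2)[of p] by (cases "p \<in> cbox c d") simp_all
    qed
    finally have eq: "(LINT p|lebesgue. w p * \<phi> p) = (LINT p|lebesgue. ?G p * \<phi> p)" by simp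
    have "(LINT p|lebesgue. \<phi> p * w p - \<phi> p * ?G p) = (LINT p|lebesgue. \<phi> p * w p) - (LINT p|lebesgue. \<phi> p * ?G p)"
    proof (rule Bochner_Integration.integral_diff)
      show "integrable lebesgue (\<lambda>p. \<phi> p * w p)"
        by (rule test_times_locally_integrable[OF \<phi>c _ L2_integrable_cbox[OF w(1)]]) (rule \<phi>(2))
      show "integrable lebesgue (\<lambda>p. \<phi> p * ?G p)"
        by (rule test_times_locally_integrable[OF \<phi>c _ Gint[OF cd]]) (rule \<phi>(2))
    qed
    then show "(LINT p|lebesgue. \<phi> p * (1 *\<^sub>R (w p - ?G p))) = 0"
      using eq by (simp only: scaleR_one right_diff_distrib mult.commute[of "\<phi> _"] diff_self)
  qed auto
  then show ?thesis using AE_koranyi4_pos unfolding w_def by eventually_elim simp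
qed

section \<open>The Hardy inequality for radial profiles\<close>

lemma inverse_profile:
  fixes g g' :: "real \<Rightarrow> complex"
  assumes g: "\<And>y. y > 0 \<Longrightarrow> (g has_vector_derivative g' y) (at y)" "continuous_on {0<..} g'"
  shows "y > 0 \<Longrightarrow> ((\<lambda>y. inverse y *\<^sub>R g y) has_vector_derivative
            inverse y *\<^sub>R g' y - (inverse y)\<^sup>2 *\<^sub>R g y) (at y)"
    and "continuous_on {0<..} (\<lambda>y. inverse y *\<^sub>R g' y - (inverse y)\<^sup>2 *\<^sub>R g y)"
proof -
  assume y: "y > 0"
  show "((\<lambda>y. inverse y *\<^sub>R g y) has_vector_derivative
            inverse y *\<^sub>R g' y - (inverse y)\<^sup>2 *\<^sub>R g y) (at y)"
    using has_vector_derivative_scaleR[OF DERIV_inverse[of y] g(1)[OF y]] y by (simp add: power2_eq_square)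
next
  have "continuous_on {0<..} g"
    by (rule continuous_on_vector_derivative[OF has_vector_derivative_at_within[OF g(1)]]) simp
  then show "continuous_on {0<..} (\<lambda>y. inverse y *\<^sub>R g' y - (inverse y)\<^sup>2 *\<^sub>R g y)"
    by (intro continuous_intros g(2)) auto
qed

lemma abs_square_profile:
  fixes f f' :: "real \<Rightarrow> complex"
  assumes f: "\<And>y. y > 0 \<Longrightarrow> (f has_vector_derivative f' y) (at y)" "continuous_on {0<..} f'"
  shows "y > 0 \<Longrightarrow> ((\<lambda>y. complex_of_real ((norm (f y))\<^sup>2)) has_vector_derivative
            complex_of_real (2 * Re (cnj (f y) * f' y))) (at y)"
    and "continuous_on {0<..} (\<lambda>y. complex_of_real (2 * Re (cnj (f y) * f' y)))"
proof -
  assume y: "y > 0"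
  have eq: "complex_of_real ((norm (f y))\<^sup>2) = f y * cnj (f y)" for y
    by (rule complex_norm_square)
  have "((\<lambda>y. f y * cnj (f y)) has_vector_derivative f y * cnj (f' y) + f' y * cnj (f y)) (at y)"
    by (intro has_vector_derivative_mult f(1) y bounded_linear.has_vector_derivative[OF bounded_linear_cnj])
  moreover have "f y * cnj (f' y) + f' y * cnj (f y) = complex_of_real (2 * Re (cnj (f y) * f' y))"
    by (simp add: complex_eq_iff)
  ultimately show "((\<lambda>y. complex_of_real ((norm (f y))\<^sup>2)) has_vector_derivative
            complex_of_real (2 * Re (cnj (f y) * f' y))) (at y)"
    unfolding eq by simp
next
  have "continuous_on {0<..} f"
    by (rule continuous_on_vector_derivative[OF has_vector_derivative_at_within[OF f(1)]]) simp
  then show "continuous_on {0<..} (\<lambda>y. complex_of_real (2 * Re (cnj (f y) * f' y)))"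
    by (intro continuous_intros f(2))
qed

text \<open>
  Settles the origin in pointwise identities: there the quotients by \<open>N\<close> take a default value, but
  they come with a factor \<open>R = 0\<close>.
\<close>

lemma zsq_eq_0_if_koranyi4_nonpos: "\<not> koranyi4 p > 0 \<Longrightarrow> zsq p = 0"
  using zsq_squared_le_koranyi4[of p] zsq_nonneg[of p] by (metis not_le order_trans power2_less_eq_zero_iff zero_less_power2)

text \<open>
  The densities \<open>|\<nabla>u|\<^sup>2 = 16 N R |f'(N)|\<^sup>2\<close> and \<open>(R/N) |u|\<^sup>2\<close> for \<open>u = f(N)\<close>.
\<close>

definition energy_density :: "(real \<Rightarrow> complex) \<Rightarrow> 'd::finite heis \<Rightarrow> real" where
  "energy_density f' p = 16 * koranyi4 p * zsq p * (norm (f' (koranyi4 p)))\<^sup>2"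

definition hardy_density :: "(real \<Rightarrow> complex) \<Rightarrow> 'd::finite heis \<Rightarrow> real" where
  "hardy_density f p = zsq p / koranyi4 p * (norm (f (koranyi4 p)))\<^sup>2"

lemma energy_density_nonneg: "0 \<le> energy_density f' p"
  by (simp add: energy_density_def zsq_nonneg koranyi4_nonneg)

lemma hardy_density_nonneg: "0 \<le> hardy_density f p"
  by (simp add: hardy_density_def zsq_nonneg koranyi4_nonneg)

text \<open>
  The divergence theorem for \<open>\<eta>(N) (|f(N)|\<^sup>2/N) \<nabla>N\<close> expresses \<open>8d \<integral> \<eta> (R/N) |f|\<^sup>2\<close> by \<open>-32 \<integral> \<eta> R
  Re (cnj f f')\<close> and a term with \<open>\<eta>'\<close>. The arithmetic-geometric mean inequality absorbs half of
  the left-hand side. In the \<open>\<eta>'\<close> term, \<open>R \<le> \<surd>N\<close> and the slope bound \<open>2/m\<close> leave a factor of order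
  \<open>m\<^bsup>-1/2\<^esup>\<close>; the inner slope of the cut-off has a favourable sign and needs no estimate.
\<close>

lemma hardy_integral_cutoff:
  fixes f f' :: "real \<Rightarrow> complex" and \<eta> \<eta>' :: "real \<Rightarrow> real" and m :: real
  assumes f: "\<And>y. y > 0 \<Longrightarrow> (f has_vector_derivative f' y) (at y)" "continuous_on {0<..} f'"
    and L2: "integrable lebesgue (\<lambda>p :: 'd::finite heis. (norm (f (koranyi4 p)))\<^sup>2)"
    and energy: "integrable lebesgue (energy_density f' :: 'd heis \<Rightarrow> real)"
    and \<eta>: "annular \<eta>" "\<And>y. (\<eta> has_real_derivative \<eta>' y) (at y)" "continuous_on UNIV \<eta>'"
      "\<And>y. 0 \<le> \<eta> y" "\<And>y. \<eta> y \<le> 1"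
    and m: "m > 0" "\<And>y. - \<eta>' y \<le> 2 / m * indicat_real {m..2 * m} y"
  shows "integrable lebesgue (\<lambda>p :: 'd heis. \<eta> (koranyi4 p) * hardy_density f p)"
    and "4 * real CARD('d) * (LINT p|lebesgue. \<eta> (koranyi4 p) * hardy_density f (p :: 'd heis))
           \<le> 4 / real CARD('d) * (LINT p|lebesgue. energy_density f' (p :: 'd heis))
             + 32 * sqrt (2 * m) / m * (LINT p|lebesgue. (norm (f (koranyi4 (p :: 'd heis))))\<^sup>2)"
proof -
  let ?d = "real CARD('d)"
  have d: "?d > 0" by simp
  define e e' where "e y = complex_of_real (\<eta> y)" and "e' y = complex_of_real (\<eta>' y)" for y
  have e: "annular e" "(e has_vector_derivative e' y) (at y)" "continuous_on UNIV e'" for y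
  proof -
    show "annular e" by (rule annular_mono[OF \<eta>(1)]) (simp add: e_def)
    show "(e has_vector_derivative e' y) (at y)"
      unfolding e_def e'_def by (rule has_vector_derivative_of_real[OF \<eta>(2)])
    show "continuous_on UNIV e'" unfolding e'_def by (intro continuous_on_of_real \<eta>(3))
  qed
  define q where "q y = complex_of_real ((norm (f y))\<^sup>2)" for y
  define q' where "q' y = complex_of_real (2 * Re (cnj (f y) * f' y))" for y
  have q: "(q has_vector_derivative q' y) (at y)" if "y > 0" for y
    unfolding q_def q'_def by (rule abs_square_profile(1)[OF _ f(2) that]) (rule f(1))
  have q'c: "continuous_on {0<..} q'"
    unfolding q'_def by (rule abs_square_profile(2)[OF _ f(2)]) (rule f(1))
  \<comment> \<open>\<open>F(N) = |f(N)|\<^sup>2 / N\<close>, the coefficient of \<open>\<nabla>N\<close> in the field whose divergence is integrated.\<close>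
  define F F' where "F y = inverse y *\<^sub>R q y" and "F' y = inverse y *\<^sub>R q' y - (inverse y)\<^sup>2 *\<^sub>R q y" for y
  have F: "(F has_vector_derivative F' y) (at y)" if "y > 0" for y
    unfolding F_def F'_def by (rule inverse_profile(1)[OF _ q'c that]) (rule q)
  have F'c: "continuous_on {0<..} F'"
    unfolding F'_def by (rule inverse_profile(2)[OF _ q'c]) (rule q)
  have prof: "annular (\<lambda>y. e y * F y)" "Ck 1 (\<lambda>y. e y * F y)"
      "vector_derivative (\<lambda>y. e y * F y) (at y) = e y * F' y + e' y * F y" for y
    by (rule annular_profile_mult[OF e _ F'c], rule F, assumption)+
  have cont: "continuous_on UNIV (\<lambda>y. e y * F y)" "continuous_on UNIV (\<lambda>y. y *\<^sub>R (e y * F' y + e' y * F y))"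
    using Ck_imp_continuous[OF prof(2)] Ck_imp_continuous[OF Ck_mult_id[OF Ck_vector_derivative[OF prof(2)[unfolded One_nat_def]]]]
    unfolding prof(3) by blast+
  have ann': "annular (\<lambda>y. y *\<^sub>R (e y * F' y + e' y * F y))"
    using annular_mult_id[OF annular_derivative[OF prof(1)]] unfolding prof(3) .
  have i1: "integrable lebesgue (lift 1 (\<lambda>y. e y * F y) :: 'd heis \<Rightarrow> complex)"
    by (rule integrable_lift[OF prof(1) cont(1)])
  have i2: "integrable lebesgue (lift 1 (\<lambda>y. y *\<^sub>R (e y * F' y + e' y * F y)) :: 'd heis \<Rightarrow> complex)"
    by (rule integrable_lift[OF ann' cont(2)])
  have h: "lift 1 (\<lambda>y. e y * F y) p = complex_of_real (\<eta> (koranyi4 p) * hardy_density f p)" for p :: "'d heis"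
    by (simp add: lift_def e_def F_def q_def hardy_density_def scaleR_conv_of_real divide_inverse)
  show hi: "integrable lebesgue (\<lambda>p :: 'd heis. \<eta> (koranyi4 p) * hardy_density f p)"
    using i1 unfolding h by (rule complex_of_real_integrable_eq[THEN iffD1])
  define T where "T p = 8 * ?d * (\<eta> (koranyi4 p) * hardy_density f p)
      + 32 * \<eta> (koranyi4 p) * zsq p * Re (cnj (f (koranyi4 p)) * f' (koranyi4 p))
      + 16 * zsq p * \<eta>' (koranyi4 p) * (norm (f (koranyi4 p)))\<^sup>2" for p :: "'d heis"
  have T: "(8 * ?d + 16) *\<^sub>R lift 1 (\<lambda>y. e y * F y) p
      + 16 *\<^sub>R lift 1 (\<lambda>y. y *\<^sub>R (e y * F' y + e' y * F y)) p = complex_of_real (T p)" for p :: "'d heis"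
  proof (cases "koranyi4 p > 0")
    case True
    then have "koranyi4 p *\<^sub>R (e (koranyi4 p) * F' (koranyi4 p) + e' (koranyi4 p) * F (koranyi4 p))
        = complex_of_real (\<eta> (koranyi4 p) * (2 * Re (cnj (f (koranyi4 p)) * f' (koranyi4 p)))
          - \<eta> (koranyi4 p) * (norm (f (koranyi4 p)))\<^sup>2 / koranyi4 p + \<eta>' (koranyi4 p) * (norm (f (koranyi4 p)))\<^sup>2)"
      unfolding e_def e'_def F_def F'_def q_def q'_def scaleR_conv_of_real of_real_mult[symmetric]
        of_real_diff[symmetric] of_real_add[symmetric]
      by (intro arg_cong[where f = complex_of_real]) (simp add: field_simps power2_eq_square)
    then have X: "lift 1 (\<lambda>y. y *\<^sub>R (e y * F' y + e' y * F y)) p = complex_of_real (zsq p *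
        (\<eta> (koranyi4 p) * (2 * Re (cnj (f (koranyi4 p)) * f' (koranyi4 p)))
          - \<eta> (koranyi4 p) * (norm (f (koranyi4 p)))\<^sup>2 / koranyi4 p + \<eta>' (koranyi4 p) * (norm (f (koranyi4 p)))\<^sup>2))"
      unfolding lift_def by (simp only: power_one_right scaleR_conv_of_real of_real_mult)
    show ?thesis
      unfolding h X unfolding scaleR_conv_of_real of_real_mult[symmetric] of_real_add[symmetric]
      by (intro arg_cong[where f = complex_of_real] trans[OF _ T_def[symmetric]])
         (simp add: hardy_density_def algebra_simps add_divide_distrib)
  next
    case False
    then have "zsq p = 0" by (rule zsq_eq_0_if_koranyi4_nonpos)
    then show ?thesis by (simp add: lift_def T_def hardy_density_def)
  qed
  have iT: "integrable lebesgue (\<lambda>p. complex_of_real (T p))"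
    unfolding T[symmetric] by (intro Bochner_Integration.integrable_add integrable_scaleR_right i1 i2)
  then have iT': "integrable lebesgue T" by (rule complex_of_real_integrable_eq[THEN iffD1])
  have "(LINT p|lebesgue. complex_of_real (T p)) = 0"
    using koranyi4_divergence_identity[OF prof(1,2), of 0, where ?'d = 'd] unfolding prof(3) T[symmetric]
    by (simp only: Bochner_Integration.integral_add[OF integrable_scaleR_right[OF i1] integrable_scaleR_right[OF i2]]
        integral_scaleR_right add_0 of_nat_0 mult_zero_right add_0_right)
  then have T0: "(LINT p|lebesgue. T p) = 0" by simp
  have key: "4 * ?d * (\<eta> (koranyi4 p) * hardy_density f p) \<le>
      T p + (4 / ?d * energy_density f' p + 32 * sqrt (2 * m) / m * (norm (f (koranyi4 p)))\<^sup>2)" for p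
  proof (cases "koranyi4 p > 0")
    case True
    define n R A B where "n = koranyi4 p" and "R = zsq p" and "A = norm (f n)" and "B = norm (f' n)"
    have pos: "n > 0" "R \<ge> 0" "A \<ge> 0" "B \<ge> 0" using True by (auto simp: n_def R_def A_def B_def zsq_nonneg)
    have re: "- (A * B) \<le> Re (cnj (f n) * f' n)"
      using abs_Re_le_cmod[of "cnj (f n) * f' n"] by (simp add: A_def B_def norm_mult)
    have am: "32 * (A * B) \<le> 4 * ?d * (A\<^sup>2 / n) + 64 / ?d * (n * B\<^sup>2)"
    proof -
      \<comment> \<open>The weights are those for which the Hardy constant comes out as \<open>1/d\<^sup>2\<close>.\<close>
      have "0 \<le> (4 / (?d * n)) * (?d * A - 4 * n * B)\<^sup>2" using pos d by simp
      also have "\<dots> = 4 * ?d * (A\<^sup>2 / n) + 64 / ?d * (n * B\<^sup>2) - 32 * (A * B)"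
        using pos d by (simp add: field_simps power2_eq_square)
      finally show ?thesis by simp
    qed
    have t1: "- (\<eta> n * R * (4 * ?d * (A\<^sup>2 / n) + 64 / ?d * (n * B\<^sup>2))) \<le> 32 * \<eta> n * R * Re (cnj (f n) * f' n)"
    proof -
      have "\<eta> n * R * (- (4 * ?d * (A\<^sup>2 / n) + 64 / ?d * (n * B\<^sup>2))) \<le> \<eta> n * R * (32 * Re (cnj (f n) * f' n))"
        using am re pos(2) \<eta>(4)[of n] by (intro mult_left_mono) auto
      then show ?thesis by (simp add: algebra_simps)
    qed
    have t2: "\<eta> n * R * (64 / ?d * (n * B\<^sup>2)) \<le> 64 / ?d * (R * n * B\<^sup>2)"
    proof -
      have "\<eta> n * (64 / ?d * (R * n * B\<^sup>2)) \<le> 1 * (64 / ?d * (R * n * B\<^sup>2))"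
        using pos \<eta>(5)[of n] d by (intro mult_right_mono) auto
      then show ?thesis by (simp add: algebra_simps)
    qed
    have t3: "- \<eta>' n * R \<le> 2 * sqrt (2 * m) / m"
    proof (cases "n \<in> {m..2 * m}")
      case True
      have "R\<^sup>2 \<le> 2 * m" using zsq_squared_le_koranyi4[of p] True by (simp add: n_def R_def)
      then have "R \<le> sqrt (2 * m)" by (rule real_le_rsqrt)
      have "- \<eta>' n * R \<le> 2 / m * R" using m(2)[of n] True pos(2) by (intro mult_right_mono) auto
      also have "\<dots> \<le> 2 / m * sqrt (2 * m)" using \<open>R \<le> sqrt (2 * m)\<close> m(1) by (intro mult_left_mono) auto
      finally show ?thesis by simp
    next
      case False
      then have "- \<eta>' n \<le> 0" using m(2)[of n] by simp
      then have "- \<eta>' n * R \<le> 0" using pos(2) by (simp add: mult_nonneg_nonneg)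
      also have "0 \<le> 2 * sqrt (2 * m) / m" using m(1) by simp
      finally show ?thesis .
    qed
    have t4: "- (16 * R * \<eta>' n * A\<^sup>2) \<le> 32 * sqrt (2 * m) / m * A\<^sup>2"
      using mult_right_mono[OF t3, of "16 * A\<^sup>2"] by (simp add: algebra_simps)
    have expand: "T p = 8 * ?d * (\<eta> n * (R / n * A\<^sup>2)) + 32 * \<eta> n * R * Re (cnj (f n) * f' n) + 16 * R * \<eta>' n * A\<^sup>2"
      by (simp add: T_def hardy_density_def n_def R_def A_def)
    have "\<eta> n * R * (4 * ?d * (A\<^sup>2 / n) + 64 / ?d * (n * B\<^sup>2)) = 4 * ?d * (\<eta> n * (R / n * A\<^sup>2)) + \<eta> n * R * (64 / ?d * (n * B\<^sup>2))"
      by (simp add: algebra_simps)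
    note split = this
    have arith: "x \<le> 2 * x + v + t + (w + z)" if "P = x + y" "- P \<le> v" "y \<le> w" "- t \<le> z" for P v w x y z t :: real
      using that by linarith
    have "4 * ?d * (\<eta> n * (R / n * A\<^sup>2)) \<le> T p + (64 / ?d * (R * n * B\<^sup>2) + 32 * sqrt (2 * m) / m * A\<^sup>2)"
      using arith[OF split t1 t2 t4] unfolding expand by (simp only: mult.assoc[symmetric])
    then show ?thesis
      by (simp add: hardy_density_def energy_density_def n_def R_def A_def B_def mult_ac)
  next
    case False
    then have "zsq p = 0" by (rule zsq_eq_0_if_koranyi4_nonpos)
    then show ?thesis using m(1) by (simp add: T_def hardy_density_def energy_density_def)
  qed
  have "(LINT p|lebesgue. 4 * ?d * (\<eta> (koranyi4 p) * hardy_density f (p :: 'd heis)))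
      \<le> (LINT p|lebesgue. T p + (4 / ?d * energy_density f' p + 32 * sqrt (2 * m) / m * (norm (f (koranyi4 p)))\<^sup>2))"
    by (intro integral_mono key integrable_mult_right hi Bochner_Integration.integrable_add iT' energy L2)
  also have "\<dots> = 4 / ?d * (LINT p|lebesgue. energy_density f' (p :: 'd heis))
      + 32 * sqrt (2 * m) / m * (LINT p|lebesgue. (norm (f (koranyi4 (p :: 'd heis))))\<^sup>2)"
    by (simp only: Bochner_Integration.integral_add[OF iT' Bochner_Integration.integrable_add[OF integrable_mult_right[OF energy] integrable_mult_right[OF L2]]]
        Bochner_Integration.integral_add[OF integrable_mult_right[OF energy] integrable_mult_right[OF L2]]
        integral_mult_right_zero T0 add_0)
  finally show "4 * ?d * (LINT p|lebesgue. \<eta> (koranyi4 p) * hardy_density f (p :: 'd heis))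
           \<le> 4 / ?d * (LINT p|lebesgue. energy_density f' (p :: 'd heis))
             + 32 * sqrt (2 * m) / m * (LINT p|lebesgue. (norm (f (koranyi4 (p :: 'd heis))))\<^sup>2)"
    by (simp only: integral_mult_right_zero)
qed

lemma eventually_inside_annulus:
  fixes y :: real
  assumes "y > 0"
  shows "\<forall>\<^sub>F n in sequentially. 2 / real (Suc n) < y \<and> y < real (Suc n)"
proof -
  obtain n0 where n0: "real n0 > max (2 / y) y" using reals_Archimedean2 by blast
  show ?thesis
  proof (rule eventually_sequentiallyI[of n0])
    fix n assume "n0 \<le> n"
    then have "real (Suc n) > 2 / y" "real (Suc n) > y" using n0 by auto
    then show "2 / real (Suc n) < y \<and> y < real (Suc n)" using \<open>y > 0\<close> by (simp add: field_simps del: of_nat_Suc)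
  qed
qed

text \<open>
  The limit of \<open>hardy_integral_cutoff\<close> by Fatou's lemma, which yields integrability of the
  left-hand side at the same time.
\<close>

lemma hardy_inequality_radial:
  fixes f f' :: "real \<Rightarrow> complex"
  assumes f: "\<And>y. y > 0 \<Longrightarrow> (f has_vector_derivative f' y) (at y)" "continuous_on {0<..} f'"
    and L2: "integrable lebesgue (\<lambda>p :: 'd::finite heis. (norm (f (koranyi4 p)))\<^sup>2)"
    and energy: "integrable lebesgue (energy_density f' :: 'd heis \<Rightarrow> real)"
  shows "integrable lebesgue (hardy_density f :: 'd heis \<Rightarrow> real)"
    and "(LINT p|lebesgue. hardy_density f (p :: 'd heis))
           \<le> (LINT p|lebesgue. energy_density f' (p :: 'd heis)) / (real CARD('d))\<^sup>2"
proof -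
  let ?d = "real CARD('d)"
  let ?E = "LINT p|lebesgue. energy_density f' (p :: 'd heis)"
  let ?U = "LINT p|lebesgue. (norm (f (koranyi4 (p :: 'd heis))))\<^sup>2"
  have d: "?d > 0" by simp
  have E0: "?E \<ge> 0" by (intro integral_nonneg_AE AE_I2 energy_density_nonneg)
  obtain \<eta> \<eta>' :: "nat \<Rightarrow> real \<Rightarrow> real" where \<eta>:
    "\<And>n y. (\<eta> n has_real_derivative \<eta>' n y) (at y)" "\<And>n. continuous_on UNIV (\<eta>' n)"
    "\<And>n y. 0 \<le> \<eta> n y" "\<And>n y. \<eta> n y \<le> 1" "\<And>n. annular (\<eta> n)"
    "\<And>n y. 2 / real (Suc n) \<le> y \<Longrightarrow> y \<le> real (Suc n) \<Longrightarrow> \<eta> n y = 1 \<and> \<eta>' n y = 0"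
    "\<And>n y. - \<eta>' n y \<le> 2 / real (Suc n) * indicat_real {real (Suc n)..2 * real (Suc n)} y"
    by (rule ex_cutoffs) blast
  define s where "s n p = \<eta> n (koranyi4 p) * hardy_density f p" for n and p :: "'d heis"
  define \<epsilon> where "\<epsilon> n = 32 * sqrt (2 * real (Suc n)) / real (Suc n)" for n
  have int: "integrable lebesgue (s n)"
    and le: "4 * ?d * (LINT p|lebesgue. s n p) \<le> 4 / ?d * ?E + \<epsilon> n * ?U" for n
  proof -
    have m: "real (Suc n) > 0" by simp
    show "integrable lebesgue (s n)"
      unfolding s_def
      by (rule hardy_integral_cutoff(1)[OF _ f(2) L2 energy \<eta>(5,1,2,3,4) m \<eta>(7)]) (rule f(1))
    show "4 * ?d * (LINT p|lebesgue. s n p) \<le> 4 / ?d * ?E + \<epsilon> n * ?U"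
      unfolding s_def \<epsilon>_def
      by (rule hardy_integral_cutoff(2)[OF _ f(2) L2 energy \<eta>(5,1,2,3,4) m \<eta>(7)]) (rule f(1))
  qed
  have \<epsilon>: "\<epsilon> \<longlonglongrightarrow> 0"
  proof -
    have "32 * sqrt (2 * x) / x = 32 * sqrt 2 * sqrt (inverse x)" if "x > 0" for x
    proof -
      obtain y where "x = y * y" "y > 0" using \<open>x > 0\<close> real_sqrt_mult_self[of x] by (metis abs_of_pos real_sqrt_gt_zero)
      then show ?thesis by (simp add: real_sqrt_mult real_sqrt_inverse divide_inverse)
    qed
    then have "\<epsilon> = (\<lambda>n. 32 * sqrt 2 * sqrt (inverse (real (Suc n))))"
      unfolding \<epsilon>_def by (simp del: of_nat_Suc add: fun_eq_iff)
    moreover have "(\<lambda>n. 32 * sqrt 2 * sqrt (inverse (real (Suc n)))) \<longlonglongrightarrow> 32 * sqrt 2 * sqrt 0"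
      by (intro tendsto_intros LIMSEQ_inverse_real_of_nat)
    ultimately show ?thesis by (simp only: real_sqrt_zero mult_zero_right)
  qed
  define a where "a n = ?E / ?d\<^sup>2 + \<epsilon> n * ?U / (4 * ?d)" for n
  have le': "(LINT p|lebesgue. s n p) \<le> a n" for n
  proof -
    have "(LINT p|lebesgue. s n p) \<le> (4 / ?d * ?E + \<epsilon> n * ?U) / (4 * ?d)"
      using le[of n] d by (simp add: pos_le_divide_eq mult.commute)
    also have "\<dots> = a n" unfolding a_def using d by (simp add: field_simps power2_eq_square)
    finally show ?thesis .
  qed
  have "a \<longlonglongrightarrow> ?E / ?d\<^sup>2 + 0 * ?U / (4 * ?d)"
    unfolding a_def by (intro tendsto_intros \<epsilon>) simp
  then have a: "a \<longlonglongrightarrow> ?E / ?d\<^sup>2" by simp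
  have s0: "0 \<le> s n p" for n p unfolding s_def by (intro mult_nonneg_nonneg \<eta>(3) hardy_density_nonneg)
  have lim: "AE p in lebesgue. (\<lambda>n. s n p) \<longlonglongrightarrow> hardy_density f p"
    using AE_koranyi4_pos
  proof eventually_elim
    case (elim p)
    have "\<forall>\<^sub>F n in sequentially. s n p = hardy_density f p"
      using eventually_inside_annulus[OF elim]
    proof (rule eventually_mono)
      fix n assume "2 / real (Suc n) < koranyi4 p \<and> koranyi4 p < real (Suc n)"
      then have "\<eta> n (koranyi4 p) = 1" using \<eta>(6)[of n "koranyi4 p"] by linarith
      then show "s n p = hardy_density f p" by (simp add: s_def)
    qed
    then show ?case by (rule tendsto_eventually)
  qed
  have meas: "hardy_density f \<in> borel_measurable (lebesgue :: 'd heis measure)"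
  proof -
    have "continuous_on {0<..} f"
      by (rule continuous_on_vector_derivative[OF has_vector_derivative_at_within[OF f(1)]]) simp
    then show ?thesis unfolding hardy_density_def[abs_def]
      by (intro borel_measurable_times borel_measurable_divide borel_measurable_zsq borel_measurable_koranyi4
          borel_measurable_power measurable_compose[OF borel_measurable_profile borel_measurable_norm])
  qed
  have "(\<integral>\<^sup>+p. ennreal (hardy_density f p) \<partial>(lebesgue :: 'd heis measure))
      = (\<integral>\<^sup>+p. liminf (\<lambda>n. ennreal (s n p)) \<partial>lebesgue)"
  proof (rule nn_integral_cong_AE)
    show "AE p in lebesgue. ennreal (hardy_density f p) = liminf (\<lambda>n. ennreal (s n p))"
      using lim
    proof eventually_elim
      case (elim p)
      then have "(\<lambda>n. ennreal (s n p)) \<longlonglongrightarrow> ennreal (hardy_density f p)" by (rule tendsto_ennrealI)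
      then show ?case by (rule lim_imp_Liminf[OF sequentially_bot, symmetric])
    qed
  qed
  also have "\<dots> \<le> liminf (\<lambda>n. \<integral>\<^sup>+p. ennreal (s n p) \<partial>lebesgue)"
  proof (rule nn_integral_liminf)
    show "(\<lambda>p. ennreal (s n p)) \<in> borel_measurable lebesgue" for n
      by (intro measurable_compose[OF borel_measurable_integrable[OF int] measurable_ennreal])
  qed
  also have "\<dots> \<le> liminf (\<lambda>n. ennreal (a n))"
  proof (rule Liminf_mono, rule always_eventually, rule allI)
    fix n
    have "(\<integral>\<^sup>+p. ennreal (s n p) \<partial>lebesgue) = ennreal (LINT p|lebesgue. s n p)"
      by (rule nn_integral_eq_integral[OF int]) (simp add: s0)
    also have "\<dots> \<le> ennreal (a n)" by (rule ennreal_leI[OF le'])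
    finally show "(\<integral>\<^sup>+p. ennreal (s n p) \<partial>lebesgue) \<le> ennreal (a n)" .
  qed
  also have "\<dots> = ennreal (?E / ?d\<^sup>2)"
    by (rule lim_imp_Liminf[OF sequentially_bot tendsto_ennrealI[OF a]])
  finally have nn: "(\<integral>\<^sup>+p. ennreal (hardy_density f p) \<partial>(lebesgue :: 'd heis measure)) \<le> ennreal (?E / ?d\<^sup>2)" .
  show I: "integrable lebesgue (hardy_density f :: 'd heis \<Rightarrow> real)"
    by (rule integrableI_nonneg[OF meas]) (use nn in \<open>auto simp: hardy_density_nonneg le_less_trans\<close>)
  have "ennreal (LINT p|lebesgue. hardy_density f (p :: 'd heis)) \<le> ennreal (?E / ?d\<^sup>2)"
    using nn nn_integral_eq_integral[OF I] by (simp add: hardy_density_nonneg)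
  then show "(LINT p|lebesgue. hardy_density f (p :: 'd heis)) \<le> ?E / ?d\<^sup>2"
    using E0 by (subst (asm) ennreal_le_iff) auto
qed

section \<open>The multiplier argument\<close>

text \<open>
  Each competitor in \<open>K\<^sub>d(\<delta>)\<close> is at least \<open>x + \<surd>(x\<^sup>2)\<close> with \<open>x = (8d + 2 + \<gamma> \<surd>\<delta>)/(4d) \<ge> 2\<close>.
\<close>

lemma kappa_lower_bound:
  assumes "d > 0" shows "4 / real d \<le> kappa d"
  unfolding kappa_def
proof (rule cINF_greatest)
  fix \<delta> :: real assume \<delta>: "\<delta> \<in> {0<..}"
  have "4 \<le> K_const d \<delta>"
    unfolding K_const_def
  proof (rule cINF_greatest)
    fix \<gamma> :: real assume \<gamma>: "\<gamma> \<in> {0<..}"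
    define x where "x = (8 * real d + 2 + \<gamma> * sqrt \<delta>) / (4 * real d)"
    have pos: "0 \<le> \<gamma> * sqrt \<delta>" "0 \<le> sqrt \<delta> / (2 * \<gamma>)" using \<gamma> \<delta> by auto
    then have x: "2 \<le> x" using assms by (simp add: x_def field_simps)
    have "(8 * real d + 2 + \<gamma> * sqrt \<delta>)\<^sup>2 / (16 * (real d)\<^sup>2) = x\<^sup>2"
      by (simp add: x_def power_divide power_mult_distrib)
    then have "x \<le> sqrt ((8 * real d + 2 + \<gamma> * sqrt \<delta>)\<^sup>2 / (16 * (real d)\<^sup>2) + sqrt \<delta> / (2 * \<gamma>))"
      using pos x by (intro real_le_rsqrt) simp
    then show "4 \<le> (8 * real d + 2 + \<gamma> * sqrt \<delta>) / (4 * real d) +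
        sqrt ((8 * real d + 2 + \<gamma> * sqrt \<delta>)\<^sup>2 / (16 * (real d)\<^sup>2) + sqrt \<delta> / (2 * \<gamma>))"
      using x unfolding x_def[symmetric] by linarith
  qed simp
  then have "4 / real d \<le> K_const d \<delta> / real d" by (intro divide_right_mono) auto
  then show "4 / real d \<le> max ((1 + 1 / \<delta>) / (real d)\<^sup>2) (K_const d \<delta> / real d)" by simp
qed simp

text \<open>
  On an annulus \<open>R/N\<close> is bounded, so \<open>|V u| \<le> (N/R) |V|\<^sup>2 |u|\<^sup>2 + R/N\<close> is integrable there.
\<close>

lemma potential_annulus_integrable:
  fixes V u :: "'d::finite heis \<Rightarrow> complex"
  assumes V: "V \<in> borel_measurable lebesgue" and u: "u \<in> L2"
    and W: "integrable lebesgue (\<lambda>p. koranyi4 p / zsq p * (norm (V p))\<^sup>2 * (norm (u p))\<^sup>2)"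
  shows "annulus_integrable (\<lambda>p. (V p - ev) * u p)"
proof (rule annulus_integrableI)
  have um: "u \<in> borel_measurable lebesgue" and u2: "integrable lebesgue (\<lambda>p. (norm (u p))\<^sup>2)"
    using u by (simp_all add: L2_def)
  show "(\<lambda>p. (V p - ev) * u p) \<in> borel_measurable lebesgue" using V um by measurable
  fix a b :: real assume a: "0 < a"
  let ?W = "\<lambda>p. koranyi4 p / zsq p * (norm (V p))\<^sup>2 * (norm (u p))\<^sup>2
      + (((1 + \<bar>b\<bar>) / a + norm ev) * indicat_real {a..b} (koranyi4 p) + norm ev * (norm (u p))\<^sup>2)"
  have "integrable lebesgue ?W"
    by (intro Bochner_Integration.integrable_add W integrable_mult_right integrable_annulus_indicator u2)
  moreover have "AE p in lebesgue. koranyi4 p \<in> {a..b} \<longrightarrow> norm ((V p - ev) * u p) \<le> ?W p"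
    using AE_zsq_pos
  proof eventually_elim
    case (elim p)
    show ?case
    proof
      assume p: "koranyi4 p \<in> {a..b}"
      define n R A B where "n = koranyi4 p" and "R = zsq p" and "A = norm (V p)" and "B = norm (u p)"
      have pos: "n > 0" "R > 0" "A \<ge> 0" "B \<ge> 0" using p a elim by (auto simp: n_def R_def A_def B_def)
      have "R * R \<le> koranyi4 p" using zsq_squared_le_koranyi4[of p] by (simp add: R_def power2_eq_square)
      also have "\<dots> \<le> \<bar>b\<bar>" using p by auto
      finally have "R * R \<le> \<bar>b\<bar>" .
      moreover have "R \<le> 1 + R * R"
        using mult_left_mono[of 1 R R] mult_nonneg_nonneg[of R R] pos(2) by (cases "R \<le> 1") linarith+
      ultimately have "R \<le> 1 + \<bar>b\<bar>" by linarith
      then have Rn: "R / n \<le> (1 + \<bar>b\<bar>) / a" using p a pos by (intro frac_le) (auto simp: n_def)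
      have "0 \<le> (n * (A * B) - R)\<^sup>2 / (R * n)" using pos by simp
      also have "\<dots> = n / R * A\<^sup>2 * B\<^sup>2 + R / n - 2 * (A * B)" using pos by (simp add: field_simps power2_eq_square)
      finally have "2 * (A * B) \<le> n / R * A\<^sup>2 * B\<^sup>2 + R / n" by simp
      then have AB: "A * B \<le> n / R * A\<^sup>2 * B\<^sup>2 + (1 + \<bar>b\<bar>) / a"
        using Rn mult_nonneg_nonneg[OF pos(3,4)] by linarith
      have "0 \<le> (B - 1)\<^sup>2" by simp
      then have "2 * B \<le> 1 + B\<^sup>2" by (simp add: power2_eq_square algebra_simps)
      then have "B \<le> 1 + B\<^sup>2" using pos(4) by linarith
      then have B: "norm ev * B \<le> norm ev + norm ev * B\<^sup>2"
        using mult_left_mono[of B "1 + B\<^sup>2" "norm ev"] by (simp add: distrib_left)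
      have "norm ((V p - ev) * u p) \<le> A * B + norm ev * B"
        unfolding norm_mult A_def B_def distrib_right[symmetric] by (intro mult_right_mono norm_triangle_ineq4) simp
      then show "norm ((V p - ev) * u p) \<le> ?W p"
        using AB B p unfolding n_def R_def A_def B_def by (simp add: distrib_right)
    qed
  qed
  moreover have "AE p in lebesgue. 0 \<le> ?W p"
    using a by (intro AE_I2 add_nonneg_nonneg mult_nonneg_nonneg divide_nonneg_nonneg) (auto simp: koranyi4_nonneg zsq_nonneg)
  ultimately show "\<exists>W. integrable lebesgue W \<and>
      (AE p in lebesgue. koranyi4 p \<in> {a..b} \<longrightarrow> norm ((V p - ev) * u p) \<le> W p) \<and> (AE p in lebesgue. 0 \<le> W p)"
    by blast
qed

lemma radial_dirichlet_energy:
  fixes u :: "'d::finite heis \<Rightarrow> complex"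
  assumes u: "u \<in> H1" and grad: "\<And>k. AE p in lebesgue. weak_deriv k u p = d_koranyi4 k p *\<^sub>R f' (koranyi4 p)"
    and f': "continuous_on {0<..} f'"
  shows "integrable lebesgue (energy_density f' :: 'd heis \<Rightarrow> real)"
    and "dirichlet_energy u = (LINT p|lebesgue. energy_density f' (p :: 'd heis))"
proof -
  have all: "AE p in lebesgue. \<forall>k\<in>UNIV. weak_deriv k u p = d_koranyi4 k p *\<^sub>R f' (koranyi4 p)"
    by (rule AE_finite_allI) (simp_all add: grad)
  have norm2: "(norm (hgrad u p))\<^sup>2 = (\<Sum>k\<in>UNIV. (norm (weak_deriv k u p))\<^sup>2)" for p
    by (simp add: hgrad_def norm_vec_def L2_set_def sum_nonneg)
  have ae: "AE p in lebesgue. (norm (hgrad u p))\<^sup>2 = energy_density f' p"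
    using all
  proof eventually_elim
    case (elim p)
    then have "(norm (hgrad u p))\<^sup>2 = (\<Sum>k\<in>UNIV. (d_koranyi4 k p)\<^sup>2) * (norm (f' (koranyi4 p)))\<^sup>2"
      unfolding norm2 sum_distrib_right by (intro sum.cong) (simp_all add: power_mult_distrib)
    then show ?case unfolding gradient_products energy_density_def .
  qed
  have int: "integrable lebesgue (\<lambda>p. (norm (hgrad u p))\<^sup>2)"
    unfolding norm2
  proof (rule Bochner_Integration.integrable_sum)
    show "integrable lebesgue (\<lambda>p. (norm (weak_deriv k u p))\<^sup>2)" for k
      using weak_deriv_spec(1)[OF u, of k] by (simp add: L2_def)
  qed
  have meas: "energy_density f' \<in> borel_measurable (lebesgue :: 'd heis measure)"
    unfolding energy_density_def[abs_def]
    by (intro borel_measurable_times borel_measurable_const borel_measurable_zsq borel_measurable_koranyi4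
        borel_measurable_power measurable_compose[OF borel_measurable_profile[OF f'] borel_measurable_norm])
  show "integrable lebesgue (energy_density f' :: 'd heis \<Rightarrow> real)"
    by (rule integrable_cong_AE_imp[OF int meas ae])
  show "dirichlet_energy u = (LINT p|lebesgue. energy_density f' (p :: 'd heis))"
    unfolding dirichlet_energy_def
    by (rule integral_cong_AE[OF borel_measurable_integrable[OF int] meas ae])
qed

text \<open>
  The equation tested against \<open>v = (R\<^sup>2/N - d/(d+1)) \<eta>(N) f(N)\<close>. Because \<open>\<nabla>N\<close> is orthogonal to the
  gradient of \<open>R\<^sup>2/N\<close>, only the derivative of \<open>\<eta> f\<close> contributes to \<open>\<nabla>v \<sqdot> \<nabla>u\<close>, with the factor
  \<open>R\<^sup>2/N - d/(d+1)\<close>. Averaging this factor over spheres with the weight \<open>R\<close> gives \<open>(d+1)/(d+2) -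
  d/(d+1) = 1/((d+1)(d+2))\<close>, while without weight the average is zero and removes the eigenvalue.
\<close>

lemma multiplier_test:
  fixes u V :: "'d::finite heis \<Rightarrow> complex" and f f' :: "real \<Rightarrow> complex" and \<eta> \<eta>' :: "real \<Rightarrow> real"
  defines "d \<equiv> real CARD('d)"
  defines "c0 \<equiv> d / (d + 1)"
  assumes sol: "weak_solution V ev u" and V: "V \<in> borel_measurable lebesgue"
    and u: "AE p in lebesgue. u p = f (koranyi4 p)"
    and f: "\<And>y. y > 0 \<Longrightarrow> (f has_vector_derivative f' y) (at y)" "continuous_on {0<..} f'"
    and grad: "\<And>k. AE p in lebesgue. weak_deriv k u p = d_koranyi4 k p *\<^sub>R f' (koranyi4 p)"
    and \<eta>: "annular \<eta>" "\<And>y. (\<eta> has_real_derivative \<eta>' y) (at y)" "continuous_on UNIV \<eta>'"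
  shows "integrable lebesgue (\<lambda>p. complex_of_real (16 * koranyi4 p * zsq p) *
              (cnj (\<eta> (koranyi4 p) *\<^sub>R f' (koranyi4 p) + \<eta>' (koranyi4 p) *\<^sub>R f (koranyi4 p)) * f' (koranyi4 (p :: 'd heis))))"
    and "norm (LINT p|lebesgue. complex_of_real (16 * koranyi4 p * zsq p) *
              (cnj (\<eta> (koranyi4 p) *\<^sub>R f' (koranyi4 p) + \<eta>' (koranyi4 p) *\<^sub>R f (koranyi4 p)) * f' (koranyi4 (p :: 'd heis))))
           / ((d + 1) * (d + 2))
         \<le> (LINT p|lebesgue. norm (((zsq p)\<^sup>2 / koranyi4 p - c0) * \<eta> (koranyi4 p)) * norm (f (koranyi4 p)) * (norm (V p) * norm (u p)))"
proof -
  have uH: "u \<in> H1" using sol by (simp add: weak_solution_def)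
  then have um: "u \<in> borel_measurable lebesgue" by (simp add: H1_def L2_def)
  have d: "d > 0" by (simp add: d_def)
  have fc: "continuous_on {0<..} f"
    by (rule continuous_on_vector_derivative[OF has_vector_derivative_at_within[OF f(1)]]) simp
  define e e' where "e y = complex_of_real (\<eta> y)" and "e' y = complex_of_real (\<eta>' y)" for y
  have e: "annular e" "(e has_vector_derivative e' y) (at y)" "continuous_on UNIV e'" for y
  proof -
    show "annular e" by (rule annular_mono[OF \<eta>(1)]) (simp add: e_def)
    show "(e has_vector_derivative e' y) (at y)"
      unfolding e_def e'_def by (rule has_vector_derivative_of_real[OF \<eta>(2)])
    show "continuous_on UNIV e'" unfolding e'_def by (intro continuous_on_of_real \<eta>(3))
  qed
  \<comment> \<open>With \<open>g(y) = f(y)/y\<close> the singular product \<open>(R\<^sup>2/N) f(N)\<close> takes the form \<open>R\<^sup>2 g(N)\<close>.\<close>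
  define g g' where "g y = inverse y *\<^sub>R f y" and "g' y = inverse y *\<^sub>R f' y - (inverse y)\<^sup>2 *\<^sub>R f y" for y
  have g: "(g has_vector_derivative g' y) (at y)" if "y > 0" for y
    unfolding g_def g'_def by (rule inverse_profile(1)[OF _ f(2) that]) (rule f(1))
  have g'c: "continuous_on {0<..} g'"
    unfolding g'_def by (rule inverse_profile(2)[OF _ f(2)]) (rule f(1))
  define \<Phi> where "\<Phi> y = e y * f y" for y
  define \<Gamma> where "\<Gamma> y = e y * g y" for y
  define \<Phi>' where "\<Phi>' y = e y * f' y + e' y * f y" for y
  have \<Phi>: "annular \<Phi>" "Ck 1 \<Phi>" "vector_derivative \<Phi> (at y) = \<Phi>' y" for y
    unfolding \<Phi>_def \<Phi>'_def by (rule annular_profile_mult[OF e _ f(2)], rule f(1), assumption)+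
  have \<Gamma>: "annular \<Gamma>" "Ck 1 \<Gamma>" "vector_derivative \<Gamma> (at y) = e y * g' y + e' y * g y" for y
    unfolding \<Gamma>_def by (rule annular_profile_mult[OF e _ g'c], rule g, assumption)+
  define v :: "'d heis \<Rightarrow> complex" where "v p = lift 2 \<Gamma> p - c0 *\<^sub>R lift 0 \<Phi> p" for p
  have v: "Ck 1 v" "bounded {p. v p \<noteq> 0}"
  proof -
    show "Ck 1 v" unfolding v_def by (intro Ck_diff Ck_scaleR Ck_const Ck_lift \<Gamma>(2) \<Phi>(2))
    have "bounded ({p. lift 2 \<Gamma> p \<noteq> 0} \<union> {p. lift 0 \<Phi> p \<noteq> 0} :: 'd heis set)"
      unfolding bounded_Un by (intro conjI bounded_support_lift \<Gamma>(1) \<Phi>(1))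
    then show "bounded {p. v p \<noteq> 0}" by (rule bounded_subset) (auto simp: v_def)
  qed
  have v_eq: "v p = complex_of_real (((zsq p)\<^sup>2 / koranyi4 p - c0) * \<eta> (koranyi4 p)) * f (koranyi4 p)" for p
    by (simp add: v_def lift_def \<Gamma>_def \<Phi>_def g_def e_def scaleR_conv_of_real divide_inverse algebra_simps)
  have X: "field_deriv k v p = field_deriv k (lift 2 \<Gamma>) p - c0 *\<^sub>R field_deriv k (lift 0 \<Phi>) p" for k p
  proof -
    have "(lift 2 \<Gamma> has_derivative frechet_derivative (lift 2 \<Gamma> :: 'd heis \<Rightarrow> complex) (at p)) (at p)"
      "(lift 0 \<Phi> has_derivative frechet_derivative (lift 0 \<Phi> :: 'd heis \<Rightarrow> complex) (at p)) (at p)"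
      by (intro Ck_Suc_has_derivative[where n = 0], fold One_nat_def, rule Ck_lift, rule \<Gamma>(2) \<Phi>(2))+
    from field_deriv_eq[OF has_derivative_diff[OF this(1) has_derivative_scaleR_right[OF this(2)]]]
    show ?thesis unfolding v_def[abs_def] field_deriv_def .
  qed
  have sum_X: "(\<Sum>k\<in>UNIV. d_koranyi4 k p *\<^sub>R field_deriv k v p)
      = 16 *\<^sub>R (lift 3 \<Phi>' p - c0 *\<^sub>R lift 1 (\<lambda>y. y *\<^sub>R \<Phi>' y) p)" for p :: "'d heis"
  proof -
    have "(\<Sum>k\<in>UNIV. d_koranyi4 k p *\<^sub>R field_deriv k v p)
        = (\<Sum>k\<in>UNIV. d_koranyi4 k p *\<^sub>R field_deriv k (lift 2 \<Gamma>) p) - c0 *\<^sub>R (\<Sum>k\<in>UNIV. d_koranyi4 k p *\<^sub>R field_deriv k (lift 0 \<Phi>) p)"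
      unfolding X by (simp add: scaleR_diff_right sum_subtractf scaleR_sum_right mult.commute)
    also have "\<dots> = 16 *\<^sub>R (lift 3 \<Gamma> p + lift 3 (\<lambda>y. y *\<^sub>R (e y * g' y + e' y * g y)) p)
        - c0 *\<^sub>R 16 *\<^sub>R lift 1 (\<lambda>y. y *\<^sub>R \<Phi>' y) p"
      unfolding sum_field_deriv_lift(2)[OF \<Gamma>(2)] sum_field_deriv_lift(2)[OF \<Phi>(2)] \<Gamma>(3) \<Phi>(3)
      by (simp add: scaleR_add_right)
    \<comment> \<open>The orthogonality of \<open>\<nabla>N\<close> and \<open>\<nabla>(R\<^sup>2/N)\<close>: the undifferentiated term cancels the one from \<open>1/y\<close>.\<close>
    also have "lift 3 \<Gamma> p + lift 3 (\<lambda>y. y *\<^sub>R (e y * g' y + e' y * g y)) p = lift 3 \<Phi>' p"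
    proof (cases "koranyi4 p > 0")
      case True
      then have "\<Gamma> (koranyi4 p) + koranyi4 p *\<^sub>R (e (koranyi4 p) * g' (koranyi4 p) + e' (koranyi4 p) * g (koranyi4 p)) = \<Phi>' (koranyi4 p)"
        unfolding \<Gamma>_def \<Phi>'_def g_def g'_def scaleR_conv_of_real by (simp add: field_simps power2_eq_square)
      then show ?thesis unfolding lift_def scaleR_add_right[symmetric] by simp
    next
      case False
      then have "zsq p = 0" by (rule zsq_eq_0_if_koranyi4_nonpos)
      then show ?thesis by (simp add: lift_def)
    qed
    finally show ?thesis by (simp add: scaleR_diff_right mult.commute)
  qed
  note vH1 = C1_weak_deriv[OF v]
  define \<Psi> where "\<Psi> y = cnj (\<Phi>' y) * f' y" for y
  have \<Phi>'_ann: "annular \<Phi>'" "continuous_on UNIV \<Phi>'"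
    using annular_derivative[OF \<Phi>(1)] Ck_imp_continuous[OF Ck_vector_derivative[OF \<Phi>(2)[unfolded One_nat_def]]]
    unfolding \<Phi>(3) by blast+
  have \<Psi>: "annular \<Psi>" "continuous_on UNIV \<Psi>"
  proof -
    show "annular \<Psi>" by (rule annular_mono[OF \<Phi>'_ann(1)]) (simp add: \<Psi>_def)
    show "continuous_on UNIV \<Psi>" unfolding \<Psi>_def
      by (intro annular_mult_continuous f(2) continuous_on_cnj \<Phi>'_ann(2) annular_mono[OF \<Phi>'_ann(1)]) simp
  qed
  have y\<Psi>: "annular (\<lambda>y. y *\<^sub>R \<Psi> y)" "continuous_on UNIV (\<lambda>y. y *\<^sub>R \<Psi> y)"
    by (rule annular_mult_id[OF \<Psi>(1)], rule continuous_on_scaleR[OF continuous_on_id \<Psi>(2)])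
  have i3: "integrable lebesgue (lift 3 \<Psi> :: 'd heis \<Rightarrow> complex)" by (rule integrable_lift[OF \<Psi>])
  have i1: "integrable lebesgue (lift 1 (\<lambda>y. y *\<^sub>R \<Psi> y) :: 'd heis \<Rightarrow> complex)" by (rule integrable_lift[OF y\<Psi>])
  let ?I = "LINT p|lebesgue. lift 1 (\<lambda>y. y *\<^sub>R \<Psi> y) (p :: 'd heis)"
  have "AE p in lebesgue. \<forall>k\<in>UNIV. weak_deriv k v p = field_deriv k v p \<and> weak_deriv k u p = d_koranyi4 k p *\<^sub>R f' (koranyi4 p)"
    by (rule AE_finite_allI) (auto intro: AE_conjI vH1(2) grad)
  then have ae: "AE p in lebesgue. (\<Sum>k\<in>UNIV. cnj (hgrad v p $ k) * hgrad u p $ k)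
      = 16 *\<^sub>R lift 3 \<Psi> p - (16 * c0) *\<^sub>R lift 1 (\<lambda>y. y *\<^sub>R \<Psi> y) p"
  proof eventually_elim
    case (elim p)
    then have "(\<Sum>k\<in>UNIV. cnj (hgrad v p $ k) * hgrad u p $ k)
        = cnj (\<Sum>k\<in>UNIV. d_koranyi4 k p *\<^sub>R field_deriv k v p) * f' (koranyi4 p)"
      unfolding hgrad_def cnj_sum sum_distrib_right by (intro sum.cong) (simp_all add: mult_ac)
    then show ?case unfolding sum_X by (simp add: lift_def \<Psi>_def scaleR_conv_of_real algebra_simps)
  qed
  have "hgrad_inner v u = (LINT p|lebesgue. 16 *\<^sub>R lift 3 \<Psi> (p :: 'd heis) - (16 * c0) *\<^sub>R lift 1 (\<lambda>y. y *\<^sub>R \<Psi> y) p)"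
    unfolding hgrad_inner_def
  proof (rule integral_cong_AE[OF _ _ ae])
    show "(\<lambda>p. \<Sum>k\<in>UNIV. cnj (hgrad v p $ k) * hgrad u p $ k) \<in> borel_measurable lebesgue"
    proof (rule borel_measurable_sum)
      fix k :: "'d + 'd"
      have "(\<lambda>p. cnj (weak_deriv k v p)) \<in> borel_measurable lebesgue"
        by (rule measurable_compose[OF borel_measurable_weak_deriv[OF vH1(1)]])
           (intro borel_measurable_continuous_onI continuous_intros)
      then show "(\<lambda>p. cnj (hgrad v p $ k) * hgrad u p $ k) \<in> borel_measurable lebesgue"
        unfolding hgrad_def using borel_measurable_weak_deriv[OF uH, of k] by (simp add: borel_measurable_times)
    qed
    show "(\<lambda>p :: 'd heis. 16 *\<^sub>R lift 3 \<Psi> p - (16 * c0) *\<^sub>R lift 1 (\<lambda>y. y *\<^sub>R \<Psi> y) p) \<in> borel_measurable lebesgue"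
      by (intro borel_measurable_integrable Bochner_Integration.integrable_diff integrable_scaleR_right i3 i1)
  qed
  also have "\<dots> = 16 *\<^sub>R (LINT p|lebesgue. lift 3 \<Psi> (p :: 'd heis)) - (16 * c0) *\<^sub>R ?I"
    by (simp only: Bochner_Integration.integral_diff[OF integrable_scaleR_right[OF i3] integrable_scaleR_right[OF i1]] integral_scaleR_right)
  \<comment> \<open>The mean of \<open>R\<^sup>2/N\<close> for the weight \<open>R\<close> that \<open>|\<nabla>N|\<^sup>2\<close> carries.\<close>
  also have "(LINT p|lebesgue. lift 3 \<Psi> (p :: 'd heis)) = ((d + 1) / (d + 2)) *\<^sub>R ?I"
  proof -
    have "(d + 1) *\<^sub>R ?I = (d + 2) *\<^sub>R (LINT p|lebesgue. lift 3 \<Psi> (p :: 'd heis))"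
      using moment_identity[OF \<Psi>, of 0, where ?'d = 'd] by (simp add: d_def)
    then have "(1 / (d + 2)) *\<^sub>R ((d + 1) *\<^sub>R ?I) = (1 / (d + 2)) *\<^sub>R ((d + 2) *\<^sub>R (LINT p|lebesgue. lift 3 \<Psi> (p :: 'd heis)))"
      by simp
    then show ?thesis using d by simp
  qed
  also have "16 *\<^sub>R (((d + 1) / (d + 2)) *\<^sub>R ?I) - (16 * c0) *\<^sub>R ?I = (16 / ((d + 1) * (d + 2))) *\<^sub>R ?I"
  proof -
    have "16 * ((d + 1) / (d + 2)) - 16 * c0 = 16 / ((d + 1) * (d + 2))"
      using d by (simp add: c0_def field_simps)
    then show ?thesis unfolding scaleR_scaleR scaleR_diff_left[symmetric] by simp
  qed
  also have "\<dots> = (1 / ((d + 1) * (d + 2))) *\<^sub>R (LINT p|lebesgue. 16 *\<^sub>R lift 1 (\<lambda>y. y *\<^sub>R \<Psi> y) (p :: 'd heis))"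
    by simp
  also have integrand: "(\<lambda>p :: 'd heis. 16 *\<^sub>R lift 1 (\<lambda>y. y *\<^sub>R \<Psi> y) p) = (\<lambda>p. complex_of_real (16 * koranyi4 p * zsq p) *
              (cnj (\<eta> (koranyi4 p) *\<^sub>R f' (koranyi4 p) + \<eta>' (koranyi4 p) *\<^sub>R f (koranyi4 p)) * f' (koranyi4 (p :: 'd heis))))"
    by (simp add: lift_def \<Psi>_def \<Phi>'_def e_def e'_def scaleR_conv_of_real fun_eq_iff algebra_simps)
  finally have grad_eq: "hgrad_inner v u = (1 / ((d + 1) * (d + 2))) *\<^sub>R
      (LINT p|lebesgue. complex_of_real (16 * koranyi4 p * zsq p) *
              (cnj (\<eta> (koranyi4 p) *\<^sub>R f' (koranyi4 p) + \<eta>' (koranyi4 p) *\<^sub>R f (koranyi4 p)) * f' (koranyi4 (p :: 'd heis))))" .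
  show "integrable lebesgue (\<lambda>p. complex_of_real (16 * koranyi4 p * zsq p) *
              (cnj (\<eta> (koranyi4 p) *\<^sub>R f' (koranyi4 p) + \<eta>' (koranyi4 p) *\<^sub>R f (koranyi4 p)) * f' (koranyi4 (p :: 'd heis))))"
    unfolding integrand[symmetric] by (intro integrable_scaleR_right i1)
  have L2_zero: "L2_inner v u = 0"
  proof -
    define q where "q y = complex_of_real ((norm (f y))\<^sup>2)" for y
    define q' where "q' y = complex_of_real (2 * Re (cnj (f y) * f' y))" for y
    have q: "(q has_vector_derivative q' y) (at y)" if "y > 0" for y
      unfolding q_def q'_def by (rule abs_square_profile(1)[OF _ f(2) that]) (rule f(1))
    have q'c: "continuous_on {0<..} q'"
      unfolding q'_def by (rule abs_square_profile(2)[OF _ f(2)]) (rule f(1))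
    define F F' where "F y = inverse y *\<^sub>R q y" and "F' y = inverse y *\<^sub>R q' y - (inverse y)\<^sup>2 *\<^sub>R q y" for y
    have F: "(F has_vector_derivative F' y) (at y)" if "y > 0" for y
      unfolding F_def F'_def by (rule inverse_profile(1)[OF _ q'c that]) (rule q)
    have F'c: "continuous_on {0<..} F'"
      unfolding F'_def by (rule inverse_profile(2)[OF _ q'c]) (rule q)
    have prof: "annular (\<lambda>y. e y * F y)" "Ck 1 (\<lambda>y. e y * F y)"
      by (rule annular_profile_mult[OF e _ F'c], rule F, assumption)+
    have j2: "integrable lebesgue (lift 2 (\<lambda>y. e y * F y) :: 'd heis \<Rightarrow> complex)"
      by (rule integrable_lift[OF prof(1) Ck_imp_continuous[OF prof(2)]])
    have j0: "integrable lebesgue (lift 0 (\<lambda>y. y *\<^sub>R (e y * F y)) :: 'd heis \<Rightarrow> complex)"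
      by (rule integrable_lift[OF annular_mult_id[OF prof(1)] continuous_on_scaleR[OF continuous_on_id Ck_imp_continuous[OF prof(2)]]])
    have "L2_inner v u = (LINT p|lebesgue. lift 2 (\<lambda>y. e y * F y) (p :: 'd heis) - c0 *\<^sub>R lift 0 (\<lambda>y. y *\<^sub>R (e y * F y)) p)"
      unfolding L2_inner_def
    proof (rule integral_cong_AE)
      have "v \<in> borel_measurable lebesgue"
        by (rule borel_measurable_integrable[OF continuous_bounded_support_integrable[OF Ck_imp_continuous[OF v(1)] v(2)]])
      then have "(\<lambda>p. cnj (v p)) \<in> borel_measurable lebesgue"
        by (rule measurable_compose) (intro borel_measurable_continuous_onI continuous_intros)
      then show "(\<lambda>p. cnj (v p) * u p) \<in> borel_measurable lebesgue" by (intro borel_measurable_times um)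
      show "(\<lambda>p :: 'd heis. lift 2 (\<lambda>y. e y * F y) p - c0 *\<^sub>R lift 0 (\<lambda>y. y *\<^sub>R (e y * F y)) p) \<in> borel_measurable lebesgue"
        by (intro borel_measurable_integrable Bochner_Integration.integrable_diff integrable_scaleR_right j2 j0)
      show "AE p in lebesgue. cnj (v p) * u p = lift 2 (\<lambda>y. e y * F y) p - c0 *\<^sub>R lift 0 (\<lambda>y. y *\<^sub>R (e y * F y)) p"
        using u AE_koranyi4_pos
      proof eventually_elim
        case (elim p)
        define n where "n = koranyi4 p"
        have n: "n > 0" using elim(2) by (simp add: n_def)
        have q_eq: "cnj (f n) * f n = q n" unfolding q_def complex_norm_square by (rule mult.commute)
        have "cnj (v p) * u p = complex_of_real (((zsq p)\<^sup>2 / n - c0) * \<eta> n) * (cnj (f n) * f n)"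
          unfolding v_eq elim(1) n_def[symmetric] by (simp add: mult_ac)
        also have "\<dots> = lift 2 (\<lambda>y. e y * F y) p - c0 *\<^sub>R lift 0 (\<lambda>y. y *\<^sub>R (e y * F y)) p"
          unfolding q_eq lift_def n_def[symmetric] F_def e_def scaleR_conv_of_real using n by (simp add: field_simps)
        finally show ?case .
      qed
    qed
    also have "\<dots> = (LINT p|lebesgue. lift 2 (\<lambda>y. e y * F y) (p :: 'd heis)) - c0 *\<^sub>R (LINT p|lebesgue. lift 0 (\<lambda>y. y *\<^sub>R (e y * F y)) (p :: 'd heis))"
      by (simp only: Bochner_Integration.integral_diff[OF j2 integrable_scaleR_right[OF j0]] integral_scaleR_right)
    also have "\<dots> = 0"
    proof -
      \<comment> \<open>The mean of \<open>R\<^sup>2/N\<close> without weight; the constant in the multiplier is chosen to cancel it.\<close>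
      have "d *\<^sub>R (LINT p|lebesgue. lift 0 (\<lambda>y. y *\<^sub>R (e y * F y)) (p :: 'd heis)) = (d + 1) *\<^sub>R (LINT p|lebesgue. lift 2 (\<lambda>y. e y * F y) (p :: 'd heis))"
        using moment_identity_C1[OF prof, of 0, where ?'d = 'd] by (simp add: d_def numeral_2_eq_2)
      then have "(1 / (d + 1)) *\<^sub>R (d *\<^sub>R (LINT p|lebesgue. lift 0 (\<lambda>y. y *\<^sub>R (e y * F y)) (p :: 'd heis)))
          = (1 / (d + 1)) *\<^sub>R ((d + 1) *\<^sub>R (LINT p|lebesgue. lift 2 (\<lambda>y. e y * F y) (p :: 'd heis)))" by simp
      then show ?thesis using d by (simp add: c0_def)
    qed
    finally show ?thesis .
  qed
  have "hgrad_inner v u + L2_inner v (\<lambda>p. V p * u p) = ev * L2_inner v u"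
    using sol vH1(1) unfolding weak_solution_def by blast
  then have "hgrad_inner v u = - L2_inner v (\<lambda>p. V p * u p)"
    unfolding L2_zero by (simp add: eq_neg_iff_add_eq_0)
  then have "norm (hgrad_inner v u) = norm (L2_inner v (\<lambda>p. V p * u p))" by simp
  also have "\<dots> \<le> (LINT p|lebesgue. norm (cnj (v p) * (V p * u p)))"
    unfolding L2_inner_def by (rule integral_norm_bound)
  also have "(\<lambda>p. norm (cnj (v p) * (V p * u p))) = (\<lambda>p. norm (((zsq p)\<^sup>2 / koranyi4 p - c0) * \<eta> (koranyi4 p)) * norm (f (koranyi4 p)) * (norm (V p) * norm (u p)))"
    unfolding v_eq norm_mult complex_mod_cnj norm_of_real by (simp only: norm_mult real_norm_def abs_mult)
  finally have "norm (hgrad_inner v u) \<le> (LINT p|lebesgue. norm (((zsq p)\<^sup>2 / koranyi4 p - c0) * \<eta> (koranyi4 p)) * norm (f (koranyi4 p)) * (norm (V p) * norm (u p)))" .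
  then show "norm (LINT p|lebesgue. complex_of_real (16 * koranyi4 p * zsq p) *
              (cnj (\<eta> (koranyi4 p) *\<^sub>R f' (koranyi4 p) + \<eta>' (koranyi4 p) *\<^sub>R f (koranyi4 p)) * f' (koranyi4 (p :: 'd heis))))
           / ((d + 1) * (d + 2))
         \<le> (LINT p|lebesgue. norm (((zsq p)\<^sup>2 / koranyi4 p - c0) * \<eta> (koranyi4 p)) * norm (f (koranyi4 p)) * (norm (V p) * norm (u p)))"
    unfolding grad_eq using d by simp
qed

text \<open>
  With the weight \<open>R\<close>, the means of \<open>R\<^sup>2/N\<close> and \<open>R\<^sup>4/N\<^sup>2\<close> over spheres are \<open>(d+1)/(d+2)\<close> and
  \<open>(d+1)(d+3)/((d+2)(d+4))\<close>, by \<open>moment_identity\<close> with \<open>m = 0\<close> and \<open>m = 2\<close>.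
\<close>

lemma multiplier_square_integral:
  fixes f :: "real \<Rightarrow> complex" and \<eta> :: "real \<Rightarrow> real"
  defines "d \<equiv> real CARD('d::finite)"
  assumes f: "continuous_on {0<..} f" and \<eta>: "annular \<eta>" "continuous_on UNIV \<eta>"
  shows "integrable lebesgue (\<lambda>p :: 'd heis. (((zsq p)\<^sup>2 / koranyi4 p - d / (d + 1)) * \<eta> (koranyi4 p))\<^sup>2 * hardy_density f p)"
    and "integrable lebesgue (\<lambda>p :: 'd heis. (\<eta> (koranyi4 p))\<^sup>2 * hardy_density f p)"
    and "(LINT p|lebesgue. (((zsq p)\<^sup>2 / koranyi4 p - d / (d + 1)) * \<eta> (koranyi4 p))\<^sup>2 * hardy_density f (p :: 'd heis))
           = (2 * d\<^sup>2 + 2 * d + 3) / ((d + 4) * (d + 2) * (d + 1)\<^sup>2)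
             * (LINT p|lebesgue. (\<eta> (koranyi4 p))\<^sup>2 * hardy_density f (p :: 'd heis))"
proof -
  have d: "d > 0" by (simp add: d_def)
  define c0 where "c0 = d / (d + 1)"
  \<comment> \<open>The power \<open>y\<^bsup>-3\<^esup>\<close> combines the denominators of \<open>(R\<^sup>2/N)\<^sup>2\<close> and of the Hardy density.\<close>
  define \<Omega> where "\<Omega> y = complex_of_real (\<eta> y) * complex_of_real (\<eta> y * (norm (f y))\<^sup>2 / y ^ 3)" for y
  have \<Omega>: "annular \<Omega>" "continuous_on UNIV \<Omega>"
  proof -
    show "annular \<Omega>" by (rule annular_mono[OF \<eta>(1)]) (simp add: \<Omega>_def)
    show "continuous_on UNIV \<Omega>"
      unfolding \<Omega>_def
    proof (rule annular_mult_continuous)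
      show "annular (\<lambda>y. complex_of_real (\<eta> y))" by (rule annular_mono[OF \<eta>(1)]) simp
      show "continuous_on UNIV (\<lambda>y. complex_of_real (\<eta> y))" by (intro continuous_on_of_real \<eta>(2))
      show "continuous_on {0<..} (\<lambda>y. complex_of_real (\<eta> y * (norm (f y))\<^sup>2 / y ^ 3))"
        by (intro continuous_intros f continuous_on_subset[OF \<eta>(2)]) auto
    qed
  qed
  let ?\<Omega>1 = "\<lambda>y. y *\<^sub>R \<Omega> y"
  let ?\<Omega>2 = "\<lambda>y. y *\<^sub>R (y *\<^sub>R \<Omega> y)"
  have \<Omega>1: "annular ?\<Omega>1" "continuous_on UNIV ?\<Omega>1"
    by (rule annular_mult_id[OF \<Omega>(1)], rule continuous_on_scaleR[OF continuous_on_id \<Omega>(2)])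
  have \<Omega>2: "annular ?\<Omega>2" "continuous_on UNIV ?\<Omega>2"
    by (rule annular_mult_id[OF \<Omega>1(1)], rule continuous_on_scaleR[OF continuous_on_id \<Omega>1(2)])
  have i5: "integrable lebesgue (lift 5 \<Omega> :: 'd heis \<Rightarrow> complex)" by (rule integrable_lift[OF \<Omega>])
  have i3: "integrable lebesgue (lift 3 ?\<Omega>1 :: 'd heis \<Rightarrow> complex)" by (rule integrable_lift[OF \<Omega>1])
  have i1: "integrable lebesgue (lift 1 ?\<Omega>2 :: 'd heis \<Rightarrow> complex)" by (rule integrable_lift[OF \<Omega>2])
  let ?I = "LINT p|lebesgue. lift 1 ?\<Omega>2 (p :: 'd heis)"
  let ?J = "LINT p|lebesgue. lift 3 ?\<Omega>1 (p :: 'd heis)"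
  let ?K = "LINT p|lebesgue. lift 5 \<Omega> (p :: 'd heis)"
  have low: "lift 1 ?\<Omega>2 p = complex_of_real ((\<eta> (koranyi4 p))\<^sup>2 * hardy_density f p)" for p :: "'d heis"
  proof (cases "koranyi4 p > 0")
    case True
    then show ?thesis
      unfolding lift_def \<Omega>_def hardy_density_def scaleR_conv_of_real of_real_mult[symmetric]
      by (intro arg_cong[where f = complex_of_real]) (simp add: field_simps power2_eq_square power3_eq_cube)
  next
    case False
    then have "zsq p = 0" by (rule zsq_eq_0_if_koranyi4_nonpos)
    then show ?thesis by (simp add: lift_def hardy_density_def)
  qed
  have full: "lift 5 \<Omega> p - (2 * c0) *\<^sub>R lift 3 ?\<Omega>1 p + c0\<^sup>2 *\<^sub>R lift 1 ?\<Omega>2 p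
      = complex_of_real ((((zsq p)\<^sup>2 / koranyi4 p - c0) * \<eta> (koranyi4 p))\<^sup>2 * hardy_density f p)" for p :: "'d heis"
  proof (cases "koranyi4 p > 0")
    case True
    then show ?thesis
      unfolding lift_def \<Omega>_def hardy_density_def scaleR_conv_of_real of_real_mult[symmetric] of_real_diff[symmetric] of_real_add[symmetric]
      by (intro arg_cong[where f = complex_of_real]) (simp add: field_simps power2_eq_square eval_nat_numeral)
  next
    case False
    then have "zsq p = 0" by (rule zsq_eq_0_if_koranyi4_nonpos)
    then show ?thesis by (simp add: lift_def hardy_density_def)
  qed
  show lowi: "integrable lebesgue (\<lambda>p :: 'd heis. (\<eta> (koranyi4 p))\<^sup>2 * hardy_density f p)"
    using i1 unfolding low by (rule complex_of_real_integrable_eq[THEN iffD1])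
  have "integrable lebesgue (\<lambda>p :: 'd heis. lift 5 \<Omega> p - (2 * c0) *\<^sub>R lift 3 ?\<Omega>1 p + c0\<^sup>2 *\<^sub>R lift 1 ?\<Omega>2 p)"
    by (intro Bochner_Integration.integrable_add Bochner_Integration.integrable_diff integrable_scaleR_right i1 i3 i5)
  then have fulli: "integrable lebesgue (\<lambda>p :: 'd heis. (((zsq p)\<^sup>2 / koranyi4 p - c0) * \<eta> (koranyi4 p))\<^sup>2 * hardy_density f p)"
    unfolding full by (rule complex_of_real_integrable_eq[THEN iffD1])
  then show "integrable lebesgue (\<lambda>p :: 'd heis. (((zsq p)\<^sup>2 / koranyi4 p - d / (d + 1)) * \<eta> (koranyi4 p))\<^sup>2 * hardy_density f p)"
    unfolding c0_def .
  have I: "?I = complex_of_real (LINT p|lebesgue. (\<eta> (koranyi4 p))\<^sup>2 * hardy_density f (p :: 'd heis))"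
    unfolding low by (rule integral_of_real[OF lowi])
  have m1: "(d + 1) *\<^sub>R ?I = (d + 2) *\<^sub>R ?J"
    using moment_identity[OF \<Omega>1, of 0, where ?'d = 'd] by (simp add: d_def)
  have m2: "(d + 3) *\<^sub>R ?J = (d + 4) *\<^sub>R ?K"
    using moment_identity[OF \<Omega>, of 2, where ?'d = 'd] by (simp add: d_def add.assoc)
  have J: "?J = ((d + 1) / (d + 2)) *\<^sub>R ?I"
  proof -
    have "?J = (1 / (d + 2)) *\<^sub>R ((d + 2) *\<^sub>R ?J)" using d by simp
    then show ?thesis unfolding m1[symmetric] by simp
  qed
  have K: "?K = ((d + 3) / (d + 4) * ((d + 1) / (d + 2))) *\<^sub>R ?I"
  proof -
    have "?K = (1 / (d + 4)) *\<^sub>R ((d + 4) *\<^sub>R ?K)" using d by simp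
    then show ?thesis unfolding m2[symmetric] J by simp
  qed
  have "complex_of_real (LINT p|lebesgue. (((zsq p)\<^sup>2 / koranyi4 p - c0) * \<eta> (koranyi4 p))\<^sup>2 * hardy_density f (p :: 'd heis))
      = (LINT p|lebesgue. lift 5 \<Omega> (p :: 'd heis) - (2 * c0) *\<^sub>R lift 3 ?\<Omega>1 p + c0\<^sup>2 *\<^sub>R lift 1 ?\<Omega>2 p)"
    unfolding full by (rule integral_of_real[OF fulli, symmetric])
  also have "\<dots> = ?K - (2 * c0) *\<^sub>R ?J + c0\<^sup>2 *\<^sub>R ?I"
    by (simp only: Bochner_Integration.integral_add[OF Bochner_Integration.integrable_diff[OF i5 integrable_scaleR_right[OF i3]] integrable_scaleR_right[OF i1]]
        Bochner_Integration.integral_diff[OF i5 integrable_scaleR_right[OF i3]] integral_scaleR_right)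
  also have "\<dots> = ((d + 3) / (d + 4) * ((d + 1) / (d + 2)) - 2 * c0 * ((d + 1) / (d + 2)) + c0\<^sup>2) *\<^sub>R ?I"
    unfolding J K scaleR_add_left scaleR_diff_left scaleR_scaleR ..
  also have "(d + 3) / (d + 4) * ((d + 1) / (d + 2)) - 2 * c0 * ((d + 1) / (d + 2)) + c0\<^sup>2
      = (2 * d\<^sup>2 + 2 * d + 3) / ((d + 4) * (d + 2) * (d + 1)\<^sup>2)"
  proof -
    have nz: "d + 1 \<noteq> 0" "d + 2 \<noteq> 0" "d + 4 \<noteq> 0" using d by auto
    have e1: "2 * c0 * ((d + 1) / (d + 2)) = 2 * d / (d + 2)" unfolding c0_def using nz by simp
    have e2: "(d + 3) / (d + 4) * ((d + 1) / (d + 2)) - 2 * d / (d + 2) = (3 - d\<^sup>2 - 4 * d) / ((d + 4) * (d + 2))"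
      using nz by (simp add: divide_simps) (simp add: algebra_simps power2_eq_square)
    have e3: "(3 - d\<^sup>2 - 4 * d) / ((d + 4) * (d + 2)) + c0\<^sup>2 = (2 * d\<^sup>2 + 2 * d + 3) / ((d + 4) * (d + 2) * (d + 1)\<^sup>2)"
      unfolding c0_def power_divide using nz by (simp add: divide_simps) (simp add: algebra_simps power2_eq_square)
    show ?thesis unfolding e1 e2 e3 ..
  qed
  finally show "(LINT p|lebesgue. (((zsq p)\<^sup>2 / koranyi4 p - d / (d + 1)) * \<eta> (koranyi4 p))\<^sup>2 * hardy_density f (p :: 'd heis))
           = (2 * d\<^sup>2 + 2 * d + 3) / ((d + 4) * (d + 2) * (d + 1)\<^sup>2)
             * (LINT p|lebesgue. (\<eta> (koranyi4 p))\<^sup>2 * hardy_density f (p :: 'd heis))"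
    unfolding I c0_def[symmetric]
    unfolding scaleR_conv_of_real of_real_mult[symmetric] by (simp only: of_real_eq_iff)
qed

text \<open>
  Equivalent to \<open>c\<^sub>2 b\<^sup>2 < c\<^sub>1\<^sup>2 d\<^sup>2\<close>, and \<open>b < 1/4\<close> leaves the polynomial inequality \<open>(2d\<^sup>2 + 2d
  + 3)(d + 2) \<le> 16 d\<^sup>2 (d + 4)\<close>.
\<close>

lemma contraction_constant:
  fixes d b :: real
  assumes "1 \<le> d" "0 < b" "b < 1 / 4"
  defines "c1 \<equiv> 1 / ((d + 1) * (d + 2))"
  defines "c2 \<equiv> (2 * d\<^sup>2 + 2 * d + 3) / ((d + 4) * (d + 2) * (d + 1)\<^sup>2)"
  shows "c1 / 2 + c2 * b\<^sup>2 / (2 * c1 * d\<^sup>2) < c1"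
proof -
  have pos: "c1 > 0" "d > 0" using assms(1) by (auto simp: c1_def)
  have c2pos: "c2 > 0" using pos(2) unfolding c2_def by (intro divide_pos_pos mult_pos_pos add_pos_pos) auto
  have "b\<^sup>2 < (1 / 4)\<^sup>2" using assms(2,3) by (intro power_strict_mono) auto
  then have "c2 * b\<^sup>2 < c2 * (1 / 16)" using c2pos by (intro mult_strict_left_mono) (auto simp: power2_eq_square)
  also have "c2 * (1 / 16) \<le> c1\<^sup>2 * d\<^sup>2"
  proof -
    have cancel1: "X * k / (16 * a * k\<^sup>2 * e) = X / (a * k * e) * (1 / 16)" if "k \<noteq> 0" for X k a e :: real
      using that by (simp add: power2_eq_square)
    have cancel2: "16 * D * a / (16 * a * k * e) = 1 / (e * k) * D" if "a \<noteq> 0" for D k a e :: real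
      using that by (simp add: mult_ac)
    have "(2 * d\<^sup>2 + 2 * d + 3) * (d + 2) \<le> 16 * d\<^sup>2 * (d + 4)"
    proof -
      have "1 \<le> d * d" "d \<le> d * d" "0 \<le> d * d * d"
        using mult_mono[of 1 d 1 d] mult_left_mono[of 1 d d] assms(1) by auto
      then show ?thesis by (simp add: algebra_simps power2_eq_square)
    qed
    then have "(2 * d\<^sup>2 + 2 * d + 3) * (d + 2) / (16 * (d + 4) * (d + 2)\<^sup>2 * (d + 1)\<^sup>2)
        \<le> 16 * d\<^sup>2 * (d + 4) / (16 * (d + 4) * (d + 2)\<^sup>2 * (d + 1)\<^sup>2)"
      using pos(2) by (intro divide_right_mono) auto
    moreover have "(2 * d\<^sup>2 + 2 * d + 3) * (d + 2) / (16 * (d + 4) * (d + 2)\<^sup>2 * (d + 1)\<^sup>2) = c2 * (1 / 16)"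
      unfolding c2_def by (rule cancel1) (use pos(2) in simp)
    moreover have "16 * d\<^sup>2 * (d + 4) / (16 * (d + 4) * (d + 2)\<^sup>2 * (d + 1)\<^sup>2) = c1\<^sup>2 * d\<^sup>2"
      unfolding c1_def power_divide power_mult_distrib power_one by (rule cancel2) (use pos(2) in simp)
    ultimately show ?thesis by simp
  qed
  finally have "c2 * b\<^sup>2 / (2 * c1 * d\<^sup>2) < c1\<^sup>2 * d\<^sup>2 / (2 * c1 * d\<^sup>2)"
    using pos by (intro divide_strict_right_mono) auto
  also have "c1\<^sup>2 * d\<^sup>2 / (2 * c1 * d\<^sup>2) = c1 / 2" using pos by (simp add: power2_eq_square)
  finally show ?thesis by linarith
qed

text \<open>
  The error made by the cut-off in the energy is supported where the cut-off is not identically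
  one, and is bounded there by the two densities, as \<open>N |\<eta>'(N)|\<close> is at most \<open>8\<close>. Both densities
  are integrable, so the error vanishes in the limit.
\<close>

lemma cutoff_energy_lower_bound:
  fixes m N R h h' :: real and x x' :: complex
  assumes pos: "N > 0" "R \<ge> 0" "m > 0"
    and h': "\<bar>h'\<bar> \<le> 2 * m * indicat_real {1 / m..2 / m} N + 2 / m * indicat_real {m..2 * m} N"
  shows "h * (16 * N * R * (norm x')\<^sup>2)
           - indicat_real (- {2 / m<..<m}) N * (64 * (R / N * (norm x)\<^sup>2) + 4 * (16 * N * R * (norm x')\<^sup>2))
         \<le> Re (complex_of_real (16 * N * R) * (cnj (h *\<^sub>R x' + h' *\<^sub>R x) * x'))"
proof -
  define A B where "A = norm x" and "B = norm x'"
  have AB: "A \<ge> 0" "B \<ge> 0" by (simp_all add: A_def B_def)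
  let ?i = "indicat_real (- {2 / m<..<m}) N"
  have Nh: "N * \<bar>h'\<bar> \<le> 8 * ?i"
  proof -
    have "N * \<bar>h'\<bar> \<le> N * (2 * m * indicat_real {1 / m..2 / m} N + 2 / m * indicat_real {m..2 * m} N)"
      using h' pos(1) by (intro mult_left_mono) auto
    also have "\<dots> = N * (2 * m) * indicat_real {1 / m..2 / m} N + N * (2 / m) * indicat_real {m..2 * m} N"
      by (simp add: algebra_simps)
    also have "\<dots> \<le> 4 * ?i + 4 * ?i"
    proof (rule add_mono)
      show "N * (2 * m) * indicat_real {1 / m..2 / m} N \<le> 4 * ?i"
        using pos by (auto simp: indicator_def field_simps)
      show "N * (2 / m) * indicat_real {m..2 * m} N \<le> 4 * ?i"
        using pos by (auto simp: indicator_def field_simps)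
    qed
    finally show ?thesis by simp
  qed
  have am: "2 * (A * B) \<le> A\<^sup>2 / N + N * B\<^sup>2"
  proof -
    have "0 \<le> (1 / N) * (A - N * B)\<^sup>2" using pos by simp
    also have "\<dots> = A\<^sup>2 / N + N * B\<^sup>2 - 2 * (A * B)" using pos by (simp add: field_simps power2_eq_square)
    finally show ?thesis by simp
  qed
  have "- (16 * N * R * (\<bar>h'\<bar> * (A * B))) \<le> 16 * N * R * (h' * Re (cnj x * x'))"
  proof -
    have "\<bar>h' * Re (cnj x * x')\<bar> \<le> \<bar>h'\<bar> * (A * B)"
      using abs_Re_le_cmod[of "cnj x * x'"] unfolding abs_mult A_def B_def by (intro mult_left_mono) (auto simp: norm_mult)
    then have "- (\<bar>h'\<bar> * (A * B)) \<le> h' * Re (cnj x * x')" by linarith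
    then have "16 * N * R * - (\<bar>h'\<bar> * (A * B)) \<le> 16 * N * R * (h' * Re (cnj x * x'))"
      using pos by (intro mult_left_mono) auto
    then show ?thesis by simp
  qed
  moreover have "16 * N * R * (\<bar>h'\<bar> * (A * B)) \<le> ?i * (64 * (R / N * A\<^sup>2) + 4 * (16 * N * R * B\<^sup>2))"
  proof -
    have "16 * N * R * (\<bar>h'\<bar> * (A * B)) = (N * \<bar>h'\<bar>) * (8 * R * (2 * (A * B)))" by simp
    also have "\<dots> \<le> (8 * ?i) * (8 * R * (A\<^sup>2 / N + N * B\<^sup>2))"
    proof (rule mult_mono[OF Nh])
      show "8 * R * (2 * (A * B)) \<le> 8 * R * (A\<^sup>2 / N + N * B\<^sup>2)"
        using am pos(2) by (intro mult_left_mono) auto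
      show "0 \<le> 8 * R * (2 * (A * B))" using pos(2) AB by simp
    qed simp
    also have "\<dots> = ?i * (64 * (R / N * A\<^sup>2) + 4 * (16 * N * R * B\<^sup>2))" by (simp add: algebra_simps)
    finally show ?thesis .
  qed
  moreover have "Re (complex_of_real (16 * N * R) * (cnj (h *\<^sub>R x' + h' *\<^sub>R x) * x'))
      = h * (16 * N * R * B\<^sup>2) + 16 * N * R * (h' * Re (cnj x * x'))"
    unfolding B_def cmod_power2 by (simp add: algebra_simps power2_eq_square)
  ultimately show ?thesis unfolding A_def[symmetric] B_def[symmetric] by linarith
qed

theorem theorem2:
  fixes V :: "'d::finite heis \<Rightarrow> complex" and b :: real
  assumes "V \<in> borel_measurable lebesgue"
    and "\<exists>a<1. form_bounded (\<lambda>p. norm (V p)) a"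
    and "form_bounded
           (\<lambda>p. koranyi_norm p ^ 4 / (norm (fst p))\<^sup>2 * (norm (V p))\<^sup>2) (b\<^sup>2)"
    and "b > 0"
    and "b < 1 / (real CARD('d) * kappa CARD('d))"
  shows "\<forall>ev u. weak_solution V ev u \<longrightarrow>
           (\<exists>g. radial g \<and> (AE p in lebesgue. u p = g p)) \<longrightarrow>
           (AE p in lebesgue. u p = 0)"
proof (intro allI impI)
  fix ev u
  assume sol: "weak_solution V ev u" and "\<exists>g. radial g \<and> (AE p in lebesgue. u p = g p)"
  then obtain g where g: "radial g" "AE p in lebesgue. u p = g p" by blast
  let ?d = "real CARD('d)"
  have d: "1 \<le> ?d" by (simp add: Suc_le_eq)
  note V = assms(1)
  have b4: "b < 1 / 4"
  proof -
    have "4 \<le> ?d * kappa CARD('d)" using kappa_lower_bound[of "CARD('d)"] d by (simp add: field_simps)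
    then have "1 / (?d * kappa CARD('d)) \<le> 1 / 4" by (intro divide_left_mono) auto
    then show ?thesis using assms(5) by linarith
  qed
  have uH: "u \<in> H1" using sol by (simp add: weak_solution_def)
  then have uL2: "u \<in> L2" by (simp add: H1_def)
  have "koranyi_norm p ^ 4 = koranyi4 p" for p :: "'d heis"
    unfolding koranyi_norm_eq by (simp add: koranyi4_nonneg)
  then have weight: "koranyi_norm p ^ 4 / (norm (fst p))\<^sup>2 * (norm (V p))\<^sup>2 * (norm (u p))\<^sup>2
      = koranyi4 p / zsq p * (norm (V p))\<^sup>2 * (norm (u p))\<^sup>2" for p
    by (simp add: zsq_def)
  define W where "W p = koranyi4 p / zsq p * (norm (V p))\<^sup>2 * (norm (u p))\<^sup>2" for p
  have W: "integrable lebesgue W" "(LINT p|lebesgue. W p) \<le> b\<^sup>2 * dirichlet_energy u"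
    unfolding W_def[abs_def] weight[symmetric]
    using assms(3)[unfolded form_bounded_def, rule_format, OF uH] by (simp_all only: simp_thms)
  have h: "annulus_integrable (\<lambda>p. (V p - ev) * u p)"
    by (rule potential_annulus_integrable[OF V uL2 W(1)[unfolded W_def[abs_def]]])
  obtain f f' where f: "\<And>y. y > 0 \<Longrightarrow> (f has_vector_derivative f' y) (at y)" "continuous_on {0<..} f'"
    and u: "AE p in lebesgue. u p = f (koranyi4 p)"
    using radial_solution_profile[OF sol V h g] by blast
  have fc: "continuous_on {0<..} f"
    by (rule continuous_on_vector_derivative[OF has_vector_derivative_at_within[OF f(1)]]) simp
  have grad: "AE p in lebesgue. weak_deriv k u p = d_koranyi4 k p *\<^sub>R f' (koranyi4 p)" for k
    by (rule radial_weak_gradient[OF uH u _ f(2)]) (rule f(1))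
  let ?e = "energy_density f' :: 'd heis \<Rightarrow> real"
  let ?s = "hardy_density f :: 'd heis \<Rightarrow> real"
  define E where "E = (LINT p|lebesgue. ?e p)"
  have ei: "integrable lebesgue ?e" and E: "dirichlet_energy u = E"
    unfolding E_def by (rule radial_dirichlet_energy[OF uH grad f(2)])+
  have E0: "E \<ge> 0" unfolding E_def by (intro integral_nonneg_AE AE_I2 energy_density_nonneg)
  have f2: "integrable lebesgue (\<lambda>p :: 'd heis. (norm (f (koranyi4 p)))\<^sup>2)"
  proof (rule integrable_cong_AE_imp)
    show "integrable lebesgue (\<lambda>p. (norm (u p))\<^sup>2)" using uL2 by (simp add: L2_def)
    show "(\<lambda>p :: 'd heis. (norm (f (koranyi4 p)))\<^sup>2) \<in> borel_measurable lebesgue"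
      by (intro borel_measurable_power measurable_compose[OF borel_measurable_profile[OF fc] borel_measurable_norm])
    show "AE p in lebesgue. (norm (u p))\<^sup>2 = (norm (f (koranyi4 p)))\<^sup>2"
      using u by eventually_elim simp
  qed
  have si: "integrable lebesgue ?s" and hardy: "(LINT p|lebesgue. ?s p) \<le> E / ?d\<^sup>2"
    unfolding E_def by (rule hardy_inequality_radial[OF _ f(2) f2 ei], rule f(1), assumption)+
  define c1 where "c1 = 1 / ((?d + 1) * (?d + 2))"
  define c2 where "c2 = (2 * ?d\<^sup>2 + 2 * ?d + 3) / ((?d + 4) * (?d + 2) * (?d + 1)\<^sup>2)"
  have c1: "c1 > 0" and c2: "c2 \<ge> 0"
    using d unfolding c1_def c2_def by (auto intro!: divide_nonneg_nonneg mult_nonneg_nonneg)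
  \<comment> \<open>The weight in the arithmetic-geometric mean inequality; with it the potential costs half of \<open>c\<^sub>1 E\<close>.\<close>
  define \<beta> where "\<beta> = c1 / b\<^sup>2"
  have \<beta>: "\<beta> > 0" using c1 assms(4) by (simp add: \<beta>_def)
  define \<theta> where "\<theta> = c1 / 2 + c2 * b\<^sup>2 / (2 * c1 * ?d\<^sup>2)"
  obtain \<eta> \<eta>' :: "nat \<Rightarrow> real \<Rightarrow> real" where \<eta>:
    "\<And>n y. (\<eta> n has_real_derivative \<eta>' n y) (at y)" "\<And>n. continuous_on UNIV (\<eta>' n)"
    "\<And>n y. 0 \<le> \<eta> n y" "\<And>n y. \<eta> n y \<le> 1" "\<And>n. annular (\<eta> n)"
    "\<And>n y. 2 / real (Suc n) \<le> y \<Longrightarrow> y \<le> real (Suc n) \<Longrightarrow> \<eta> n y = 1 \<and> \<eta>' n y = 0"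
    "\<And>n y. \<bar>\<eta>' n y\<bar> \<le> 2 * real (Suc n) * indicat_real {1 / real (Suc n)..2 / real (Suc n)} y
        + 2 / real (Suc n) * indicat_real {real (Suc n)..2 * real (Suc n)} y"
    by (rule ex_cutoffs) blast
  have \<eta>c: "continuous_on UNIV (\<eta> n)" for n
    by (rule DERIV_continuous_on[OF has_field_derivative_at_within[OF \<eta>(1)]])
  define J where "J n p = complex_of_real (16 * koranyi4 p * zsq p) *
      (cnj (\<eta> n (koranyi4 p) *\<^sub>R f' (koranyi4 p) + \<eta>' n (koranyi4 p) *\<^sub>R f (koranyi4 p)) * f' (koranyi4 p))" for n and p :: "'d heis"
  define Q where "Q n p = norm (((zsq p)\<^sup>2 / koranyi4 p - ?d / (?d + 1)) * \<eta> n (koranyi4 p)) * norm (f (koranyi4 p)) * (norm (V p) * norm (u p))" for n and p :: "'d heis"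
  have Ji: "integrable lebesgue (J n)" and JQ: "norm (LINT p|lebesgue. J n p) * c1 \<le> (LINT p|lebesgue. Q n p)" for n
  proof -
    show "integrable lebesgue (J n)"
      unfolding J_def by (rule multiplier_test(1)[OF sol V u _ f(2) grad \<eta>(5,1,2)]) (rule f(1))
    have "norm (LINT p|lebesgue. J n p) / ((?d + 1) * (?d + 2)) \<le> (LINT p|lebesgue. Q n p)"
      unfolding J_def Q_def by (rule multiplier_test(2)[OF sol V u _ f(2) grad \<eta>(5,1,2)]) (rule f(1))
    then show "norm (LINT p|lebesgue. J n p) * c1 \<le> (LINT p|lebesgue. Q n p)" by (simp add: c1_def)
  qed
  have Qle: "(LINT p|lebesgue. Q n p) \<le> \<theta> * E" for n
  proof -
    let ?q = "\<lambda>p :: 'd heis. ((zsq p)\<^sup>2 / koranyi4 p - ?d / (?d + 1)) * \<eta> n (koranyi4 p)"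
    note sq = multiplier_square_integral[OF fc \<eta>(5)[of n] \<eta>c[of n], where ?'d = 'd]
    have "(LINT p|lebesgue. Q n p) \<le> (LINT p|lebesgue. \<beta> / 2 * W p + 1 / (2 * \<beta>) * ((?q p)\<^sup>2 * ?s p))"
    proof (rule integral_mono_AE')
      show "integrable lebesgue (\<lambda>p. \<beta> / 2 * W p + 1 / (2 * \<beta>) * ((?q p)\<^sup>2 * ?s p))"
        by (intro Bochner_Integration.integrable_add integrable_mult_right W(1) sq(1))
      show "AE p in lebesgue. 0 \<le> \<beta> / 2 * W p + 1 / (2 * \<beta>) * ((?q p)\<^sup>2 * ?s p)"
        using \<beta> by (intro AE_I2 add_nonneg_nonneg mult_nonneg_nonneg hardy_density_nonneg)
          (auto simp: W_def koranyi4_nonneg zsq_nonneg)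
      show "AE p in lebesgue. Q n p \<le> \<beta> / 2 * W p + 1 / (2 * \<beta>) * ((?q p)\<^sup>2 * ?s p)"
        using AE_zsq_pos AE_koranyi4_pos
      proof eventually_elim
        case (elim p)
        define t X Y where "t = koranyi4 p / zsq p" and "X = norm (V p) * norm (u p)" and "Y = norm (?q p) * norm (f (koranyi4 p))"
        have t: "t > 0" using elim by (simp add: t_def)
        have "0 \<le> (1 / (2 * \<beta> * t)) * (\<beta> * t * X - Y)\<^sup>2" using t \<beta> by simp
        also have "\<dots> = \<beta> / 2 * (t * X\<^sup>2) + 1 / (2 * \<beta>) * (Y\<^sup>2 / t) - X * Y"
          using t \<beta> by (simp add: field_simps power2_eq_square)
        finally have "X * Y \<le> \<beta> / 2 * (t * X\<^sup>2) + 1 / (2 * \<beta>) * (Y\<^sup>2 / t)" by simp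
        moreover have "t * X\<^sup>2 = W p" by (simp add: W_def t_def X_def power_mult_distrib)
        moreover have "Y\<^sup>2 / t = (?q p)\<^sup>2 * ?s p"
          unfolding Y_def t_def hardy_density_def power_mult_distrib real_norm_def power2_abs by simp
        moreover have "Q n p = X * Y" by (simp add: Q_def X_def Y_def)
        ultimately show ?case by simp
      qed
    qed
    also have "\<dots> = \<beta> / 2 * (LINT p|lebesgue. W p) + 1 / (2 * \<beta>) * (LINT p|lebesgue. (?q p)\<^sup>2 * ?s p)"
      by (simp only: Bochner_Integration.integral_add[OF integrable_mult_right[OF W(1)] integrable_mult_right[OF sq(1)]] integral_mult_right_zero)
    also have "\<dots> \<le> \<beta> / 2 * (b\<^sup>2 * E) + 1 / (2 * \<beta>) * (c2 * (E / ?d\<^sup>2))"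
    proof (intro add_mono mult_left_mono)
      show "(LINT p|lebesgue. W p) \<le> b\<^sup>2 * E" using W(2) unfolding E .
      have "(LINT p|lebesgue. (\<eta> n (koranyi4 p))\<^sup>2 * ?s p) \<le> (LINT p|lebesgue. ?s p)"
      proof (rule integral_mono[OF sq(2) si])
        fix p :: "'d heis"
        have "(\<eta> n (koranyi4 p))\<^sup>2 \<le> 1" using \<eta>(3,4) by (simp add: power_le_one)
        then show "(\<eta> n (koranyi4 p))\<^sup>2 * ?s p \<le> ?s p"
          using mult_right_mono[OF _ hardy_density_nonneg, of _ 1] by simp
      qed
      then have "(LINT p|lebesgue. (\<eta> n (koranyi4 p))\<^sup>2 * ?s p) \<le> E / ?d\<^sup>2" using hardy by linarith
      then show "(LINT p|lebesgue. (?q p)\<^sup>2 * ?s p) \<le> c2 * (E / ?d\<^sup>2)"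
        unfolding sq(3) c2_def[symmetric] using c2 by (rule mult_left_mono)
    qed (use \<beta> in auto)
    also have "\<dots> = \<theta> * E"
      unfolding \<theta>_def \<beta>_def using assms(4) c1 by (simp add: field_simps)
    finally show ?thesis .
  qed
  define \<phi> where "\<phi> n p = indicat_real (- {2 / real (Suc n)<..<real (Suc n)}) (koranyi4 p)" for n and p :: "'d heis"
  \<comment> \<open>A lower bound for the real part of \<open>J n\<close> in which the derivative of the cut-off no longer occurs.\<close>
  define X where "X n p = \<eta> n (koranyi4 p) * ?e p - \<phi> n p * (64 * ?s p + 4 * ?e p)" for n p
  have Xlim: "(\<lambda>n. LINT p|lebesgue. X n p) \<longlonglongrightarrow> E"
    unfolding E_def
  proof (rule integral_dominated_convergence[where w = "\<lambda>p. 64 * ?s p + 5 * ?e p"])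
    show "AE p in lebesgue. (\<lambda>n. X n p) \<longlonglongrightarrow> ?e p"
      using AE_koranyi4_pos
    proof eventually_elim
      case (elim p)
      have "\<forall>\<^sub>F n in sequentially. X n p = ?e p"
        using eventually_inside_annulus[OF elim]
      proof (rule eventually_mono)
        fix n assume n: "2 / real (Suc n) < koranyi4 p \<and> koranyi4 p < real (Suc n)"
        then have "\<eta> n (koranyi4 p) = 1" using \<eta>(6)[of n "koranyi4 p"] by linarith
        moreover have "\<phi> n p = 0" using n by (simp add: \<phi>_def)
        ultimately show "X n p = ?e p" by (simp add: X_def)
      qed
      then show ?case by (rule tendsto_eventually)
    qed
    show "X n \<in> borel_measurable lebesgue" for n
    proof -
      have "(\<lambda>p :: 'd heis. \<eta> n (koranyi4 p)) \<in> borel_measurable lebesgue"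
        by (rule measurable_compose[OF borel_measurable_koranyi4 borel_measurable_continuous_onI[OF \<eta>c]])
      moreover have "\<phi> n \<in> borel_measurable lebesgue"
        unfolding \<phi>_def[abs_def] by (rule measurable_compose[OF borel_measurable_koranyi4]) simp
      ultimately show ?thesis
        unfolding X_def[abs_def]
        by (intro borel_measurable_diff borel_measurable_times borel_measurable_add borel_measurable_const
            borel_measurable_integrable[OF si] borel_measurable_integrable[OF ei])
    qed
    show "AE p in lebesgue. norm (X n p) \<le> 64 * ?s p + 5 * ?e p" for n
    proof (rule AE_I2)
      fix p :: "'d heis"
      have nn: "0 \<le> ?e p" "0 \<le> ?s p" by (rule energy_density_nonneg hardy_density_nonneg)+
      have "0 \<le> \<eta> n (koranyi4 p) * ?e p" "\<eta> n (koranyi4 p) * ?e p \<le> ?e p"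
        using \<eta>(3,4) nn by (auto intro: mult_left_le_one_le)
      moreover have "0 \<le> \<phi> n p * (64 * ?s p + 4 * ?e p)" "\<phi> n p * (64 * ?s p + 4 * ?e p) \<le> 64 * ?s p + 4 * ?e p"
        using nn by (auto simp: \<phi>_def indicator_def)
      ultimately show "norm (X n p) \<le> 64 * ?s p + 5 * ?e p" using nn unfolding X_def by (simp add: abs_le_iff)
    qed
    show "integrable lebesgue (\<lambda>p. 64 * ?s p + 5 * ?e p)"
      by (intro Bochner_Integration.integrable_add integrable_mult_right si ei)
  qed (rule borel_measurable_integrable[OF ei])
  have Xle: "(LINT p|lebesgue. X n p) \<le> \<theta> * E / c1" for n
  proof -
    have "(LINT p|lebesgue. X n p) \<le> (LINT p|lebesgue. Re (J n p))"
    proof (rule integral_mono_AE)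
      have chi: "integrable lebesgue (\<lambda>p. \<phi> n p * F p)" if "integrable lebesgue F" for F :: "'d heis \<Rightarrow> real"
      proof (rule Bochner_Integration.integrable_bound[OF that])
        show "(\<lambda>p. \<phi> n p * F p) \<in> borel_measurable lebesgue"
          unfolding \<phi>_def
          by (intro borel_measurable_times borel_measurable_integrable[OF that] measurable_compose[OF borel_measurable_koranyi4]) simp
        show "AE p in lebesgue. norm (\<phi> n p * F p) \<le> norm (F p)"
          by (rule AE_I2) (simp add: \<phi>_def indicator_def)
      qed
      have eta: "integrable lebesgue (\<lambda>p. \<eta> n (koranyi4 p) * ?e p)"
      proof (rule Bochner_Integration.integrable_bound[OF ei])
        show "(\<lambda>p :: 'd heis. \<eta> n (koranyi4 p) * ?e p) \<in> borel_measurable lebesgue"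
          by (intro borel_measurable_times borel_measurable_integrable[OF ei]
              measurable_compose[OF borel_measurable_koranyi4 borel_measurable_continuous_onI[OF \<eta>c]])
        show "AE p in lebesgue. norm (\<eta> n (koranyi4 p) * ?e p) \<le> norm (?e p)"
          using \<eta>(3,4) by (intro AE_I2) (simp add: abs_mult mult_left_le_one_le)
      qed
      show "integrable lebesgue (X n)"
        unfolding X_def[abs_def]
        by (intro Bochner_Integration.integrable_diff eta chi Bochner_Integration.integrable_add integrable_mult_right si ei)
      show "integrable lebesgue (\<lambda>p. Re (J n p))" by (rule integrable_Re[OF Ji])
      show "AE p in lebesgue. X n p \<le> Re (J n p)"
        using AE_koranyi4_pos
      proof eventually_elim
        case (elim p)
        show ?case
          unfolding X_def \<phi>_def energy_density_def hardy_density_def J_def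
          by (rule cutoff_energy_lower_bound[OF elim zsq_nonneg _ \<eta>(7)]) simp
      qed
    qed
    also have "\<dots> = Re (LINT p|lebesgue. J n p)" by (rule integral_Re[OF Ji])
    also have "\<dots> \<le> norm (LINT p|lebesgue. J n p)" by (rule complex_Re_le_cmod)
    also have "\<dots> \<le> \<theta> * E / c1"
      using JQ[of n] Qle[of n] c1 by (simp add: pos_le_divide_eq)
    finally show ?thesis .
  qed
  have "E \<le> \<theta> * E / c1"
    by (rule LIMSEQ_le_const2[OF Xlim]) (use Xle in blast)
  moreover have "\<theta> < c1"
    unfolding \<theta>_def c1_def c2_def by (rule contraction_constant[OF d assms(4) b4])
  ultimately have "E = 0"
  proof -
    assume a: "E \<le> \<theta> * E / c1" "\<theta> < c1"
    then have "(c1 - \<theta>) * E \<le> 0" using c1 by (simp add: field_simps)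
    then show "E = 0" using a(2) E0 by (simp add: mult_le_0_iff)
  qed
  then have "(LINT p|lebesgue. ?s p) \<le> 0" using hardy by simp
  moreover have "0 \<le> (LINT p|lebesgue. ?s p)" by (intro integral_nonneg_AE AE_I2 hardy_density_nonneg)
  ultimately have "(LINT p|lebesgue. ?s p) = 0" by (rule antisym)
  then have "AE p in lebesgue. ?s p = 0"
    using integral_nonneg_eq_0_iff_AE[OF si] by (simp add: hardy_density_nonneg)
  then show "AE p in lebesgue. u p = 0"
    using u AE_zsq_pos AE_koranyi4_pos by eventually_elim (simp add: hardy_density_def)
qed

end
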